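(* Let $B=R[x,x^{-1}]$ and let $[p]:B\to B$ be the $R$-algebra homomorphism with $x\mapsto x^p$ (inducing the $p$-power isogeny of $\mathbb G_m=\operatorname{Spec}B$). Then the induced morphism of Banach $\mathbb K$-algebras $P^\infty([p]):P^\infty(B)\to P^\infty(B)$ is surjective but not injective.
   Context: $p$ odd prime; $R$ a complete discrete valuation ring with maximal ideal $pR$, algebraically closed residue field, unique Frobenius lift $\phi$. $\widehat{\ }$ is $p$-adic completion. $\mathbb K^\circ$ is the $p$-adic completion of $\bigcup_mR[p^{1/p^m}]$ (compatible roots fixed), $\mathbb K=\mathbb K^\circ[1/p]$, $\Phi$ on $\mathbb K^\circ$ the automorphism extending $\phi$ and fixing the $p^{1/p^m}$. $J^\infty(R[x,x^{-1}])=R[x,x^{-1},x',x'',\dots]\widehat{\ }$ with Frobenius lift $\phi$ extending $\phi$ on $R$ by $x\mapsto x^p+px'$, $x^{(i)}\mapsto(x^{(i)})^p+px^{(i+1)}$, and $p$-derivation $\delta F=(\phi(F)-F^p)/p$. For a smooth finitely generated $R$-algebra $B$, $P^\infty(B)=\widehat{\mathcal B}[1/p]$ where $\mathcal A=J^\infty(B)\otimes_R\mathbb K^\circ$ with $\Phi=\phi\otimes\Phi$ extended to $\widehat{\mathcal A}$, and $\mathcal B=\varinjlim_\Phi\widehat{\mathcal A}$ (direct limit along $\Phi$); it is a perfectoid $\mathbb K$-algebra. A homomorphism $u:B\to B$ induces the unique $\delta$-compatible extension $J^\infty(B)\to J^\infty(B)$ and hence $P^\infty(u)$. *)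

theory Defs
  imports "HOL-Algebra.Algebraic_Closure_Type" "HOL-Algebra.Generated_Rings"
    "HOL-Library.Poly_Mapping" "HOL-Library.FuncSet"
begin

text \<open>
  Base rings live inside the field type \<open>'k\<close> (an extension of the fraction field of \<open>R\<close>
  containing the chosen roots of \<open>p\<close>); they are turned into HOL-Algebra records by restricting the
  carrier of \<^const>\<open>ring_of_type_algebra\<close>.  Every ring built afterwards is a HOL-Algebra record.
\<close>

definition sub_of_type :: "'a::ring_1 set \<Rightarrow> 'a ring" where
  "sub_of_type S = ring_of_type_algebra\<lparr>carrier := S\<rparr>"

definition p_ideal :: "nat \<Rightarrow> ('a, 'm) ring_scheme \<Rightarrow> nat \<Rightarrow> 'a set" where
  "p_ideal p A n = PIdl\<^bsub>A\<^esub> ([(p ^ n)] \<cdot>\<^bsub>A\<^esub> \<one>\<^bsub>A\<^esub>)"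

text \<open>The map induced by \<open>g\<close> on cosets, with values in the cosets of \<open>I\<close> in \<open>A\<close>: all \<open>g z\<close> with
  \<open>z \<in> U\<close> lie in a single coset of \<open>I\<close> when \<open>g\<close> is compatible with the ideals, so the union is
  that coset.\<close>

definition coset_map :: "('a, 'm) ring_scheme \<Rightarrow> 'a set \<Rightarrow> ('b \<Rightarrow> 'a) \<Rightarrow> 'b set \<Rightarrow> 'a set" where
  "coset_map A I g U = (\<Union>z\<in>U. I +>\<^bsub>A\<^esub> g z)"


section \<open>The \<open>p\<close>-adic completion, as the inverse limit of the rings \<open>A / p\<^sup>n A\<close>\<close>

definition p_completion :: "nat \<Rightarrow> ('a, 'm) ring_scheme \<Rightarrow> (nat \<Rightarrow> 'a set) ring" where
  "p_completion p A =
    \<lparr>carrier = {s. (\<forall>n. s n \<in> carrier (A Quot p_ideal p A n)) \<and> (\<forall>n. s (Suc n) \<subseteq> s n)},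
     monoid.mult = (\<lambda>s t n. s n \<otimes>\<^bsub>A Quot p_ideal p A n\<^esub> t n),
     one = (\<lambda>n. \<one>\<^bsub>A Quot p_ideal p A n\<^esub>),
     ring.zero = (\<lambda>n. \<zero>\<^bsub>A Quot p_ideal p A n\<^esub>),
     add = (\<lambda>s t n. s n \<oplus>\<^bsub>A Quot p_ideal p A n\<^esub> t n)\<rparr>"

definition to_completion :: "nat \<Rightarrow> ('a, 'm) ring_scheme \<Rightarrow> 'a \<Rightarrow> (nat \<Rightarrow> 'a set)" where
  "to_completion p A a = (\<lambda>n. p_ideal p A n +>\<^bsub>A\<^esub> a)"

definition completion_map ::
    "nat \<Rightarrow> ('a, 'm) ring_scheme \<Rightarrow> ('b \<Rightarrow> 'a) \<Rightarrow> (nat \<Rightarrow> 'b set) \<Rightarrow> (nat \<Rightarrow> 'a set)" where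
  "completion_map p A g s = (\<lambda>n. coset_map A (p_ideal p A n) g (s n))"


section \<open>The base ring\<close>

definition discrete_valuation_ring :: "('a, 'm) ring_scheme \<Rightarrow> bool" where
  "discrete_valuation_ring A \<longleftrightarrow>
     principal_domain A \<and> \<not> Ring.field A \<and> (\<exists>!M. maximalideal M A)"

definition complete_dvr_at :: "nat \<Rightarrow> ('a, 'm) ring_scheme \<Rightarrow> bool" where
  "complete_dvr_at p A \<longleftrightarrow>
     discrete_valuation_ring A \<and> maximalideal (p_ideal p A 1) A \<and>
     bij_betw (to_completion p A) (carrier A) (carrier (p_completion p A))"

definition frobenius_lift :: "nat \<Rightarrow> ('a, 'm) ring_scheme \<Rightarrow> ('a \<Rightarrow> 'a) \<Rightarrow> bool" where
  "frobenius_lift p A \<phi> \<longleftrightarrow>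
     \<phi> \<in> ring_hom A A \<and> (\<forall>a\<in>carrier A. \<phi> a \<ominus>\<^bsub>A\<^esub> a [^]\<^bsub>A\<^esub> p \<in> p_ideal p A 1)"

text \<open>\<open>\<delta> F = (\<phi> F - F\<^sup>p) / p\<close>, for \<open>A\<close> without \<open>p\<close>-torsion.\<close>

definition p_derivation :: "nat \<Rightarrow> ('a, 'm) ring_scheme \<Rightarrow> ('a \<Rightarrow> 'a) \<Rightarrow> 'a \<Rightarrow> 'a" where
  "p_derivation p A \<phi> F =
     (THE G. G \<in> carrier A \<and> [p] \<cdot>\<^bsub>A\<^esub> G = \<phi> F \<ominus>\<^bsub>A\<^esub> F [^]\<^bsub>A\<^esub> p)"


section \<open>The ring \<open>\<bbbK>\<degree>\<close> and its automorphism\<close>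

text \<open>\<open>\<pi> m\<close> is the fixed root \<open>p\<^bsup>1/p^m\<^esup>\<close>.\<close>

definition K_uncompleted :: "'k::field set \<Rightarrow> (nat \<Rightarrow> 'k) \<Rightarrow> 'k ring" where
  "K_uncompleted R \<pi> = sub_of_type (\<Union>m. generate_ring ring_of_type_algebra (insert (\<pi> m) R))"

definition K_int :: "nat \<Rightarrow> 'k::field set \<Rightarrow> (nat \<Rightarrow> 'k) \<Rightarrow> (nat \<Rightarrow> 'k set) ring" where
  "K_int p R \<pi> = p_completion p (K_uncompleted R \<pi>)"

definition to_K_int :: "nat \<Rightarrow> 'k::field set \<Rightarrow> (nat \<Rightarrow> 'k) \<Rightarrow> 'k \<Rightarrow> (nat \<Rightarrow> 'k set)" where
  "to_K_int p R \<pi> = to_completion p (K_uncompleted R \<pi>)"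

definition K_aut ::
    "nat \<Rightarrow> 'k::field set \<Rightarrow> ('k \<Rightarrow> 'k) \<Rightarrow> (nat \<Rightarrow> 'k) \<Rightarrow> (nat \<Rightarrow> 'k set) \<Rightarrow> (nat \<Rightarrow> 'k set)" where
  "K_aut p R \<phi> \<pi> =
     (THE \<Phi>. \<Phi> \<in> ring_iso (K_int p R \<pi>) (K_int p R \<pi>) \<inter> extensional (carrier (K_int p R \<pi>)) \<and>
        (\<forall>r\<in>R. \<Phi> (to_K_int p R \<pi> r) = to_K_int p R \<pi> (\<phi> r)) \<and>
        (\<forall>m. \<Phi> (to_K_int p R \<pi> (\<pi> m)) = to_K_int p R \<pi> (\<pi> m)))"


section \<open>The jet algebra \<open>J\<^sup>\<infinity>(R[x, x\<^sup>-\<^sup>1])\<close>\<close>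

text \<open>A monomial \<open>\<Prod>i. (x\<^bsup>(i)\<^esup>) ^ (e i)\<close> is encoded by its exponent vector \<open>e\<close>; only \<open>e 0\<close>,
  the exponent of \<open>x = x\<^bsup>(0)\<^esup>\<close>, may be negative.\<close>

type_synonym 'k jet_poly = "(nat \<Rightarrow>\<^sub>0 int) \<Rightarrow>\<^sub>0 'k"

definition jet_const :: "'k::field \<Rightarrow> 'k jet_poly" where
  "jet_const c = Poly_Mapping.single 0 c"

definition jet_var :: "nat \<Rightarrow> 'k::field jet_poly" where
  "jet_var i = Poly_Mapping.single (Poly_Mapping.single i 1) 1"

text \<open>\<open>B = R[x, x\<^sup>-\<^sup>1]\<close>, as a subring of \<open>R[x, x\<^sup>-\<^sup>1, x', x'', \<dots>]\<close>.\<close>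

definition laurent_ring :: "'k::field set \<Rightarrow> 'k jet_poly ring" where
  "laurent_ring R = sub_of_type
     {f. range (poly_mapping.lookup f) \<subseteq> R \<and> (\<forall>e\<in>Poly_Mapping.keys f. \<forall>i\<ge>1. poly_mapping.lookup e i = 0)}"

definition jet_poly_ring :: "'k::field set \<Rightarrow> 'k jet_poly ring" where
  "jet_poly_ring R = sub_of_type
     {f. range (poly_mapping.lookup f) \<subseteq> R \<and> (\<forall>e\<in>Poly_Mapping.keys f. \<forall>i\<ge>1. poly_mapping.lookup e i \<ge> 0)}"

definition jet_algebra :: "nat \<Rightarrow> 'k::field set \<Rightarrow> (nat \<Rightarrow> 'k jet_poly set) ring" where
  "jet_algebra p R = p_completion p (jet_poly_ring R)"

definition to_jet :: "nat \<Rightarrow> 'k::field set \<Rightarrow> 'k jet_poly \<Rightarrow> (nat \<Rightarrow> 'k jet_poly set)" where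
  "to_jet p R = to_completion p (jet_poly_ring R)"

definition jet_frob :: "nat \<Rightarrow> 'k::field set \<Rightarrow> ('k \<Rightarrow> 'k) \<Rightarrow>
    (nat \<Rightarrow> 'k jet_poly set) \<Rightarrow> (nat \<Rightarrow> 'k jet_poly set)" where
  "jet_frob p R \<phi> =
     (THE \<psi>. \<psi> \<in> ring_hom (jet_algebra p R) (jet_algebra p R) \<inter>
                   extensional (carrier (jet_algebra p R)) \<and>
        (\<forall>r\<in>R. \<psi> (to_jet p R (jet_const r)) = to_jet p R (jet_const (\<phi> r))) \<and>
        (\<forall>i. \<psi> (to_jet p R (jet_var i)) =
              to_jet p R (jet_var i ^ p + of_nat p * jet_var (Suc i))))"

definition jet_delta :: "nat \<Rightarrow> 'k::field set \<Rightarrow> ('k \<Rightarrow> 'k) \<Rightarrow>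
    (nat \<Rightarrow> 'k jet_poly set) \<Rightarrow> (nat \<Rightarrow> 'k jet_poly set)" where
  "jet_delta p R \<phi> = p_derivation p (jet_algebra p R) (jet_frob p R \<phi>)"

text \<open>\<open>J\<^sup>\<infinity>(u)\<close> for \<open>u : B \<rightarrow> B\<close>.\<close>

definition jet_map :: "nat \<Rightarrow> 'k::field set \<Rightarrow> ('k \<Rightarrow> 'k) \<Rightarrow> ('k jet_poly \<Rightarrow> 'k jet_poly) \<Rightarrow>
    (nat \<Rightarrow> 'k jet_poly set) \<Rightarrow> (nat \<Rightarrow> 'k jet_poly set)" where
  "jet_map p R \<phi> u =
     (THE v. v \<in> ring_hom (jet_algebra p R) (jet_algebra p R) \<inter>
                   extensional (carrier (jet_algebra p R)) \<and>
        (\<forall>b\<in>carrier (laurent_ring R). v (to_jet p R b) = to_jet p R (u b)) \<and>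
        (\<forall>F\<in>carrier (jet_algebra p R). v (jet_delta p R \<phi> F) = jet_delta p R \<phi> (v F)))"


section \<open>Tensor products of algebras\<close>

text \<open>The tensor product of \<open>A\<close> and \<open>C\<close> over a ring with underlying set \<open>S\<close> and structure maps
  \<open>\<alpha>\<close>, \<open>\<gamma>\<close>: the free abelian group on \<open>A \<times> C\<close>, with the product determined by
  \<open>(a, c) (a', c') = (a a', c c')\<close>, modulo the ideal of the usual relations.\<close>

definition formal_tensors ::
    "('a, 'm) ring_scheme \<Rightarrow> ('c, 'n) ring_scheme \<Rightarrow> ('a \<times> 'c \<Rightarrow>\<^sub>0 int) ring" where
  "formal_tensors A C =
    \<lparr>carrier = {z. Poly_Mapping.keys z \<subseteq> carrier A \<times> carrier C},
     monoid.mult = (\<lambda>z w. frag_extend (\<lambda>(a, c). frag_extend (\<lambda>(a', c').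
               frag_of (a \<otimes>\<^bsub>A\<^esub> a', c \<otimes>\<^bsub>C\<^esub> c')) w) z),
     one = frag_of (\<one>\<^bsub>A\<^esub>, \<one>\<^bsub>C\<^esub>),
     ring.zero = 0,
     add = (+)\<rparr>"

definition tensor_relations :: "'s set \<Rightarrow> ('s \<Rightarrow> 'a) \<Rightarrow> ('s \<Rightarrow> 'c) \<Rightarrow>
    ('a, 'm) ring_scheme \<Rightarrow> ('c, 'n) ring_scheme \<Rightarrow> ('a \<times> 'c \<Rightarrow>\<^sub>0 int) set" where
  "tensor_relations S \<alpha> \<gamma> A C =
     {frag_of (a \<oplus>\<^bsub>A\<^esub> a', c) - frag_of (a, c) - frag_of (a', c) | a a' c.
        a \<in> carrier A \<and> a' \<in> carrier A \<and> c \<in> carrier C} \<union>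
     {frag_of (a, c \<oplus>\<^bsub>C\<^esub> c') - frag_of (a, c) - frag_of (a, c') | a c c'.
        a \<in> carrier A \<and> c \<in> carrier C \<and> c' \<in> carrier C} \<union>
     {frag_of (\<alpha> s \<otimes>\<^bsub>A\<^esub> a, c) - frag_of (a, \<gamma> s \<otimes>\<^bsub>C\<^esub> c) | s a c.
        s \<in> S \<and> a \<in> carrier A \<and> c \<in> carrier C}"

definition tensor_ideal :: "'s set \<Rightarrow> ('s \<Rightarrow> 'a) \<Rightarrow> ('s \<Rightarrow> 'c) \<Rightarrow>
    ('a, 'm) ring_scheme \<Rightarrow> ('c, 'n) ring_scheme \<Rightarrow> ('a \<times> 'c \<Rightarrow>\<^sub>0 int) set" where
  "tensor_ideal S \<alpha> \<gamma> A C = Idl\<^bsub>formal_tensors A C\<^esub> (tensor_relations S \<alpha> \<gamma> A C)"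

definition tensor_ring :: "'s set \<Rightarrow> ('s \<Rightarrow> 'a) \<Rightarrow> ('s \<Rightarrow> 'c) \<Rightarrow>
    ('a, 'm) ring_scheme \<Rightarrow> ('c, 'n) ring_scheme \<Rightarrow> ('a \<times> 'c \<Rightarrow>\<^sub>0 int) set ring" where
  "tensor_ring S \<alpha> \<gamma> A C = formal_tensors A C Quot tensor_ideal S \<alpha> \<gamma> A C"

text \<open>\<open>f \<otimes> g\<close> for endomorphisms \<open>f\<close> of \<open>A\<close> and \<open>g\<close> of \<open>C\<close>.\<close>

definition tensor_map :: "'s set \<Rightarrow> ('s \<Rightarrow> 'a) \<Rightarrow> ('s \<Rightarrow> 'c) \<Rightarrow>
    ('a, 'm) ring_scheme \<Rightarrow> ('c, 'n) ring_scheme \<Rightarrow> ('a \<Rightarrow> 'a) \<Rightarrow> ('c \<Rightarrow> 'c) \<Rightarrow>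
    ('a \<times> 'c \<Rightarrow>\<^sub>0 int) set \<Rightarrow> ('a \<times> 'c \<Rightarrow>\<^sub>0 int) set" where
  "tensor_map S \<alpha> \<gamma> A C f g =
     coset_map (formal_tensors A C) (tensor_ideal S \<alpha> \<gamma> A C)
       (frag_extend (\<lambda>(a, c). frag_of (f a, g c)))"


section \<open>The direct limit of \<open>A \<rightarrow> A \<rightarrow> A \<rightarrow> \<dots>\<close> along an endomorphism\<close>

text \<open>The pair \<open>(n, a)\<close> stands for the image of \<open>a\<close> in the \<open>n\<close>-th copy of \<open>A\<close>.\<close>

definition dirlim_rel :: "('a, 'm) ring_scheme \<Rightarrow> ('a \<Rightarrow> 'a) \<Rightarrow> ((nat \<times> 'a) \<times> (nat \<times> 'a)) set" where
  "dirlim_rel A \<Phi> = {((n, a), (m, b)). a \<in> carrier A \<and> b \<in> carrier A \<and>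
     (\<exists>i j. n + i = m + j \<and> (\<Phi> ^^ i) a = (\<Phi> ^^ j) b)}"

definition dirlim_class :: "('a, 'm) ring_scheme \<Rightarrow> ('a \<Rightarrow> 'a) \<Rightarrow> nat \<Rightarrow> 'a \<Rightarrow> (nat \<times> 'a) set" where
  "dirlim_class A \<Phi> n a = dirlim_rel A \<Phi> `` {(n, a)}"

definition dirlim :: "('a, 'm) ring_scheme \<Rightarrow> ('a \<Rightarrow> 'a) \<Rightarrow> (nat \<times> 'a) set ring" where
  "dirlim A \<Phi> =
    \<lparr>carrier = (UNIV \<times> carrier A) // dirlim_rel A \<Phi>,
     monoid.mult = (\<lambda>U V. \<Union>(n, a)\<in>U. \<Union>(m, b)\<in>V.
               dirlim_class A \<Phi> (n + m) ((\<Phi> ^^ m) a \<otimes>\<^bsub>A\<^esub> (\<Phi> ^^ n) b)),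
     one = dirlim_class A \<Phi> 0 \<one>\<^bsub>A\<^esub>,
     ring.zero = dirlim_class A \<Phi> 0 \<zero>\<^bsub>A\<^esub>,
     add = (\<lambda>U V. \<Union>(n, a)\<in>U. \<Union>(m, b)\<in>V.
               dirlim_class A \<Phi> (n + m) ((\<Phi> ^^ m) a \<oplus>\<^bsub>A\<^esub> (\<Phi> ^^ n) b))\<rparr>"

definition dirlim_map :: "('a, 'm) ring_scheme \<Rightarrow> ('a \<Rightarrow> 'a) \<Rightarrow> ('a \<Rightarrow> 'a) \<Rightarrow>
    (nat \<times> 'a) set \<Rightarrow> (nat \<times> 'a) set" where
  "dirlim_map A \<Phi> g U = (\<Union>(n, a)\<in>U. dirlim_class A \<Phi> n (g a))"


section \<open>The localization \<open>A[1/p]\<close>\<close>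

text \<open>The pair \<open>(n, a)\<close> stands for the fraction \<open>a / p\<^sup>n\<close>.\<close>

definition frac_rel :: "nat \<Rightarrow> ('a, 'm) ring_scheme \<Rightarrow> ((nat \<times> 'a) \<times> (nat \<times> 'a)) set" where
  "frac_rel p A = {((n, a), (m, b)). a \<in> carrier A \<and> b \<in> carrier A \<and>
     (\<exists>k. [(p ^ (k + m))] \<cdot>\<^bsub>A\<^esub> a = [(p ^ (k + n))] \<cdot>\<^bsub>A\<^esub> b)}"

definition frac_class :: "nat \<Rightarrow> ('a, 'm) ring_scheme \<Rightarrow> nat \<Rightarrow> 'a \<Rightarrow> (nat \<times> 'a) set" where
  "frac_class p A n a = frac_rel p A `` {(n, a)}"

definition invert_p :: "nat \<Rightarrow> ('a, 'm) ring_scheme \<Rightarrow> (nat \<times> 'a) set ring" where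
  "invert_p p A =
    \<lparr>carrier = (UNIV \<times> carrier A) // frac_rel p A,
     monoid.mult = (\<lambda>U V. \<Union>(n, a)\<in>U. \<Union>(m, b)\<in>V. frac_class p A (n + m) (a \<otimes>\<^bsub>A\<^esub> b)),
     one = frac_class p A 0 \<one>\<^bsub>A\<^esub>,
     ring.zero = frac_class p A 0 \<zero>\<^bsub>A\<^esub>,
     add = (\<lambda>U V. \<Union>(n, a)\<in>U. \<Union>(m, b)\<in>V.
               frac_class p A (n + m) ([(p ^ m)] \<cdot>\<^bsub>A\<^esub> a \<oplus>\<^bsub>A\<^esub> [(p ^ n)] \<cdot>\<^bsub>A\<^esub> b))\<rparr>"

definition invert_p_map :: "nat \<Rightarrow> ('a, 'm) ring_scheme \<Rightarrow> ('a \<Rightarrow> 'a) \<Rightarrow>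
    (nat \<times> 'a) set \<Rightarrow> (nat \<times> 'a) set" where
  "invert_p_map p A g U = (\<Union>(n, a)\<in>U. frac_class p A n (g a))"


section \<open>The perfectoid algebra \<open>P\<^sup>\<infinity>(B)\<close> and the maps \<open>P\<^sup>\<infinity>(u)\<close>\<close>

type_synonym 'k jet_tensor = "((nat \<Rightarrow> 'k jet_poly set) \<times> (nat \<Rightarrow> 'k set) \<Rightarrow>\<^sub>0 int) set"

type_synonym 'k perfectoid_elem =
  "(nat \<times> (nat \<Rightarrow> (nat \<times> (nat \<Rightarrow> 'k jet_tensor set)) set set)) set"

text \<open>\<open>\<A> = J\<^sup>\<infinity>(B) \<otimes>\<^sub>R \<bbbK>\<degree>\<close>, and on it the maps \<open>f \<otimes> g\<close>.\<close>

definition ring_A :: "nat \<Rightarrow> 'k::field set \<Rightarrow> (nat \<Rightarrow> 'k) \<Rightarrow> 'k jet_tensor ring" where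
  "ring_A p R \<pi> =
     tensor_ring R (\<lambda>r. to_jet p R (jet_const r)) (to_K_int p R \<pi>) (jet_algebra p R) (K_int p R \<pi>)"

definition map_A :: "nat \<Rightarrow> 'k::field set \<Rightarrow> (nat \<Rightarrow> 'k) \<Rightarrow>
    ((nat \<Rightarrow> 'k jet_poly set) \<Rightarrow> (nat \<Rightarrow> 'k jet_poly set)) \<Rightarrow>
    ((nat \<Rightarrow> 'k set) \<Rightarrow> (nat \<Rightarrow> 'k set)) \<Rightarrow> 'k jet_tensor \<Rightarrow> 'k jet_tensor" where
  "map_A p R \<pi> =
     tensor_map R (\<lambda>r. to_jet p R (jet_const r)) (to_K_int p R \<pi>) (jet_algebra p R) (K_int p R \<pi>)"

definition ring_A_hat :: "nat \<Rightarrow> 'k::field set \<Rightarrow> (nat \<Rightarrow> 'k) \<Rightarrow> (nat \<Rightarrow> 'k jet_tensor set) ring" where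
  "ring_A_hat p R \<pi> = p_completion p (ring_A p R \<pi>)"

definition Phi_A_hat :: "nat \<Rightarrow> 'k::field set \<Rightarrow> ('k \<Rightarrow> 'k) \<Rightarrow> (nat \<Rightarrow> 'k) \<Rightarrow>
    (nat \<Rightarrow> 'k jet_tensor set) \<Rightarrow> (nat \<Rightarrow> 'k jet_tensor set)" where
  "Phi_A_hat p R \<phi> \<pi> =
     completion_map p (ring_A p R \<pi>) (map_A p R \<pi> (jet_frob p R \<phi>) (K_aut p R \<phi> \<pi>))"

definition ring_B :: "nat \<Rightarrow> 'k::field set \<Rightarrow> ('k \<Rightarrow> 'k) \<Rightarrow> (nat \<Rightarrow> 'k) \<Rightarrow>
    (nat \<times> (nat \<Rightarrow> 'k jet_tensor set)) set ring" where
  "ring_B p R \<phi> \<pi> = dirlim (ring_A_hat p R \<pi>) (Phi_A_hat p R \<phi> \<pi>)"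

definition P_infty :: "nat \<Rightarrow> 'k::field set \<Rightarrow> ('k \<Rightarrow> 'k) \<Rightarrow> (nat \<Rightarrow> 'k) \<Rightarrow>
    'k perfectoid_elem ring" where
  "P_infty p R \<phi> \<pi> = invert_p p (p_completion p (ring_B p R \<phi> \<pi>))"

definition P_infty_map :: "nat \<Rightarrow> 'k::field set \<Rightarrow> ('k \<Rightarrow> 'k) \<Rightarrow> (nat \<Rightarrow> 'k) \<Rightarrow>
    ('k jet_poly \<Rightarrow> 'k jet_poly) \<Rightarrow> 'k perfectoid_elem \<Rightarrow> 'k perfectoid_elem" where
  "P_infty_map p R \<phi> \<pi> u =
     invert_p_map p (p_completion p (ring_B p R \<phi> \<pi>))
       (completion_map p (ring_B p R \<phi> \<pi>)
         (dirlim_map (ring_A_hat p R \<pi>) (Phi_A_hat p R \<phi> \<pi>)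
           (completion_map p (ring_A p R \<pi>)
             (map_A p R \<pi> (jet_map p R \<phi> u) (\<lambda>c. c)))))"

end

theory Submission
  imports Defs
begin

text \<open>
  The homomorphism multiplies the first jet coordinate by \<open>p\<close>: it sends \<open>x'\<close> to \<open>\<delta>(x\<^sup>p)\<close>, which is
  divisible by \<open>p\<close>.  Hence it kills the limit of \<open>\<Phi>\<^bsup>-n\<^esup>(x')\<^bsup>p\<^sup>n\<^esup>\<close>, the Teichmueller lift of
  \<open>x'\<close>.  No multiple of this limit by a power of \<open>p\<close> vanishes: evaluating all jet coordinates at \<open>1\<close>
  maps \<open>\<A>\<close> to \<open>\<bbbK>\<degree>\<close> and \<open>x'\<close> to \<open>1\<close>, and \<open>\<bbbK>\<degree>\<close> is \<open>p\<close>-torsion free with \<open>p\<close> not a unit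
  (by Nakayama's lemma, applied to the span of the powers of a root of \<open>p\<close>).

  For surjectivity it suffices, by completeness, to reach every \<open>\<Phi>\<^bsup>-n\<^esup>(a \<otimes> c)\<close> modulo \<open>p\<close>, and
  since \<open>\<Phi>\<close> acts on both factors only \<open>a\<close> matters: it has to be shown that some \<open>\<phi>\<^sup>m a\<close> lies in
  \<open>u(J) + pJ\<close>.  The \<open>a\<close> for which some \<open>\<phi>\<^sup>m a\<close> lies in \<open>u(J) + p\<^sup>N J\<close> form a ring, and if \<open>py\<close>
  has this property for \<open>N + 1\<close> then \<open>y\<close> has it for \<open>N\<close>: from \<open>py = u(w)\<close> and
  \<open>\<phi>\<^sup>m w = w\<^bsup>p\<^sup>m\<^esup> + p w'\<close> one gets \<open>\<phi>\<^sup>m y = u(w') + p\<^bsup>p\<^sup>m-1\<^esup> y\<^bsup>p\<^sup>m\<^esup>\<close>.  Writing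
  \<open>\<phi>(x) = x\<^sup>p (1 + p y)\<close> and comparing \<open>u(\<phi>(x))\<close> with \<open>\<phi>(u(x))\<close> gives
  \<open>p u(y) = (1 + p y)\<^sup>p - 1\<close>, so \<open>u(y)/p = y + p(\<dots>)\<close> has the property for all \<open>N\<close>, and by
  successive approximation so does \<open>y\<close>.  Hence so does \<open>x\<close>, since \<open>\<phi>(x) = u(x) (1 + p y)\<close>, and then
  every \<open>x\<^bsup>(i)\<^esup>\<close>, since \<open>p x\<^bsup>(i+1)\<^esup> = \<phi>(x\<^bsup>(i)\<^esup>) - (x\<^bsup>(i)\<^esup>)\<^sup>p\<close>.
\<close>

section \<open>Congruences modulo powers of p\<close>

text \<open>\<open>jet_frob\<close>, \<open>K_aut\<close>, \<open>jet_map\<close> and \<delta> are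
  definite descriptions, so existence and uniqueness have to be settled first. Uniqueness needs no
  topology: a ring homomorphism sends multiples of \<open>p ^ n\<close> to multiples of
  \<open>p ^ n\<close> and is thus automatically continuous. The delicate existence question is
  \<Phi> on the ring generated by the \<open>\<pi> m\<close>, elements of the field known only
  through \<open>\<pi> (Suc m) ^ p = \<pi> m\<close>. Applying \<phi> to coefficients is well
  defined there because the powers of \<open>\<pi> m\<close> below \<open>p ^ m\<close> are linearly
  independent over \<open>R\<close>, an Eisenstein argument resting on Nakayama's lemma. For
  surjectivity, each division by p costs one power of p, so x and all x^(i) have to be treated at
  every level N although only level 1 is used in the end. For the kernel, evaluation at 1 does not
  commute with \<Phi>: x goes to 1, but \<phi>(x) = x^p + p x' goes to 1 + p. Hence it gives no map
  on the direct limit, and non-vanishing is tested at a finite stage modulo p^(k+1), where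
  \<Phi>^i(x') may be replaced by a power of x'.\<close>

definition pcong :: "nat \<Rightarrow> ('a, 'm) ring_scheme \<Rightarrow> nat \<Rightarrow> 'a \<Rightarrow> 'a \<Rightarrow> bool" where
  "pcong p A n a b \<longleftrightarrow> a \<in> carrier A \<and> b \<in> carrier A \<and> (\<exists>c\<in>carrier A. a = b \<oplus>\<^bsub>A\<^esub> [(p ^ n)] \<cdot>\<^bsub>A\<^esub> c)"

context cring
begin

lemma nmult_closed [simp, intro]: "a \<in> carrier R \<Longrightarrow> [(k::nat)] \<cdot> a \<in> carrier R"
  by (rule add.nat_pow_closed)

lemma nmult_Suc: "a \<in> carrier R \<Longrightarrow> [(Suc k)] \<cdot> a = [k] \<cdot> a \<oplus> a"
  by (rule add.nat_pow_Suc)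

lemma nmult_0 [simp]: "[(0::nat)] \<cdot> a = \<zero>"
  by (rule add.nat_pow_0)

lemma nmult_one [simp]: "a \<in> carrier R \<Longrightarrow> [(1::nat)] \<cdot> a = a"
  using nmult_Suc[of a 0] by simp

lemma nmult_add: "a \<in> carrier R \<Longrightarrow> b \<in> carrier R \<Longrightarrow> [(k::nat)] \<cdot> (a \<oplus> b) = [k] \<cdot> a \<oplus> [k] \<cdot> b"
  by (rule add.nat_pow_distrib)

lemma nmult_nmult: "a \<in> carrier R \<Longrightarrow> [(k::nat)] \<cdot> ([(l::nat)] \<cdot> a) = [(k * l)] \<cdot> a"
  using add.nat_pow_pow[of a k l] by (simp add: mult.commute)

lemma nmult_plus: "a \<in> carrier R \<Longrightarrow> [(k + l::nat)] \<cdot> a = [k] \<cdot> a \<oplus> [l] \<cdot> a"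
  by (rule add.nat_pow_mult[symmetric])

lemma nmult_zero [simp]: "[(k::nat)] \<cdot> \<zero> = \<zero>"
  by (rule add.nat_pow_one)

lemma nmult_l: "a \<in> carrier R \<Longrightarrow> b \<in> carrier R \<Longrightarrow> ([(k::nat)] \<cdot> a) \<otimes> b = [k] \<cdot> (a \<otimes> b)"
  by (rule add_pow_ldistr)

lemma nmult_r: "a \<in> carrier R \<Longrightarrow> b \<in> carrier R \<Longrightarrow> a \<otimes> ([(k::nat)] \<cdot> b) = [k] \<cdot> (a \<otimes> b)"
  by (rule add_pow_rdistr)

lemma nmult_neg: "a \<in> carrier R \<Longrightarrow> [(k::nat)] \<cdot> (\<ominus> a) = \<ominus> ([k] \<cdot> a)"
  by (rule add.nat_pow_inv)

lemma nmult_minus: "a \<in> carrier R \<Longrightarrow> b \<in> carrier R \<Longrightarrow> [(k::nat)] \<cdot> (a \<ominus> b) = [k] \<cdot> a \<ominus> [k] \<cdot> b"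
  by (simp add: a_minus_def nmult_add nmult_neg)

lemma nmult_pow: "a \<in> carrier R \<Longrightarrow> ([(k::nat)] \<cdot> a) [^] (n::nat) = [(k ^ n)] \<cdot> (a [^] n)"
  by (induction n) (simp_all add: nmult_l nmult_r nmult_nmult mult.commute)

lemma p_ideal_iff: "a \<in> p_ideal p R n \<longleftrightarrow> (\<exists>c\<in>carrier R. a = [(p ^ n)] \<cdot> c)"
  proof -
  have "x \<otimes> [(p ^ n)] \<cdot> \<one> = [(p ^ n)] \<cdot> x" if "x \<in> carrier R" for x using that by (simp add: nmult_r)
  then show ?thesis unfolding p_ideal_def cgenideal_def by (auto simp: Bex_def) (metis+)
qed

lemma p_ideal_ideal: "ideal (p_ideal p R n) R"
  unfolding p_ideal_def by (rule cgenideal_ideal) simp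

lemma pcong_iff_minus:
  assumes "a \<in> carrier R" "b \<in> carrier R"
  shows "pcong p R n a b \<longleftrightarrow> a \<ominus> b \<in> p_ideal p R n"
proof -
  have "a = b \<oplus> c \<longleftrightarrow> a \<ominus> b = c" if "c \<in> carrier R" for c
    using assms that a_lcomm[of b c "\<ominus> b"] by (auto simp: a_minus_def a_ac r_neg1 r_neg2 r_neg l_neg)
  then show ?thesis using assms unfolding pcong_def p_ideal_iff by auto
qed

lemma pcongI: "b \<in> carrier R \<Longrightarrow> c \<in> carrier R \<Longrightarrow> pcong p R n (b \<oplus> [(p ^ n)] \<cdot> c) b"
  unfolding pcong_def by auto

lemma pcong_refl [simp, intro]: "a \<in> carrier R \<Longrightarrow> pcong p R n a a"
  unfolding pcong_def by (auto intro!: bexI[of _ \<zero>])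

lemma pcong_carr: "pcong p R n a b \<Longrightarrow> a \<in> carrier R" "pcong p R n a b \<Longrightarrow> b \<in> carrier R"
  unfolding pcong_def by auto

text \<open>Equality of cosets is an equivalence relation, so symmetry and transitivity of
  \<open>pcong\<close> come from here without manipulating witnesses.\<close>

lemma to_completion_eq_iff:
  assumes "a \<in> carrier R" "b \<in> carrier R"
  shows "to_completion p R a n = to_completion p R b n \<longleftrightarrow> pcong p R n a b"
proof -
  interpret I: ideal "p_ideal p R n" R by (rule p_ideal_ideal)
  show ?thesis unfolding to_completion_def pcong_iff_minus[OF assms]
    using quotient_eq_iff_same_a_r_cos[OF p_ideal_ideal assms] by simp
qed

lemma pcong_sym: "pcong p R n a b \<Longrightarrow> pcong p R n b a"
  using to_completion_eq_iff[of a b] to_completion_eq_iff[of b a] pcong_carr by metis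

lemma pcong_trans [trans]: "pcong p R n a b \<Longrightarrow> pcong p R n b c \<Longrightarrow> pcong p R n a c"
  using to_completion_eq_iff pcong_carr by metis

lemma pcong_add:
  assumes "pcong p R n a b" "pcong p R n c d"
  shows "pcong p R n (a \<oplus> c) (b \<oplus> d)"
proof -
  obtain x y where "x \<in> carrier R" "y \<in> carrier R" "a = b \<oplus> [(p ^ n)] \<cdot> x" "c = d \<oplus> [(p ^ n)] \<cdot> y"
    using assms unfolding pcong_def by auto
  then have "a \<oplus> c = (b \<oplus> d) \<oplus> [(p ^ n)] \<cdot> (x \<oplus> y)" using pcong_carr[OF assms(1)] pcong_carr[OF assms(2)]
    by (simp add: nmult_add a_ac)
  then show ?thesis using assms unfolding pcong_def by (auto intro!: bexI[of _ "x \<oplus> y"] simp: \<open>x \<in> _\<close> \<open>y \<in> _\<close>)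
qed

lemma pcong_mult:
  assumes "pcong p R n a b" "pcong p R n c d"
  shows "pcong p R n (a \<otimes> c) (b \<otimes> d)"
proof -
  have l: "pcong p R n (a \<otimes> c) (b \<otimes> c)" if ab: "pcong p R n a b" and c: "c \<in> carrier R" for a b c
  proof -
    obtain x where x: "x \<in> carrier R" "a = b \<oplus> [(p ^ n)] \<cdot> x"
      using ab unfolding pcong_def by auto
    then have "a \<otimes> c = b \<otimes> c \<oplus> [(p ^ n)] \<cdot> (x \<otimes> c)" using c pcong_carr[OF ab]
      by (simp add: l_distr nmult_l)
    then show ?thesis using c x pcong_carr[OF ab] by (auto simp: pcong_def)
  qed
  have "pcong p R n (a \<otimes> c) (b \<otimes> c)" using l assms pcong_carr by blast
  moreover have "pcong p R n (b \<otimes> c) (b \<otimes> d)"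
    using l[OF assms(2), of b] assms pcong_carr by (metis m_comm)
  ultimately show ?thesis by (rule pcong_trans)
qed

lemma pcong_pow: "pcong p R n a b \<Longrightarrow> pcong p R n (a [^] (k::nat)) (b [^] k)"
  by (induction k) (auto intro: pcong_mult)

lemma pcong_neg: "pcong p R n a b \<Longrightarrow> pcong p R n (\<ominus> a) (\<ominus> b)"
  using pcong_mult[of p n "\<ominus> \<one>" "\<ominus> \<one>" a b] by (simp add: l_minus pcong_carr)

lemma pcong_minus: "pcong p R n a b \<Longrightarrow> pcong p R n c d \<Longrightarrow> pcong p R n (a \<ominus> c) (b \<ominus> d)"
  unfolding a_minus_def by (intro pcong_add pcong_neg)

lemma pcong_mono:
  assumes "pcong p R n a b" "m \<le> n" shows "pcong p R m a b"
proof -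
  obtain x where x: "x \<in> carrier R" "a = b \<oplus> [(p ^ n)] \<cdot> x"
    using assms unfolding pcong_def by auto
  have "p ^ n = p ^ m * p ^ (n - m)" using assms by (simp flip: power_add)
  then have "[(p ^ n)] \<cdot> x = [(p ^ m)] \<cdot> ([(p ^ (n - m))] \<cdot> x)" using x by (simp add: nmult_nmult)
  then show ?thesis using assms x unfolding pcong_def by auto
qed

lemma pcong_0 [simp]: "a \<in> carrier R \<Longrightarrow> b \<in> carrier R \<Longrightarrow> pcong p R 0 a b"
  unfolding pcong_def by (auto intro!: bexI[of _ "a \<ominus> b"] simp: a_minus_def a_ac r_neg1 r_neg2 r_neg l_neg)

text \<open>A factor \<open>p ^ k\<close> raises the level by k; \<open>near_image_p\<close> and
  \<open>teich_nonzero\<close> live on this gain.\<close>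

lemma pcong_nmult:
  assumes "pcong p R n a b" shows "pcong p R (n + k) ([(p ^ k)] \<cdot> a) ([(p ^ k)] \<cdot> b)"
  using assms unfolding pcong_def by (auto simp: nmult_add nmult_nmult power_add mult.commute)

lemma pcong_nmult_any:
  assumes "pcong p R n a b" shows "pcong p R n ([(k::nat)] \<cdot> a) ([k] \<cdot> b)"
  by (induction k) (use pcong_carr[OF assms] assms in \<open>auto simp: nmult_Suc intro: pcong_add\<close>)

lemma pcong_p_zero: "a \<in> carrier R \<Longrightarrow> pcong p R n ([(p ^ n)] \<cdot> a) \<zero>"
  using pcongI[of \<zero> a p n] by simp

lemma pcong_zero_iff: "pcong p R n a \<zero> \<longleftrightarrow> (\<exists>c\<in>carrier R. a = [(p ^ n)] \<cdot> c)"
  unfolding pcong_def by auto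

lemma pcong_diff_zero: "a \<in> carrier R \<Longrightarrow> b \<in> carrier R \<Longrightarrow> pcong p R n (a \<ominus> b) \<zero> \<longleftrightarrow> pcong p R n a b"
  by (simp add: pcong_iff_minus a_minus_def)

end

section \<open>Ring homomorphisms and congruences\<close>

lemma ring_hom_nmult:
  assumes "cring A" "cring B" "h \<in> ring_hom A B" "a \<in> carrier A"
  shows "h ([(k::nat)] \<cdot>\<^bsub>A\<^esub> a) = [k] \<cdot>\<^bsub>B\<^esub> h a"
proof -
  interpret A: cring A by fact
  interpret B: cring B by fact
  show ?thesis
    using assms by (induction k) (auto simp: A.nmult_Suc B.nmult_Suc ring_hom_add ring_hom_closed
        ring_hom_zero[OF assms(3) A.ring_axioms B.ring_axioms])
qed

lemma ring_hom_pow':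
  assumes "cring A" "cring B" "h \<in> ring_hom A B" "a \<in> carrier A"
  shows "h (a [^]\<^bsub>A\<^esub> (k::nat)) = h a [^]\<^bsub>B\<^esub> k"
proof -
  interpret ring_hom_cring A B h using assms by (simp add: ring_hom_cring_def ring_hom_cring_axioms_def)
  show ?thesis using assms(4) by simp
qed

lemma ring_hom_minus:
  assumes "cring A" "cring B" "h \<in> ring_hom A B" "a \<in> carrier A" "b \<in> carrier A"
  shows "h (a \<ominus>\<^bsub>A\<^esub> b) = h a \<ominus>\<^bsub>B\<^esub> h b"
proof -
  interpret ring_hom_cring A B h using assms by (simp add: ring_hom_cring_def ring_hom_cring_axioms_def)
  show ?thesis using assms(4-5) by (simp add: a_minus_def)
qed

lemma ring_hom_funpow: "h \<in> ring_hom A A \<Longrightarrow> h ^^ n \<in> ring_hom A A"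
proof (induction n)
  case 0 show ?case using id_ring_hom[of A] by (simp add: id_def)
next
  case (Suc n)
  have "h \<circ> h ^^ n \<in> ring_hom A A" using ring_hom_trans[OF Suc.IH[OF Suc.prems] Suc.prems] .
  then show ?case by (simp only: funpow.simps)
qed

lemma pcong_hom:
  assumes "cring A" "cring B" "h \<in> ring_hom A B" "pcong p A n a b"
  shows "pcong p B n (h a) (h b)"
proof -
  interpret A: cring A by fact
  interpret B: cring B by fact
  from assms(4) obtain c where "c \<in> carrier A" "a = b \<oplus>\<^bsub>A\<^esub> [(p ^ n)] \<cdot>\<^bsub>A\<^esub> c" "b \<in> carrier A"
    unfolding pcong_def by auto
  then show ?thesis using assms(3)
    by (auto simp: ring_hom_add[OF assms(3)] ring_hom_nmult[OF assms(1-3)] ring_hom_closed[OF assms(3)]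
        intro!: B.pcongI)
qed

section \<open>Completions\<close>

text \<open>Only the class of \<open>a n\<close> modulo \<open>p ^ n\<close> enters, so a point of
  the inverse limit can be handled through a sequence of representatives.\<close>

definition lim_seq :: "nat \<Rightarrow> ('a, 'm) ring_scheme \<Rightarrow> (nat \<Rightarrow> 'a) \<Rightarrow> (nat \<Rightarrow> 'a set)" where
  "lim_seq p A a = (\<lambda>n. to_completion p A (a n) n)"

text \<open>A Cauchy condition with a prescribed rate. It corresponds to
  \<open>s (Suc n) \<subseteq> s n\<close> in \<open>p_completion\<close>, where inclusion of cosets
  stands for the transition maps.\<close>

definition coherent :: "nat \<Rightarrow> ('a, 'm) ring_scheme \<Rightarrow> (nat \<Rightarrow> 'a) \<Rightarrow> bool" where
  "coherent p A a \<longleftrightarrow> (\<forall>n. pcong p A n (a (Suc n)) (a n))"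

context cring
begin

lemma to_completion_hom: "(\<lambda>a. to_completion p R a n) \<in> ring_hom R (R Quot p_ideal p R n)"
  unfolding to_completion_def using ideal.rcos_ring_hom[OF p_ideal_ideal] by metis

lemma quot_cring: "cring (R Quot p_ideal p R n)"
  by (rule ideal.quotient_is_cring[OF p_ideal_ideal cring_axioms])

lemma to_completion_self: "a \<in> carrier R \<Longrightarrow> a \<in> to_completion p R a n"
  using abelian_subgroup.a_rcos_self ideal.axioms(1) p_ideal_ideal
  by (metis abelian_subgroupI3 is_abelian_group to_completion_def)

lemma mem_to_completion:
  assumes "a \<in> carrier R" shows "b \<in> to_completion p R a n \<longleftrightarrow> pcong p R n b a"
proof -
  interpret I: ideal "p_ideal p R n" R by (rule p_ideal_ideal)
  have 1: "b \<in> to_completion p R a n \<Longrightarrow> b \<in> carrier R"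
    unfolding to_completion_def using assms I.a_elemrcos_carrier[OF assms] by blast
  show ?thesis
  proof
    assume b: "b \<in> to_completion p R a n"
    then have "to_completion p R a n = to_completion p R b n"
      unfolding to_completion_def using a_repr_independence I.additive_subgroup_axioms assms
      by (metis additive_subgroup.a_subgroup)
    then show "pcong p R n b a" using 1[OF b] assms to_completion_eq_iff by metis
  next
    assume "pcong p R n b a"
    then show "b \<in> to_completion p R a n"
      using to_completion_eq_iff to_completion_self assms pcong_carr by metis
  qed
qed

lemma to_completion_mono:
  assumes "pcong p R n b a" shows "to_completion p R b (Suc n) \<subseteq> to_completion p R a n"
proof
  fix x assume "x \<in> to_completion p R b (Suc n)"
  then have "pcong p R (Suc n) x b" using assms pcong_carr mem_to_completion by metis
  then have "pcong p R n x b" by (rule pcong_mono) simp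
  then show "x \<in> to_completion p R a n" using assms pcong_carr mem_to_completion pcong_trans by metis
qed

lemma quot_carrier: "U \<in> carrier (R Quot p_ideal p R n) \<longleftrightarrow> (\<exists>a\<in>carrier R. U = to_completion p R a n)"
  by (auto simp: FactRing_def A_RCOSETS_def' to_completion_def)

lemma coherent_carr: "coherent p R a \<Longrightarrow> a n \<in> carrier R"
  unfolding coherent_def using pcong_carr by blast

lemma lim_seq_in:
  assumes "coherent p R a" shows "lim_seq p R a \<in> carrier (p_completion p R)"
proof -
  have "lim_seq p R a (Suc n) \<subseteq> lim_seq p R a n" for n
    unfolding lim_seq_def using assms by (intro to_completion_mono) (simp add: coherent_def)
  moreover have "lim_seq p R a n \<in> carrier (R Quot p_ideal p R n)" for n
    unfolding lim_seq_def quot_carrier using coherent_carr[OF assms] by blast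
  ultimately show ?thesis unfolding p_completion_def by simp
qed

lemma completion_carrE:
  assumes "s \<in> carrier (p_completion p R)"
  obtains a where "coherent p R a" "s = lim_seq p R a"
proof -
  have s: "s n \<in> carrier (R Quot p_ideal p R n)" "s (Suc n) \<subseteq> s n" for n
    using assms unfolding p_completion_def by auto
  then obtain a where a: "\<And>n. a n \<in> carrier R" "\<And>n. s n = to_completion p R (a n) n"
    unfolding quot_carrier by metis
  have "coherent p R a" unfolding coherent_def
    using a s(2) to_completion_self mem_to_completion by (metis subsetD)
  moreover have "s = lim_seq p R a" using a unfolding lim_seq_def by auto
  ultimately show ?thesis using that by blast
qed

lemma lim_seq_eq_iff:
  assumes "coherent p R a" "coherent p R b"
  shows "lim_seq p R a = lim_seq p R b \<longleftrightarrow> (\<forall>n. pcong p R n (a n) (b n))"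
  unfolding lim_seq_def fun_eq_iff using to_completion_eq_iff coherent_carr assms by metis

lemma lim_seq_ops:
  assumes "coherent p R a" "coherent p R b"
  shows "lim_seq p R a \<otimes>\<^bsub>p_completion p R\<^esub> lim_seq p R b = lim_seq p R (\<lambda>n. a n \<otimes> b n)"
    "lim_seq p R a \<oplus>\<^bsub>p_completion p R\<^esub> lim_seq p R b = lim_seq p R (\<lambda>n. a n \<oplus> b n)"
  unfolding lim_seq_def p_completion_def
  using ring_hom_mult[OF to_completion_hom] ring_hom_add[OF to_completion_hom] assms coherent_carr
  by fastforce+

lemma lim_seq_consts:
  shows "\<one>\<^bsub>p_completion p R\<^esub> = lim_seq p R (\<lambda>n. \<one>)"
    "\<zero>\<^bsub>p_completion p R\<^esub> = lim_seq p R (\<lambda>n. \<zero>)"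
  unfolding lim_seq_def p_completion_def
  using ring_hom_one[OF to_completion_hom] ring_hom_zero[OF to_completion_hom ring_axioms] quot_cring
  by (fastforce dest: cring.axioms(1))+

lemma coherent_ops:
  "coherent p R a \<Longrightarrow> coherent p R b \<Longrightarrow> coherent p R (\<lambda>n. a n \<otimes> b n)"
  "coherent p R a \<Longrightarrow> coherent p R b \<Longrightarrow> coherent p R (\<lambda>n. a n \<oplus> b n)"
  "coherent p R a \<Longrightarrow> coherent p R (\<lambda>n. \<ominus> a n)"
  "x \<in> carrier R \<Longrightarrow> coherent p R (\<lambda>n. x)"
  unfolding coherent_def by (auto intro: pcong_mult pcong_add pcong_neg)

lemma completion_cring: "cring (p_completion p R)"
proof -
  let ?C = "p_completion p R"
  note E = completion_carrE[of _ p]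
  note [simp] = lim_seq_ops lim_seq_consts coherent_ops lim_seq_in coherent_carr
  show ?thesis
  proof (rule cringI)
    show "abelian_group ?C"
    proof (rule abelian_groupI)
      fix x assume "x \<in> carrier ?C"
      then obtain a where a: "coherent p R a" "x = lim_seq p R a" using E by metis
      show "\<exists>y\<in>carrier ?C. y \<oplus>\<^bsub>?C\<^esub> x = \<zero>\<^bsub>?C\<^esub>"
        by (rule bexI[of _ "lim_seq p R (\<lambda>n. \<ominus> a n)"]) (use a in \<open>simp_all add: l_neg\<close>)
    qed (auto elim!: E simp: a_ac)
    show "Group.comm_monoid ?C"
      by (rule comm_monoidI) (auto elim!: E simp: m_ac)
  qed (auto elim!: E simp: l_distr)
qed

lemma to_completion_lim: "to_completion p R a = lim_seq p R (\<lambda>n. a)"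
  unfolding lim_seq_def by auto

lemma to_completion_ring_hom: "to_completion p R \<in> ring_hom R (p_completion p R)"
  by (rule ring_hom_memI) (auto simp: to_completion_lim lim_seq_ops lim_seq_consts coherent_ops lim_seq_in)

lemma lim_seq_nmult:
  assumes "coherent p R a"
  shows "[(k::nat)] \<cdot>\<^bsub>p_completion p R\<^esub> lim_seq p R a = lim_seq p R (\<lambda>n. [k] \<cdot> a n)"
    "coherent p R (\<lambda>n. [k] \<cdot> a n)"
proof -
  interpret C: cring "p_completion p R" by (rule completion_cring)
  have "[k] \<cdot>\<^bsub>p_completion p R\<^esub> lim_seq p R a = lim_seq p R (\<lambda>n. [k] \<cdot> a n) \<and> coherent p R (\<lambda>n. [k] \<cdot> a n)"
    by (induction k) (use assms in \<open>auto simp: lim_seq_consts coherent_ops C.nmult_Suc nmult_Suc lim_seq_in lim_seq_ops coherent_carr\<close>)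
  then show "[k] \<cdot>\<^bsub>p_completion p R\<^esub> lim_seq p R a = lim_seq p R (\<lambda>n. [k] \<cdot> a n)"
    "coherent p R (\<lambda>n. [k] \<cdot> a n)" by auto
qed

lemma coherent_pcong:
  assumes "coherent p R a" "n \<le> m" shows "pcong p R n (a m) (a n)"
  using assms(2)
proof (induction m rule: dec_induct)
  case base then show ?case using assms coherent_carr by auto
next
  case (step m)
  have "pcong p R m (a (Suc m)) (a m)" using assms unfolding coherent_def by auto
  then have "pcong p R n (a (Suc m)) (a m)" using step pcong_mono by simp
  then show ?case using step pcong_trans by metis
qed

text \<open>The kernel of the projection to component n consists of multiples of
  \<open>p ^ n\<close>. Since the ring may have p-torsion, \<open>a\<close> is not divided termwise:
  the quotient is assembled from chosen witnesses of the successive differences.\<close>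

lemma completion_zero_component:
  assumes a: "coherent p R a" and z: "pcong p R n (a n) \<zero>"
  shows "\<exists>b. coherent p R b \<and> lim_seq p R a = [(p ^ n)] \<cdot>\<^bsub>p_completion p R\<^esub> lim_seq p R b"
proof -
  have "\<exists>b. \<forall>m. b m \<in> carrier R \<and> a (Suc m) = a m \<oplus> [(p ^ m)] \<cdot> b m"
    using a unfolding coherent_def pcong_def by metis
  then obtain d where d: "\<And>m. d m \<in> carrier R" "\<And>m. a (Suc m) = a m \<oplus> [(p ^ m)] \<cdot> d m" by auto
  obtain c0 where c0: "c0 \<in> carrier R" "a n = [(p ^ n)] \<cdot> c0" using z unfolding pcong_zero_iff by auto
  \<comment> \<open>Partial sums of the increments of \<open>a\<close> from index n on, each with
    \<open>p ^ n\<close> taken out; hence \<open>a (n + k)\<close> is exactly \<open>p ^ n\<close>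
    times \<open>b k\<close>.\<close>
  define b where "b = rec_nat c0 (\<lambda>k x. x \<oplus> [(p ^ k)] \<cdot> d (n + k))"
  have b0: "b 0 = c0" and bS: "\<And>k. b (Suc k) = b k \<oplus> [(p ^ k)] \<cdot> d (n + k)" by (auto simp: b_def)
  have bc: "b k \<in> carrier R" for k by (induction k) (auto simp: b0 bS c0 d)
  have cb: "coherent p R b" unfolding coherent_def bS by (auto intro: pcongI bc d)
  have ab: "a (n + k) = [(p ^ n)] \<cdot> b k" for k
    by (induction k) (auto simp: b0 bS c0 d bc nmult_add nmult_nmult power_add)
  have "pcong p R m (a m) ([(p ^ n)] \<cdot> b m)" for m
    using coherent_pcong[OF a, of m "n + m"] ab[of m] pcong_sym by auto
  then have "lim_seq p R a = lim_seq p R (\<lambda>m. [(p ^ n)] \<cdot> b m)"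
    using lim_seq_eq_iff[OF a lim_seq_nmult(2)[OF cb]] by auto
  then show ?thesis using cb lim_seq_nmult(1)[OF cb] by auto
qed

text \<open>Turns congruences in the completion into equality of one component. Separatedness,
  density of the original ring and completeness all follow from it.\<close>

lemma completion_pcong_iff:
  assumes "s \<in> carrier (p_completion p R)" "t \<in> carrier (p_completion p R)"
  shows "pcong p (p_completion p R) n s t \<longleftrightarrow> s n = t n"
proof -
  interpret C: cring "p_completion p R" by (rule completion_cring)
  obtain a b where a: "coherent p R a" "s = lim_seq p R a" and b: "coherent p R b" "t = lim_seq p R b"
    using assms completion_carrE by metis
  show ?thesis
  proof
    assume "pcong p (p_completion p R) n s t"
    then obtain c where c: "c \<in> carrier (p_completion p R)" "s = t \<oplus>\<^bsub>p_completion p R\<^esub> [(p ^ n)] \<cdot>\<^bsub>p_completion p R\<^esub> c"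
      unfolding pcong_def by auto
    obtain d where d: "coherent p R d" "c = lim_seq p R d" using completion_carrE c by metis
    have "lim_seq p R a = lim_seq p R (\<lambda>m. b m \<oplus> [(p ^ n)] \<cdot> d m)"
      using c a b d by (simp add: lim_seq_ops lim_seq_nmult)
    then have "pcong p R n (a n) (b n \<oplus> [(p ^ n)] \<cdot> d n)"
      using lim_seq_eq_iff[OF a(1) coherent_ops(2)[OF b(1) lim_seq_nmult(2)[OF d(1)]]] by blast
    then have "pcong p R n (a n) (b n)"
      using pcongI[OF coherent_carr[OF b(1)] coherent_carr[OF d(1)]] pcong_trans by metis
    then show "s n = t n" unfolding a b lim_seq_def using to_completion_eq_iff coherent_carr a b by metis
  next
    assume "s n = t n"
    then have "pcong p R n (a n) (b n)" unfolding a b lim_seq_def using to_completion_eq_iff coherent_carr a b by metis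
    then have z: "pcong p R n (a n \<oplus> \<ominus> b n) \<zero>"
      using pcong_diff_zero coherent_carr a b unfolding a_minus_def by metis
    obtain c where c: "coherent p R c" "lim_seq p R (\<lambda>n. a n \<oplus> \<ominus> b n) = [(p ^ n)] \<cdot>\<^bsub>p_completion p R\<^esub> lim_seq p R c"
      using completion_zero_component[OF coherent_ops(2)[OF a(1) coherent_ops(3)[OF b(1)]] z] by auto
    have "s = t \<oplus>\<^bsub>p_completion p R\<^esub> [(p ^ n)] \<cdot>\<^bsub>p_completion p R\<^esub> lim_seq p R c"
      unfolding c(2)[symmetric] using a b
      by (simp add: lim_seq_ops coherent_ops coherent_carr a_ac r_neg)
    then show "pcong p (p_completion p R) n s t" using assms c lim_seq_in unfolding pcong_def by auto
  qed
qed

lemma completion_pcongD: "pcong p (p_completion p R) n s t \<Longrightarrow> s n = t n"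
  using completion_pcong_iff unfolding pcong_def by blast

lemma completion_eqI:
  assumes "s \<in> carrier (p_completion p R)" "t \<in> carrier (p_completion p R)"
    "\<And>n. pcong p (p_completion p R) n s t"
  shows "s = t"
  using assms completion_pcong_iff by blast

lemma completion_approx:
  assumes "s \<in> carrier (p_completion p R)"
  shows "\<exists>a\<in>carrier R. pcong p (p_completion p R) n s (to_completion p R a)"
proof -
  obtain a where a: "coherent p R a" "s = lim_seq p R a"
    using assms completion_carrE by metis
  have "to_completion p R (a n) \<in> carrier (p_completion p R)"
    using to_completion_ring_hom coherent_carr[OF a(1)] by (rule ring_hom_closed)
  then have "pcong p (p_completion p R) n s (to_completion p R (a n))"
    using completion_pcong_iff[OF assms] a by (auto simp: lim_seq_def)
  then show ?thesis using coherent_carr a by auto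
qed

lemma completion_limit:
  assumes "coherent p (p_completion p R) t"
  shows "\<exists>s\<in>carrier (p_completion p R). \<forall>n. pcong p (p_completion p R) n s (t n)"
proof -
  interpret C: cring "p_completion p R" by (rule completion_cring)
  have tc: "t n \<in> carrier (p_completion p R)" for n using C.coherent_carr[OF assms] by auto
  \<comment> \<open>The diagonal: component n is already final in \<open>t n\<close>, since all
    later terms agree with it modulo \<open>p ^ n\<close>.\<close>
  define s where "s = (\<lambda>n. t n n)"
  have e: "t (Suc n) n = t n n" for n
    using assms completion_pcong_iff tc unfolding coherent_def by blast
  have m: "u (Suc n) \<subseteq> u n" "u n \<in> carrier (R Quot p_ideal p R n)" if "u \<in> carrier (p_completion p R)" for u n
    using that unfolding p_completion_def by auto
  have "s \<in> carrier (p_completion p R)"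
    using m(1)[OF tc] m(2)[OF tc] e unfolding s_def p_completion_def by auto (metis subsetD)
  moreover have "\<forall>n. pcong p (p_completion p R) n s (t n)"
    using completion_pcong_iff[OF calculation tc] unfolding s_def by auto
  ultimately show ?thesis by blast
qed

lemma completion_torsion_free:
  assumes tf: "\<And>a. a \<in> carrier R \<Longrightarrow> [p] \<cdot> a = \<zero> \<Longrightarrow> a = \<zero>"
    and s: "s \<in> carrier (p_completion p R)" "[p] \<cdot>\<^bsub>p_completion p R\<^esub> s = \<zero>\<^bsub>p_completion p R\<^esub>"
  shows "s = \<zero>\<^bsub>p_completion p R\<^esub>"
proof -
  obtain a where a: "coherent p R a" "s = lim_seq p R a"
    using s completion_carrE by metis
  have "pcong p R n ([p] \<cdot> a n) \<zero>" for n
    using s(2) unfolding a lim_seq_nmult(1)[OF a(1)] lim_seq_consts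
    using lim_seq_eq_iff[OF lim_seq_nmult(2)[OF a(1)] coherent_ops(4)] by blast
  note az = this
  have "pcong p R n (a n) \<zero>" for n
  proof -
    \<comment> \<open>Cancelling p loses one power, hence the term of index n + 1; coherence then
      leads back to the term of index n.\<close>
    obtain c where c: "c \<in> carrier R" "[p] \<cdot> a (Suc n) = [(p ^ Suc n)] \<cdot> c"
      using az unfolding pcong_zero_iff by metis
    have ac: "a (Suc n) \<in> carrier R" using coherent_carr a by auto
    have "[p] \<cdot> (a (Suc n) \<ominus> [(p ^ n)] \<cdot> c) = \<zero>"
      using c ac by (simp add: nmult_minus nmult_nmult)
    from tf[OF minus_closed[OF ac nmult_closed[OF c(1)]] this] have "a (Suc n) \<ominus> [(p ^ n)] \<cdot> c = \<zero>" .
    then have "a (Suc n) = [(p ^ n)] \<cdot> c" using c ac by (simp add: r_right_minus_eq)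
    then have "pcong p R n (a (Suc n)) \<zero>" using c pcong_p_zero by simp
    then show ?thesis using a(1) pcong_sym pcong_trans unfolding coherent_def by blast
  qed
  then show ?thesis unfolding a lim_seq_consts using lim_seq_eq_iff[OF a(1) coherent_ops(4)] by blast
qed

end

section \<open>Extension of homomorphisms to completions\<close>

definition compl_ext :: "('b \<Rightarrow> nat \<Rightarrow> 'a set) \<Rightarrow> (nat \<Rightarrow> 'b set) \<Rightarrow> (nat \<Rightarrow> 'a set)" where
  "compl_ext G s = (\<lambda>n. \<Union>z\<in>s n. G z n)"

text \<open>\<open>completion_map\<close> is the case of a map factoring through the uncompleted
  target. The general form is needed for jets, where x may go to an element whose inverse exists
  only in the completion.\<close>

lemma completion_map_eq_ext: "completion_map p A g = compl_ext (\<lambda>z. to_completion p A (g z))"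
  by (intro ext) (simp add: completion_map_def coset_map_def compl_ext_def to_completion_def)

locale completion_hom =
  fixes p :: nat and A :: "('b, 'm) ring_scheme" and C :: "('a, 'n) ring_scheme" and G
  assumes A: "cring A" and C: "cring C" and G: "G \<in> ring_hom A (p_completion p C)"
begin

interpretation A: cring A by (rule A)
interpretation C: cring C by (rule C)
interpretation CC: cring "p_completion p C" by (rule C.completion_cring)
interpretation AA: cring "p_completion p A" by (rule A.completion_cring)

lemma ext_lim:
  assumes "coherent p A a"
  shows "compl_ext G (lim_seq p A a) = (\<lambda>n. G (a n) n)"
proof
  fix n
  have a: "a n \<in> carrier A" using A.coherent_carr assms .
  \<comment> \<open>Congruent arguments have the same component n, so the union in
    \<open>compl_ext\<close> is a single coset.\<close>
  have "G z n = G (a n) n" if "z \<in> to_completion p A (a n) n" for z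
  proof -
    have "pcong p A n z (a n)" using that A.mem_to_completion a by metis
    then have "pcong p (p_completion p C) n (G z) (G (a n))"
      by (rule pcong_hom[OF A C.completion_cring G])
    then show ?thesis by (rule C.completion_pcongD)
  qed
  then show "compl_ext G (lim_seq p A a) n = G (a n) n"
    unfolding compl_ext_def lim_seq_def using A.to_completion_self[OF a] by blast
qed

lemma ext_approx:
  assumes "s \<in> carrier (p_completion p A)"
  shows "compl_ext G s \<in> carrier (p_completion p C)"
    and "a \<in> carrier A \<Longrightarrow> pcong p (p_completion p A) n s (to_completion p A a) \<Longrightarrow>
      pcong p (p_completion p C) n (compl_ext G s) (G a)"
proof -
  obtain b where b: "coherent p A b" "s = lim_seq p A b" using A.completion_carrE assms by metis
  have "coherent p (p_completion p C) (\<lambda>n. G (b n))"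
    using b(1) pcong_hom[OF A C.completion_cring G] unfolding coherent_def by blast
  from C.completion_limit[OF this] obtain t where
    t: "t \<in> carrier (p_completion p C)" "\<And>n. pcong p (p_completion p C) n t (G (b n))" by auto
  have e: "compl_ext G s = t"
    unfolding b ext_lim[OF b(1)] using C.completion_pcongD[OF t(2)] by (simp add: fun_eq_iff)
  show "compl_ext G s \<in> carrier (p_completion p C)" using e t by simp
  assume a: "a \<in> carrier A" "pcong p (p_completion p A) n s (to_completion p A a)"
  then have "to_completion p A (b n) n = to_completion p A a n"
    using A.completion_pcong_iff[OF assms, of "to_completion p A a" n]
      ring_hom_closed[OF A.to_completion_ring_hom] unfolding b lim_seq_def by auto
  then have "pcong p A n (b n) a" using A.to_completion_eq_iff A.coherent_carr b a by metis
  then have "pcong p (p_completion p C) n (G (b n)) (G a)"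
    by (rule pcong_hom[OF A C.completion_cring G])
  then show "pcong p (p_completion p C) n (compl_ext G s) (G a)" using t e CC.pcong_trans by metis
qed

lemma ext_to_completion:
  assumes "a \<in> carrier A" shows "compl_ext G (to_completion p A a) = G a"
proof -
  have t: "to_completion p A a \<in> carrier (p_completion p A)"
    using assms ring_hom_closed[OF A.to_completion_ring_hom] by blast
  show ?thesis
    by (rule C.completion_eqI) (use ext_approx[OF t] assms t ring_hom_closed[OF G] in auto)
qed

lemma ext_hom: "compl_ext G \<in> ring_hom (p_completion p A) (p_completion p C)"
proof (rule ring_hom_memI)
  note tc = ring_hom_closed[OF A.to_completion_ring_hom] and Gc = ring_hom_closed[OF G]
  fix x assume x: "x \<in> carrier (p_completion p A)"
  then show "compl_ext G x \<in> carrier (p_completion p C)" by (rule ext_approx)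
  fix y assume y: "y \<in> carrier (p_completion p A)"
  obtain a b where ab: "\<And>n. a n \<in> carrier A" "\<And>n. b n \<in> carrier A"
    "\<And>n. pcong p (p_completion p A) n x (to_completion p A (a n))"
    "\<And>n. pcong p (p_completion p A) n y (to_completion p A (b n))"
    using A.completion_approx[OF x] A.completion_approx[OF y] unfolding Bex_def by metis
  note e = ext_approx(2)[OF x ab(1) ab(3)] ext_approx(2)[OF y ab(2) ab(4)]
  show "compl_ext G (x \<otimes>\<^bsub>p_completion p A\<^esub> y) = compl_ext G x \<otimes>\<^bsub>p_completion p C\<^esub> compl_ext G y"
  proof (rule C.completion_eqI)
    fix n
    have "pcong p (p_completion p A) n (x \<otimes>\<^bsub>p_completion p A\<^esub> y) (to_completion p A (a n \<otimes>\<^bsub>A\<^esub> b n))"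
      using AA.pcong_mult[OF ab(3) ab(4)] ab by (simp add: ring_hom_mult[OF A.to_completion_ring_hom])
    then have "pcong p (p_completion p C) n (compl_ext G (x \<otimes>\<^bsub>p_completion p A\<^esub> y)) (G (a n \<otimes>\<^bsub>A\<^esub> b n))"
      using ab x y by (intro ext_approx) auto
    then show "pcong p (p_completion p C) n (compl_ext G (x \<otimes>\<^bsub>p_completion p A\<^esub> y)) (compl_ext G x \<otimes>\<^bsub>p_completion p C\<^esub> compl_ext G y)"
      using CC.pcong_sym[OF CC.pcong_mult[OF e]] ab by (auto elim!: CC.pcong_trans simp: ring_hom_mult[OF G])
  qed (use x y ext_approx in auto)
  show "compl_ext G (x \<oplus>\<^bsub>p_completion p A\<^esub> y) = compl_ext G x \<oplus>\<^bsub>p_completion p C\<^esub> compl_ext G y"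
  proof (rule C.completion_eqI)
    fix n
    have "pcong p (p_completion p A) n (x \<oplus>\<^bsub>p_completion p A\<^esub> y) (to_completion p A (a n \<oplus>\<^bsub>A\<^esub> b n))"
      using AA.pcong_add[OF ab(3) ab(4)] ab by (simp add: ring_hom_add[OF A.to_completion_ring_hom])
    then have "pcong p (p_completion p C) n (compl_ext G (x \<oplus>\<^bsub>p_completion p A\<^esub> y)) (G (a n \<oplus>\<^bsub>A\<^esub> b n))"
      using ab x y by (intro ext_approx) auto
    then show "pcong p (p_completion p C) n (compl_ext G (x \<oplus>\<^bsub>p_completion p A\<^esub> y)) (compl_ext G x \<oplus>\<^bsub>p_completion p C\<^esub> compl_ext G y)"
      using CC.pcong_sym[OF CC.pcong_add[OF e]] ab by (auto elim!: CC.pcong_trans simp: ring_hom_add[OF G])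
  qed (use x y ext_approx in auto)
next
  have "compl_ext G \<one>\<^bsub>p_completion p A\<^esub> = compl_ext G (to_completion p A \<one>\<^bsub>A\<^esub>)"
    using ring_hom_one[OF A.to_completion_ring_hom] by metis
  then show "compl_ext G \<one>\<^bsub>p_completion p A\<^esub> = \<one>\<^bsub>p_completion p C\<^esub>"
    using ext_to_completion ring_hom_one[OF G] by auto
qed

end

text \<open>No continuity is assumed: modulo \<open>p ^ n\<close> every element comes from the
  uncompleted ring, and homomorphisms preserve such congruences.\<close>

lemma completion_hom_unique:
  assumes A: "cring A" and C: "cring C"
    and h: "h \<in> ring_hom (p_completion p A) (p_completion p C)"
    and h': "h' \<in> ring_hom (p_completion p A) (p_completion p C)"
    and eq: "\<And>a. a \<in> carrier A \<Longrightarrow> h (to_completion p A a) = h' (to_completion p A a)"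
    and s: "s \<in> carrier (p_completion p A)"
  shows "h s = h' s"
proof -
  interpret A: cring A by (rule A)
  interpret C: cring C by (rule C)
  interpret CC: cring "p_completion p C" by (rule C.completion_cring)
  show ?thesis
  proof (rule C.completion_eqI)
    fix n
    obtain a where a: "a \<in> carrier A" "pcong p (p_completion p A) n s (to_completion p A a)"
      using A.completion_approx s by blast
    show "pcong p (p_completion p C) n (h s) (h' s)"
      using pcong_hom[OF A.completion_cring C.completion_cring h a(2)]
        pcong_hom[OF A.completion_cring C.completion_cring h' a(2)] eq[OF a(1)]
        CC.pcong_sym[of p n "h' s"] CC.pcong_trans[of p n "h s" "h' (to_completion p A a)" "h' s"] by simp
  qed (use s h h' ring_hom_closed in metis)+
qed

text \<open>Successive approximation: write c = h(s) + p r, repeat with r in place of c, and sum the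
  preimages with weights \<open>p ^ k\<close>.\<close>

lemma completion_hom_surj:
  assumes A: "cring A" and C: "cring C"
    and h: "h \<in> ring_hom (p_completion p A) (p_completion p C)"
    and modp: "\<And>c. c \<in> carrier (p_completion p C) \<Longrightarrow>
      \<exists>s\<in>carrier (p_completion p A). pcong p (p_completion p C) 1 c (h s)"
    and c: "c \<in> carrier (p_completion p C)"
  shows "\<exists>s\<in>carrier (p_completion p A). h s = c"
proof -
  interpret A: cring A by (rule A)
  interpret C: cring C by (rule C)
  interpret CC: cring "p_completion p C" by (rule C.completion_cring)
  interpret AA: cring "p_completion p A" by (rule A.completion_cring)
  note hc = ring_hom_closed[OF h]
  have "\<forall>c\<in>carrier (p_completion p C). \<exists>s r. s \<in> carrier (p_completion p A) \<and> r \<in> carrier (p_completion p C) \<and>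
     c = h s \<oplus>\<^bsub>p_completion p C\<^esub> [p] \<cdot>\<^bsub>p_completion p C\<^esub> r"
    using modp unfolding pcong_def by fastforce
  then obtain \<sigma> \<rho> where sr: "\<And>c. c \<in> carrier (p_completion p C) \<Longrightarrow> \<sigma> c \<in> carrier (p_completion p A)"
    "\<And>c. c \<in> carrier (p_completion p C) \<Longrightarrow> \<rho> c \<in> carrier (p_completion p C)"
    "\<And>c. c \<in> carrier (p_completion p C) \<Longrightarrow> c = h (\<sigma> c) \<oplus>\<^bsub>p_completion p C\<^esub> [p] \<cdot>\<^bsub>p_completion p C\<^esub> \<rho> c"
    by metis
  define r where "r k = (\<rho> ^^ k) c" for k
  have r: "r k \<in> carrier (p_completion p C)" for k by (induction k) (auto simp: r_def c sr)
  \<comment> \<open>Partial sums of the p-adic series for the preimage; the remainder after k steps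
    is \<open>p ^ k\<close> times \<open>r k\<close>.\<close>
  define t where "t = rec_nat \<zero>\<^bsub>p_completion p A\<^esub> (\<lambda>k x. x \<oplus>\<^bsub>p_completion p A\<^esub> [(p ^ k)] \<cdot>\<^bsub>p_completion p A\<^esub> \<sigma> (r k))"
  have t0: "t 0 = \<zero>\<^bsub>p_completion p A\<^esub>" and tS: "t (Suc k) = t k \<oplus>\<^bsub>p_completion p A\<^esub> [(p ^ k)] \<cdot>\<^bsub>p_completion p A\<^esub> \<sigma> (r k)" for k
    by (auto simp: t_def)
  have t: "t k \<in> carrier (p_completion p A)" for k
    by (induction k) (auto simp: t0 tS intro!: AA.a_closed AA.nmult_closed sr r)
  have "coherent p (p_completion p A) t"
    unfolding coherent_def tS by (auto intro!: AA.pcongI t sr r)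
  then obtain s where s: "s \<in> carrier (p_completion p A)" "\<And>n. pcong p (p_completion p A) n s (t n)"
    using A.completion_limit by blast
  have ct: "c = h (t k) \<oplus>\<^bsub>p_completion p C\<^esub> [(p ^ k)] \<cdot>\<^bsub>p_completion p C\<^esub> r k" for k
  proof (induction k)
    case 0
    then show ?case using c
      by (simp add: t0 ring_hom_zero[OF h AA.ring_axioms CC.ring_axioms] r_def)
  next
    case (Suc k)
    have "[(p ^ k)] \<cdot>\<^bsub>p_completion p C\<^esub> r k = [(p ^ k)] \<cdot>\<^bsub>p_completion p C\<^esub> (h (\<sigma> (r k)) \<oplus>\<^bsub>p_completion p C\<^esub> [p] \<cdot>\<^bsub>p_completion p C\<^esub> r (Suc k))"
      using sr(3)[OF r, of k] by (simp add: r_def)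
    also have "\<dots> = [(p ^ k)] \<cdot>\<^bsub>p_completion p C\<^esub> h (\<sigma> (r k)) \<oplus>\<^bsub>p_completion p C\<^esub> [(p ^ Suc k)] \<cdot>\<^bsub>p_completion p C\<^esub> r (Suc k)"
      using r hc sr by (simp add: CC.nmult_add CC.nmult_nmult mult.commute)
    finally show ?case
      using Suc t r sr hc
      by (simp add: tS ring_hom_add[OF h] ring_hom_nmult[OF A.completion_cring C.completion_cring h] CC.a_assoc del: power_Suc)
  qed
  have "h s = c"
  proof (rule C.completion_eqI)
    fix n
    have "pcong p (p_completion p C) n (h s) (h (t n))"
      using pcong_hom[OF A.completion_cring C.completion_cring h s(2)] .
    moreover have "pcong p (p_completion p C) n c (h (t n))"
      unfolding pcong_def using c hc t r ct by blast
    ultimately show "pcong p (p_completion p C) n (h s) c" by (rule CC.pcong_trans[OF _ CC.pcong_sym])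
  qed (use s hc c in auto)
  then show ?thesis using s by blast
qed

lemma completion_map_hom:
  assumes "cring A" "cring C" "g \<in> ring_hom A C"
  shows "completion_map p C g \<in> ring_hom (p_completion p A) (p_completion p C)"
    and "a \<in> carrier A \<Longrightarrow> completion_map p C g (to_completion p A a) = to_completion p C (g a)"
proof -
  have "to_completion p C \<circ> g \<in> ring_hom A (p_completion p C)"
    using ring_hom_trans[OF assms(3) cring.to_completion_ring_hom[OF assms(2)]] .
  then interpret completion_hom p A C "\<lambda>z. to_completion p C (g z)"
    using assms by (simp add: completion_hom_def comp_def)
  show "completion_map p C g \<in> ring_hom (p_completion p A) (p_completion p C)"
    unfolding completion_map_eq_ext by (rule ext_hom)
  show "a \<in> carrier A \<Longrightarrow> completion_map p C g (to_completion p A a) = to_completion p C (g a)"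
    unfolding completion_map_eq_ext by (rule ext_to_completion)
qed

lemma completion_map_surj:
  assumes A: "cring A" and C: "cring C" and g: "g \<in> ring_hom A C"
    and modp: "\<And>c. c \<in> carrier C \<Longrightarrow> \<exists>a\<in>carrier A. pcong p C 1 c (g a)"
    and c: "c \<in> carrier (p_completion p C)"
  shows "\<exists>s\<in>carrier (p_completion p A). completion_map p C g s = c"
proof (rule completion_hom_surj[OF A C completion_map_hom(1)[OF A C g] _ c])
  interpret C: cring C by (rule C)
  interpret A: cring A by (rule A)
  interpret CC: cring "p_completion p C" by (rule C.completion_cring)
  fix c assume "c \<in> carrier (p_completion p C)"
  then obtain d where d: "d \<in> carrier C" "pcong p (p_completion p C) 1 c (to_completion p C d)"
    using C.completion_approx by blast
  obtain a where a: "a \<in> carrier A" "pcong p C 1 d (g a)" using modp d by blast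
  have "pcong p (p_completion p C) 1 (to_completion p C d) (to_completion p C (g a))"
    using pcong_hom[OF C C.completion_cring C.to_completion_ring_hom a(2)] .
  then have "pcong p (p_completion p C) 1 c (completion_map p C g (to_completion p A a))"
    using d CC.pcong_trans completion_map_hom(2)[OF A C g a(1)] by metis
  then show "\<exists>s\<in>carrier (p_completion p A). pcong p (p_completion p C) 1 c (completion_map p C g s)"
    using a ring_hom_closed[OF A.to_completion_ring_hom] by blast
qed

section \<open>Powers modulo p\<close>

context cring
begin

lemma binomial:
  assumes [simp]: "a \<in> carrier R" "b \<in> carrier R"
  shows "(a \<oplus> b) [^] n = (\<Oplus>k\<in>{..n}. [(n choose k)] \<cdot> (a [^] k \<otimes> b [^] (n - k)))"
proof (induction n)
  case 0
  then show ?case by simp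
next
  case (Suc n)
  let ?f = "\<lambda>n k. [(n choose k)] \<cdot> (a [^] k \<otimes> b [^] (n - k))"
  have "(\<Oplus>k\<in>{..Suc n}. ?f (Suc n) k) = (\<Oplus>k\<in>{..n}. ?f (Suc n) (Suc k)) \<oplus> ?f (Suc n) 0"
    by (subst finsum_Suc2) auto
  also have "(\<Oplus>k\<in>{..n}. ?f (Suc n) (Suc k)) =
     (\<Oplus>k\<in>{..n}. ?f n k \<otimes> a \<oplus> [(n choose Suc k)] \<cdot> (a [^] Suc k \<otimes> b [^] (n - k)))"
    by (rule finsum_cong') (auto simp: nmult_plus nmult_l nmult_r m_ac)
  also have "\<dots> = (\<Oplus>k\<in>{..n}. ?f n k \<otimes> a) \<oplus> (\<Oplus>k\<in>{..n}. [(n choose Suc k)] \<cdot> (a [^] Suc k \<otimes> b [^] (n - k)))"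
    by (rule finsum_addf) auto
  also have "\<dots> \<oplus> ?f (Suc n) 0 = (\<Oplus>k\<in>{..n}. ?f n k \<otimes> a) \<oplus>
     ((\<Oplus>k\<in>{..n}. [(n choose Suc k)] \<cdot> (a [^] Suc k \<otimes> b [^] (n - k))) \<oplus> ?f (Suc n) 0)"
    by (rule a_assoc) (auto intro!: finsum_closed)
  also have "(\<Oplus>k\<in>{..n}. [(n choose Suc k)] \<cdot> (a [^] Suc k \<otimes> b [^] (n - k))) \<oplus> ?f (Suc n) 0
     = (\<Oplus>k\<in>{..Suc n}. [(n choose k)] \<cdot> (a [^] k \<otimes> b [^] (Suc n - k)))"
    by (subst finsum_Suc2) auto
  also have "\<dots> = (\<Oplus>k\<in>{..n}. [(n choose k)] \<cdot> (a [^] k \<otimes> b [^] (Suc n - k)))"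
    by (subst finsum_Suc) (auto intro!: finsum_closed simp: binomial_eq_0)
  also have "\<dots> = (\<Oplus>k\<in>{..n}. ?f n k \<otimes> b)"
    by (rule finsum_cong') (auto simp: nmult_l Suc_diff_le m_assoc)
  also have "(\<Oplus>k\<in>{..n}. ?f n k \<otimes> a) \<oplus> (\<Oplus>k\<in>{..n}. ?f n k \<otimes> b) = (a \<oplus> b) [^] n \<otimes> (a \<oplus> b)"
    unfolding Suc by (subst (1 2) finsum_ldistr[symmetric]) (auto simp: r_distr intro!: finsum_closed)
  finally show ?case by simp
qed

text \<open>The mixed terms share not only p but also a factor \<open>a\<close>. That second factor
  is what \<open>pcong_pow_p\<close> exploits, with \<open>a\<close> itself a multiple of a power of
  p.\<close>

lemma binomial_prime:
  fixes p :: nat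
  assumes p: "Factorial_Ring.prime p" and ab[simp]: "a \<in> carrier R" "b \<in> carrier R"
  shows "\<exists>c\<in>carrier R. (a \<oplus> b) [^] p = a [^] p \<oplus> (b [^] p \<oplus> [p] \<cdot> (a \<otimes> c))"
proof -
  let ?f = "\<lambda>k. [(p choose k)] \<cdot> (a [^] k \<otimes> b [^] (p - k))"
  obtain m where m: "p = Suc (Suc m)" using prime_ge_2_nat[OF p] by (metis add_2_eq_Suc le_Suc_ex)
  have S: "(\<Oplus>k\<in>A. f k) \<in> {[p] \<cdot> (a \<otimes> c) |c. c \<in> carrier R}" if "finite A" "\<And>k. k \<in> A \<Longrightarrow> f k \<in> {[p] \<cdot> (a \<otimes> c) |c. c \<in> carrier R}"
    for A and f :: "nat \<Rightarrow> 'a" using that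
  proof (induction A)
    case empty
    then show ?case by (auto intro!: exI[of _ \<zero>])
  next
    case (insert x F)
    from insert.prems[of x] obtain c where c: "c \<in> carrier R" "f x = [p] \<cdot> (a \<otimes> c)" by auto
    from insert.IH insert.prems obtain d where d: "d \<in> carrier R" "(\<Oplus>k\<in>F. f k) = [p] \<cdot> (a \<otimes> d)" by auto
    have "(\<Oplus>k\<in>insert x F. f k) = f x \<oplus> (\<Oplus>k\<in>F. f k)"
      using insert.hyps insert.prems by (intro finsum_insert) (auto, force+)
    also have "\<dots> = [p] \<cdot> (a \<otimes> (c \<oplus> d))" using c d by (simp add: r_distr nmult_add)
    finally show ?case using c d by blast
  qed
  have "?f (Suc k) \<in> {[p] \<cdot> (a \<otimes> c) |c. c \<in> carrier R}" if "k \<le> m" for k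
  proof -
    have "p dvd (p choose Suc k)" using p m that by (intro dvd_choose_prime) auto
    then obtain q where q: "p choose Suc k = p * q" by (elim dvdE)
    have "?f (Suc k) = [p] \<cdot> (a \<otimes> [q] \<cdot> (a [^] k \<otimes> b [^] (p - Suc k)))"
    proof -
      let ?x = "a [^] k \<otimes> b [^] (p - Suc k)"
      have "a [^] Suc k \<otimes> b [^] (p - Suc k) = a \<otimes> ?x" by (simp add: m_ac)
      moreover have "[(p * q)] \<cdot> (a \<otimes> ?x) = [p] \<cdot> ([q] \<cdot> (a \<otimes> ?x))" by (rule nmult_nmult[symmetric]) simp
      moreover have "[q] \<cdot> (a \<otimes> ?x) = a \<otimes> [q] \<cdot> ?x" by (rule nmult_r[symmetric]) simp_all
      ultimately show ?thesis by (simp only: q)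
    qed
    moreover have "[q] \<cdot> (a [^] k \<otimes> b [^] (p - Suc k)) \<in> carrier R" by simp
    ultimately show ?thesis unfolding mem_Collect_eq by (intro exI conjI)
  qed
  then obtain c where c: "c \<in> carrier R" "(\<Oplus>k\<in>{..m}. ?f (Suc k)) = [p] \<cdot> (a \<otimes> c)"
    using S[of "{..m}" "\<lambda>k. ?f (Suc k)"] by auto
  have "(a \<oplus> b) [^] p = (\<Oplus>k\<in>{..Suc (Suc m)}. ?f k)" using binomial[OF ab, of p] m by simp
  also have "\<dots> = ?f (Suc (Suc m)) \<oplus> ((\<Oplus>k\<in>{..m}. ?f (Suc k)) \<oplus> ?f 0)"
    by (subst finsum_Suc, simp, subst finsum_Suc2) auto
  also have "\<dots> = a [^] p \<oplus> (b [^] p \<oplus> [p] \<cdot> (a \<otimes> c))"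
    unfolding c using c by (simp add: m[symmetric] a_ac)
  finally show ?thesis using c by blast
qed

lemma pcong_frobenius_add:
  fixes p :: nat
  assumes p: "Factorial_Ring.prime p" and ab[simp]: "a \<in> carrier R" "b \<in> carrier R"
  shows "pcong p R 1 ((a \<oplus> b) [^] p) (a [^] p \<oplus> b [^] p)"
proof -
  obtain c where "c \<in> carrier R" "(a \<oplus> b) [^] p = a [^] p \<oplus> (b [^] p \<oplus> [p] \<cdot> (a \<otimes> c))"
    using binomial_prime[OF assms] by auto
  then show ?thesis using pcongI[of "a [^] p \<oplus> b [^] p" "a \<otimes> c" p 1] by (simp add: a_assoc)
qed

text \<open>In (b + p^(m+1) x)^p every term except b^p gains a factor p: the mixed ones from the
  binomial coefficient, the pure power because (m+1) p is at least m + 2.\<close>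

lemma pcong_pow_p:
  assumes p: "Factorial_Ring.prime p" and ab: "pcong p R (Suc m) a b"
  shows "pcong p R (Suc (Suc m)) (a [^] p) (b [^] p)"
proof -
  obtain x where x: "x \<in> carrier R" "a = b \<oplus> [(p ^ Suc m)] \<cdot> x" "b \<in> carrier R" using ab unfolding pcong_def by auto
  let ?d = "[(p ^ Suc m)] \<cdot> x"
  have d: "?d \<in> carrier R" using x by simp
  obtain c where c: "c \<in> carrier R" "(?d \<oplus> b) [^] p = ?d [^] p \<oplus> (b [^] p \<oplus> [p] \<cdot> (?d \<otimes> c))"
    using binomial_prime[OF p d x(3)] by auto
  have 1: "pcong p R (Suc (Suc m)) (?d [^] p) \<zero>"
  proof -
    have "Suc (Suc m) \<le> Suc m * 2" by simp
    also have "\<dots> \<le> Suc m * p" using prime_ge_2_nat[OF p] mult_le_mono2 by blast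
    finally have "Suc (Suc m) \<le> Suc m * p" .
    moreover have "?d [^] p = [(p ^ (Suc m * p))] \<cdot> (x [^] p)" using x by (simp add: nmult_pow del: power_Suc mult_Suc flip: power_mult)
    ultimately show ?thesis using x pcong_p_zero pcong_mono by (metis nat_pow_closed)
  qed
  have 2: "pcong p R (Suc (Suc m)) ([p] \<cdot> (?d \<otimes> c)) \<zero>"
  proof -
    have "[p] \<cdot> (?d \<otimes> c) = [(p ^ Suc (Suc m))] \<cdot> (x \<otimes> c)" using x c by (simp add: nmult_l nmult_nmult)
    then show ?thesis using pcong_p_zero x c by (metis m_closed)
  qed
  have "pcong p R (Suc (Suc m)) ((?d \<oplus> b) [^] p) (\<zero> \<oplus> (b [^] p \<oplus> \<zero>))"
    unfolding c using 1 2 x by (intro pcong_add) auto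
  then show ?thesis using x by (simp add: a_comm)
qed

lemma pcong_pow_p_pow:
  assumes p: "Factorial_Ring.prime p" and ab: "pcong p R 1 a b"
  shows "pcong p R (Suc n) (a [^] (p ^ n)) (b [^] (p ^ n))"
proof (induction n)
  case 0
  then show ?case using ab pcong_carr[OF ab] by simp
next
  case (Suc n)
  have "a [^] p ^ Suc n = (a [^] p ^ n) [^] p" if "a \<in> carrier R" for a
    using that by (simp add: nat_pow_pow mult.commute)
  then show ?case using pcong_pow_p[OF p Suc] pcong_carr[OF ab] by simp
qed

end

section \<open>Rings inside a type\<close>

lemma sub_of_type_simps [simp]:
  "carrier (sub_of_type S) = S" "x \<otimes>\<^bsub>sub_of_type S\<^esub> y = x * y" "x \<oplus>\<^bsub>sub_of_type S\<^esub> y = x + y"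
  "\<one>\<^bsub>sub_of_type S\<^esub> = 1" "\<zero>\<^bsub>sub_of_type S\<^esub> = 0"
  by (auto simp: sub_of_type_def ring_of_type_algebra_def)

lemma sub_of_type_pow [simp]: "x [^]\<^bsub>sub_of_type S\<^esub> (n::nat) = x ^ n"
  by (induction n) (auto simp: nat_pow_def mult.commute power_commutes)

lemma sub_of_type_nmult [simp]: "[(k::nat)] \<cdot>\<^bsub>sub_of_type S\<^esub> x = of_nat k * x"
  by (induction k) (auto simp: add_pow_def nat_pow_def algebra_simps)

lemma sub_of_type_cring:
  fixes S :: "'a::comm_ring_1 set"
  assumes "1 \<in> S" "\<And>x y. x \<in> S \<Longrightarrow> y \<in> S \<Longrightarrow> x * y \<in> S"
    "\<And>x y. x \<in> S \<Longrightarrow> y \<in> S \<Longrightarrow> x + y \<in> S" "\<And>x. x \<in> S \<Longrightarrow> - x \<in> S"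
  shows "cring (sub_of_type S)"
proof -
  have "0 \<in> S" using assms(3)[OF assms(1) assms(4)[OF assms(1)]] by simp
  then show ?thesis using assms
    by (intro cringI abelian_groupI comm_monoidI) (auto simp: algebra_simps intro: bexI[of _ "- x" for x])
qed

section \<open>Linear extensions\<close>

text \<open>One construction serves three purposes: evaluating jet polynomials, evaluating
  polynomials with fractional exponents at p, and mapping formal tensors with integer
  coefficients.\<close>

definition lin_ext :: "('c, 'n) ring_scheme \<Rightarrow> ('e \<Rightarrow> 'k \<Rightarrow> 'c) \<Rightarrow> ('e \<Rightarrow>\<^sub>0 'k::zero) \<Rightarrow> 'c" where
  "lin_ext C T f = (\<Oplus>\<^bsub>C\<^esub>e\<in>Poly_Mapping.keys f. T e (poly_mapping.lookup f e))"

definition supported :: "'k::zero set \<Rightarrow> 'e set \<Rightarrow> ('e \<Rightarrow>\<^sub>0 'k) set" where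
  "supported K P = {f. range (poly_mapping.lookup f) \<subseteq> K \<and> Poly_Mapping.keys f \<subseteq> P}"

lemma poly_mapping_expand:
  "f = (\<Sum>e\<in>Poly_Mapping.keys f. Poly_Mapping.single e (poly_mapping.lookup f e))"
  by (rule poly_mapping_eqI) (auto simp: lookup_sum lookup_single when_def in_keys_iff)

lemma supported_induct [consumes 1, case_names zero add]:
  fixes f :: "'e \<Rightarrow>\<^sub>0 'k::comm_monoid_add"
  assumes f: "f \<in> supported K P" and zero: "Q 0"
    and add: "\<And>e c g. e \<in> P \<Longrightarrow> c \<in> K \<Longrightarrow> Q g \<Longrightarrow> Q (Poly_Mapping.single e c + g)"
  shows "Q f"
proof -
  have "Q (\<Sum>e\<in>Z. Poly_Mapping.single e (poly_mapping.lookup f e))" if "finite Z" "Z \<subseteq> Poly_Mapping.keys f" for Z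
    using that
  proof (induction Z)
    case empty then show ?case using zero by simp
  next
    case (insert x F)
    then show ?case using f by (auto intro!: add simp: supported_def)
  qed
  from this[of "Poly_Mapping.keys f"] show ?thesis using poly_mapping_expand[of f] by simp
qed

locale linear_extension = C?: cring C for C :: "('c, 'n) ring_scheme" (structure) +
  fixes K :: "'k::comm_monoid_add set" and P :: "'e set" and T :: "'e \<Rightarrow> 'k \<Rightarrow> 'c"
  assumes T_closed [simp]: "e \<in> P \<Longrightarrow> c \<in> K \<Longrightarrow> T e c \<in> carrier C"
    and T_zero [simp]: "e \<in> P \<Longrightarrow> T e 0 = \<zero>"
    and T_add: "e \<in> P \<Longrightarrow> c \<in> K \<Longrightarrow> d \<in> K \<Longrightarrow> T e (c + d) = T e c \<oplus> T e d"
    and K_zero [simp]: "0 \<in> K"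
    and K_add: "c \<in> K \<Longrightarrow> d \<in> K \<Longrightarrow> c + d \<in> K"
begin

lemma lookup_supported: "f \<in> supported K P \<Longrightarrow> poly_mapping.lookup f e \<in> K"
  by (auto simp: supported_def)

lemma lin_ext_superset:
  assumes "f \<in> supported K P" "finite Z" "Poly_Mapping.keys f \<subseteq> Z" "Z \<subseteq> P"
  shows "lin_ext C T f = (\<Oplus>e\<in>Z. T e (poly_mapping.lookup f e))"
  unfolding lin_ext_def using assms lookup_supported[OF assms(1)]
  by (intro add.finprod_mono_neutral_cong_left) (auto simp: in_keys_iff)

lemma supported_add: "f \<in> supported K P \<Longrightarrow> g \<in> supported K P \<Longrightarrow> f + g \<in> supported K P"
  using keys_add[of f g] K_add unfolding supported_def lookup_add image_subset_iff mem_Collect_eq by blast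

lemma supported_single: "e \<in> P \<Longrightarrow> c \<in> K \<Longrightarrow> Poly_Mapping.single e c \<in> supported K P"
  by (auto simp: supported_def lookup_single when_def)

lemma lin_ext_add:
  assumes "f \<in> supported K P" "g \<in> supported K P"
  shows "lin_ext C T (f + g) = lin_ext C T f \<oplus> lin_ext C T g"
proof -
  let ?Z = "Poly_Mapping.keys f \<union> Poly_Mapping.keys g"
  have Z: "?Z \<subseteq> P" using assms by (auto simp: supported_def)
  have "lin_ext C T (f + g) = (\<Oplus>e\<in>?Z. T e (poly_mapping.lookup f e + poly_mapping.lookup g e))"
    using lin_ext_superset[OF supported_add[OF assms], of ?Z] Z keys_add[of f g] by (simp add: lookup_add)
  also have "\<dots> = (\<Oplus>e\<in>?Z. T e (poly_mapping.lookup f e) \<oplus> T e (poly_mapping.lookup g e))"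
    using Z assms lookup_supported by (intro finsum_cong') (auto intro!: T_add)
  also have "\<dots> = (\<Oplus>e\<in>?Z. T e (poly_mapping.lookup f e)) \<oplus> (\<Oplus>e\<in>?Z. T e (poly_mapping.lookup g e))"
    using Z assms lookup_supported by (intro finsum_addf) auto
  also have "\<dots> = lin_ext C T f \<oplus> lin_ext C T g"
    using lin_ext_superset[OF assms(1), of ?Z] lin_ext_superset[OF assms(2), of ?Z] Z by simp
  finally show ?thesis .
qed

lemma lin_ext_zero [simp]: "lin_ext C T 0 = \<zero>"
  by (simp add: lin_ext_def)

lemma lin_ext_single: "e \<in> P \<Longrightarrow> c \<in> K \<Longrightarrow> lin_ext C T (Poly_Mapping.single e c) = T e c"
  using lin_ext_superset[OF supported_single, of e c "{e}"] by (simp add: finsum_singleton)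

lemma lin_ext_closed [simp]: "f \<in> supported K P \<Longrightarrow> lin_ext C T f \<in> carrier C"
  unfolding lin_ext_def using lookup_supported[of f] by (intro finsum_closed) (auto simp: supported_def)

end

locale multiplicative_extension = linear_extension C K P T
  for C :: "('c, 'n) ring_scheme" (structure) and K :: "'k::comm_semiring_1 set"
    and P :: "'e::comm_monoid_add set" and T +
  assumes K_mult: "c \<in> K \<Longrightarrow> d \<in> K \<Longrightarrow> c * d \<in> K"
    and P_add: "e \<in> P \<Longrightarrow> e' \<in> P \<Longrightarrow> e + e' \<in> P"
    and T_mult: "e \<in> P \<Longrightarrow> e' \<in> P \<Longrightarrow> c \<in> K \<Longrightarrow> d \<in> K \<Longrightarrow> T (e + e') (c * d) = T e c \<otimes> T e' d"
begin

lemma zero_supported: "0 \<in> supported K P"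
  by (auto simp: supported_def)

lemma single_mult_ext:
  assumes g: "g \<in> supported K P" and e: "e \<in> P" "c \<in> K"
  shows "Poly_Mapping.single e c * g \<in> supported K P \<and> g \<in> supported K P \<and>
    lin_ext C T (Poly_Mapping.single e c * g) = T e c \<otimes> lin_ext C T g"
  using g
proof (induction g rule: supported_induct)
  case zero then show ?case using e by (simp add: zero_supported)
next
  case (add e' c' g)
  have s: "Poly_Mapping.single e c * Poly_Mapping.single e' c' = Poly_Mapping.single (e + e') (c * c')"
    by (simp add: mult_single)
  have "Poly_Mapping.single (e + e') (c * c') \<in> supported K P" using add e by (simp add: supported_single K_mult P_add)
  then show ?case using add e
    by (simp add: distrib_left s lin_ext_add lin_ext_single supported_add supported_single K_mult P_add T_mult r_distr)
qed

lemma
  assumes f: "f \<in> supported K P" and g: "g \<in> supported K P"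
  shows supported_mult: "f * g \<in> supported K P"
    and lin_ext_mult: "lin_ext C T (f * g) = lin_ext C T f \<otimes> lin_ext C T g"
proof -
  have "f * g \<in> supported K P \<and> f \<in> supported K P \<and> lin_ext C T (f * g) = lin_ext C T f \<otimes> lin_ext C T g"
    using f
  proof (induction f rule: supported_induct)
    case zero then show ?case using g by (simp add: zero_supported)
  next
    case (add e c f)
    then show ?case using g single_mult_ext[OF g add(1,2)]
      by (simp add: distrib_right lin_ext_add lin_ext_single supported_add supported_single l_distr)
  qed
  then show "f * g \<in> supported K P" "lin_ext C T (f * g) = lin_ext C T f \<otimes> lin_ext C T g" by auto
qed

end

section \<open>Jet polynomials\<close>

definition jet_exps :: "(nat \<Rightarrow>\<^sub>0 int) set" where
  "jet_exps = {e. \<forall>i\<ge>1. poly_mapping.lookup e i \<ge> 0}"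

lemma jet_poly_ring_eq: "jet_poly_ring R = sub_of_type (supported R jet_exps)"
  unfolding jet_poly_ring_def supported_def jet_exps_def by (simp add: subset_iff Ball_def)

lemma laurent_ring_eq: "laurent_ring R = sub_of_type (supported R {e. \<forall>i\<ge>1. poly_mapping.lookup e i = 0})"
  unfolding laurent_ring_def supported_def by (simp add: subset_iff Ball_def)

definition jet_inv :: "'k::field jet_poly" where
  "jet_inv = Poly_Mapping.single (Poly_Mapping.single 0 (-1)) 1"

lemma jet_inv_var: "jet_var 0 * jet_inv = 1"
  unfolding jet_var_def jet_inv_def mult_single single_add[symmetric] by simp

lemma jet_const_mult: "jet_const (a * b) = jet_const a * jet_const b"
  by (simp add: jet_const_def mult_single)

lemma jet_const_add: "jet_const (a + b) = jet_const a + jet_const b"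
  by (simp add: jet_const_def single_add)

lemma single_exponent_power:
  "Poly_Mapping.single (Poly_Mapping.single i (int n * k)) (1::'k::field) = Poly_Mapping.single (Poly_Mapping.single i k) 1 ^ n"
proof (induction n)
  case (Suc n)
  have "Poly_Mapping.single i (int (Suc n) * k) = Poly_Mapping.single i k + Poly_Mapping.single i (int n * k)"
    by (simp add: algebra_simps flip: single_add)
  then show ?case by (simp add: mult_single Suc[symmetric])
qed simp

text \<open>\<open>I\<close> lists the coordinates that may occur: \<open>{0}\<close> gives the
  Laurent ring, \<open>UNIV\<close> the whole jet polynomial ring.\<close>

lemma jet_generation:
  fixes f :: "'k::field jet_poly"
  assumes f: "f \<in> supported R {e \<in> jet_exps. Poly_Mapping.keys e \<subseteq> I}"
    and zero: "0 \<in> R" and one: "1 \<in> R"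
    and const: "\<And>r. r \<in> R \<Longrightarrow> Q (jet_const r)"
    and var: "\<And>i. i \<in> I \<Longrightarrow> Q (jet_var i)" and inv: "Q jet_inv"
    and add: "\<And>f g. Q f \<Longrightarrow> Q g \<Longrightarrow> Q (f + g)" and mult: "\<And>f g. Q f \<Longrightarrow> Q g \<Longrightarrow> Q (f * g)"
  shows "Q f"
proof -
  have one': "Q 1" using const[OF one] by (simp add: jet_const_def)
  have zero': "Q 0" using const[OF zero] by (simp add: jet_const_def)
  have pow: "Q (g ^ n)" if "Q g" for g n by (induction n) (auto intro: one' mult that)
  have term_case: "Q (Poly_Mapping.single (Poly_Mapping.single i k) 1)" if "i \<in> I" "i \<ge> 1 \<longrightarrow> k \<ge> 0" for i k
  proof (cases "k \<ge> 0")
    case True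
    then show ?thesis using pow[OF var[OF that(1)], of "nat k"] single_exponent_power[where 'k = 'k, of i "nat k" 1]
      by (simp add: jet_var_def)
  next
    case False
    then have "i = 0" using that by (cases i) auto
    then show ?thesis using False pow[OF inv, of "nat (- k)"] single_exponent_power[where 'k = 'k, of i "nat (- k)" "- 1"]
      by (simp add: jet_inv_def)
  qed
  have mono: "Q (Poly_Mapping.single e 1)" if e: "e \<in> jet_exps" "Poly_Mapping.keys e \<subseteq> I" for e
  proof -
    have "Q (Poly_Mapping.single (\<Sum>i\<in>Z. Poly_Mapping.single i (poly_mapping.lookup e i)) 1)"
      if "finite Z" "Z \<subseteq> Poly_Mapping.keys e" for Z
      using that
    proof (induction Z)
      case empty then show ?case using one' by simp
    next
      case (insert x F)
      then have "Q (Poly_Mapping.single (Poly_Mapping.single x (poly_mapping.lookup e x)) 1 *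
        Poly_Mapping.single (\<Sum>i\<in>F. Poly_Mapping.single i (poly_mapping.lookup e i)) 1)"
        using e by (intro mult term_case) (auto simp: jet_exps_def)
      then show ?case using insert by (simp add: mult_single)
    qed
    from this[of "Poly_Mapping.keys e"] show ?thesis using poly_mapping_expand[of e] by simp
  qed
  show ?thesis using f
  proof (induction f rule: supported_induct)
    case zero then show ?case by (rule zero')
  next
    case (add e c g)
    have "Poly_Mapping.single e c = jet_const c * Poly_Mapping.single e 1"
      by (simp add: jet_const_def mult_single)
    then show ?case using add const mono \<open>\<And>g f. Q f \<Longrightarrow> Q g \<Longrightarrow> Q (f + g)\<close> mult by auto
  qed
qed

section \<open>Evaluation of jet polynomials in a ring\<close>

locale jet_eval = C?: cring C for C :: "('c, 'n) ring_scheme" (structure) +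
  fixes R :: "'k::field set" and h :: "'k \<Rightarrow> 'c" and v :: "nat \<Rightarrow> 'c" and w :: 'c
  assumes cring_R: "cring (sub_of_type R)" and h: "h \<in> ring_hom (sub_of_type R) C"
    and v [simp]: "v i \<in> carrier C" and w [simp]: "w \<in> carrier C" and vw: "v 0 \<otimes> w = \<one>"
begin

text \<open>The inverse of \<open>v 0\<close> is carried as the parameter \<open>w\<close>, so
  negative exponents need no choice of an inverse.\<close>

definition zpow :: "int \<Rightarrow> 'c" where
  "zpow k = (if k \<ge> 0 then v 0 [^] nat k else w [^] nat (- k))"

lemma zpow_closed [simp]: "zpow k \<in> carrier C" by (simp add: zpow_def del: pow_nat)

lemma zpow_0 [simp]: "zpow 0 = \<one>" and zpow_1 [simp]: "zpow 1 = v 0" and zpow_m1 [simp]: "zpow (-1) = w"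
  by (auto simp: zpow_def simp del: pow_nat)

lemma zpow_Suc: "zpow (k + 1) = zpow k \<otimes> v 0"
proof (cases "k \<ge> 0")
  case True
  then have "nat (k + 1) = Suc (nat k)" by simp
  then show ?thesis using True by (simp add: zpow_def del: pow_nat)
next
  case False
  then obtain n where n: "k = - int (Suc n)" by (metis int_cases of_nat_0_le_iff)
  have "nat (- k) = Suc n" using n by simp
  then have "zpow k \<otimes> v 0 = w [^] n" using False vw by (simp add: zpow_def m_assoc m_comm[of w "v 0"] del: pow_nat)
  moreover have "zpow (k + 1) = w [^] n" using n by (cases n) (simp_all add: zpow_def nat_add_distrib del: pow_nat)
  ultimately show ?thesis by simp
qed

lemma zpow_pred: "zpow (k - 1) = zpow k \<otimes> w"
proof -
  have "zpow k = zpow (k - 1) \<otimes> v 0" using zpow_Suc[of "k - 1"] by simp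
  then show ?thesis using vw by (simp add: m_assoc)
qed

lemma zpow_add: "zpow (k + l) = zpow k \<otimes> zpow l"
proof (induction l rule: int_induct[where k = 0])
  case base then show ?case by simp
next
  case (step1 i)
  then show ?case using zpow_Suc[of "k + i"] zpow_Suc[of i] by (simp add: add.assoc m_assoc)
next
  case (step2 i)
  then show ?case using zpow_pred[of "k + i"] zpow_pred[of i] by (simp add: diff_add_eq m_assoc add_diff_eq)
qed

text \<open>\<open>nat\<close> loses nothing on \<open>jet_exps\<close>, where only the exponent at
  0 can be negative; multiplicativity is therefore stated on \<open>jet_exps\<close>.\<close>

definition jmono :: "(nat \<Rightarrow>\<^sub>0 int) \<Rightarrow> 'c" where
  "jmono e = zpow (poly_mapping.lookup e 0) \<otimes>
     (\<Otimes>i\<in>Poly_Mapping.keys e - {0}. v i [^] nat (poly_mapping.lookup e i))"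

lemma jmono_superset:
  assumes "finite Z" "Poly_Mapping.keys e \<subseteq> Z"
  shows "jmono e = zpow (poly_mapping.lookup e 0) \<otimes> (\<Otimes>i\<in>Z - {0}. v i [^] nat (poly_mapping.lookup e i))"
proof -
  have "(\<Otimes>i\<in>Poly_Mapping.keys e - {0}. v i [^] nat (poly_mapping.lookup e i)) =
      (\<Otimes>i\<in>Z - {0}. v i [^] nat (poly_mapping.lookup e i))"
    using assms by (intro finprod_mono_neutral_cong_left) (auto simp: in_keys_iff)
  then show ?thesis by (simp add: jmono_def)
qed

lemma jmono_closed [simp]: "jmono e \<in> carrier C"
  by (auto simp: jmono_def intro!: finprod_closed)

lemma jmono_add:
  assumes "e \<in> jet_exps" "e' \<in> jet_exps"
  shows "jmono (e + e') = jmono e \<otimes> jmono e'"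
proof -
  let ?Z = "Poly_Mapping.keys e \<union> Poly_Mapping.keys e'"
  have "(\<Otimes>i\<in>?Z - {0}. v i [^] nat (poly_mapping.lookup (e + e') i)) =
      (\<Otimes>i\<in>?Z - {0}. v i [^] nat (poly_mapping.lookup e i) \<otimes> v i [^] nat (poly_mapping.lookup e' i))"
    using assms by (intro finprod_cong') (auto simp: lookup_add jet_exps_def nat_add_distrib nat_pow_mult simp del: pow_nat)
  also have "\<dots> = (\<Otimes>i\<in>?Z - {0}. v i [^] nat (poly_mapping.lookup e i)) \<otimes>
      (\<Otimes>i\<in>?Z - {0}. v i [^] nat (poly_mapping.lookup e' i))"
    by (intro finprod_multf) auto
  finally have *: "(\<Otimes>i\<in>?Z - {0}. v i [^] nat (poly_mapping.lookup (e + e') i)) = \<dots>" .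
  have c: "(\<Otimes>i\<in>?Z - {0}. v i [^] nat (poly_mapping.lookup e i)) \<in> carrier C" for e
    by (auto intro!: finprod_closed)
  show ?thesis
    using jmono_superset[of ?Z e] jmono_superset[of ?Z e'] jmono_superset[of ?Z "e + e'"] keys_add[of e e'] * c
    by (simp add: lookup_add zpow_add m_ac)
qed

sublocale multiplicative_extension C R jet_exps "\<lambda>e c. h c \<otimes> jmono e"
proof -
  interpret R: cring "sub_of_type R" by (rule cring_R)
  note hc = ring_hom_closed[OF h, simplified] and hz = ring_hom_zero[OF h R.ring_axioms ring_axioms, simplified]
    and ha = ring_hom_add[OF h, simplified] and hm = ring_hom_mult[OF h, simplified]
  show "multiplicative_extension C R jet_exps (\<lambda>e c. h c \<otimes> jmono e)"
    using R.zero_closed R.a_closed R.m_closed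
    by unfold_locales (simp_all add: hc hz ha hm l_distr jmono_add, (simp add: jet_exps_def lookup_add)?, simp add: hc m_ac)
qed

definition jev :: "'k jet_poly \<Rightarrow> 'c" where "jev = lin_ext C (\<lambda>e c. h c \<otimes> jmono e)"

lemma one_R: "1 \<in> R" "0 \<in> R" "- 1 \<in> R"
proof -
  interpret R: cring "sub_of_type R" by (rule cring_R)
  show "1 \<in> R" "0 \<in> R" using R.one_closed R.zero_closed by auto
  have "\<ominus>\<^bsub>sub_of_type R\<^esub> 1 \<in> R" using R.a_inv_closed[OF R.one_closed] by simp
  moreover have "\<ominus>\<^bsub>sub_of_type R\<^esub> 1 = - 1"
    using R.l_neg[OF R.one_closed] by (simp add: eq_neg_iff_add_eq_0)
  ultimately show "- 1 \<in> R" by simp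
qed

lemma jev_const: "r \<in> R \<Longrightarrow> jev (jet_const r) = h r"
  unfolding jev_def jet_const_def using ring_hom_closed[OF h]
  by (subst lin_ext_single) (auto simp: jet_exps_def jmono_def)

lemma jev_one: "jev 1 = \<one>"
  using jev_const[OF one_R(1)] ring_hom_one[OF h] by (simp add: jet_const_def)

lemma jev_var: "jev (jet_var i) = v i"
proof -
  have "jmono (Poly_Mapping.single i 1) = v i"
  proof (cases "i = 0")
    case False
    then have "{i} - {0} = {i}" by auto
    moreover have "(\<Otimes>j\<in>{i}. v j [^] nat (poly_mapping.lookup (Poly_Mapping.single i 1) j)) = v i"
      by (subst finprod_insert) auto
    ultimately show ?thesis using False by (simp add: jmono_def lookup_single_not_eq del: lookup_frag_of)
  qed (simp add: jmono_def)
  then show ?thesis unfolding jev_def jet_var_def using one_R ring_hom_one[OF h]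
    by (subst lin_ext_single) (auto simp: jet_exps_def lookup_single when_def)
qed

lemma jev_hom: "jev \<in> ring_hom (jet_poly_ring R) C"
proof (rule ring_hom_memI)
  show "jev \<one>\<^bsub>jet_poly_ring R\<^esub> = \<one>" by (simp add: jet_poly_ring_eq jev_one)
qed (auto simp: jet_poly_ring_eq jev_def lin_ext_add lin_ext_mult)

lemma jet_poly_cring: "cring (jet_poly_ring R)"
  unfolding jet_poly_ring_eq
proof (rule sub_of_type_cring)
  have c: "jet_const r \<in> supported R jet_exps" if "r \<in> R" for r
    unfolding jet_const_def using that by (intro supported_single) (simp_all add: jet_exps_def)
  show "1 \<in> supported R jet_exps" using c[OF one_R(1)] by (simp add: jet_const_def)
  fix f assume f: "f \<in> supported R jet_exps"
  have "- f = jet_const (- 1) * f"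
    by (simp add: jet_const_def single_uminus)
  then show "- f \<in> supported R jet_exps" using supported_mult[OF c[OF one_R(3)] f] by simp
qed (simp_all add: supported_add supported_mult)

end

text \<open>Closure under products was obtained inside \<open>jet_eval\<close>, which needs some
  target; sending every coordinate to 1 in \<open>R\<close> itself provides one.\<close>

lemma jet_poly_ring_cring:
  assumes "cring (sub_of_type (R::'k::field set))" shows "cring (jet_poly_ring R)"
proof -
  interpret R: cring "sub_of_type R" by fact
  interpret jet_eval "sub_of_type R" R "\<lambda>x. x" "\<lambda>_. 1" 1
    using assms R.one_closed by unfold_locales (auto simp: ring_hom_def)
  show ?thesis by (rule jet_poly_cring)
qed

section \<open>The base ring\<close>

text \<open>The list \<open>P\<close> is X^n - c with leading coefficient first. It splits and has
  positive degree, so it has a root. This is what makes the residue field perfect.\<close>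

lemma (in algebraically_closed) exists_root_power:
  assumes c: "c \<in> carrier L" and n: "n > 0"
  shows "\<exists>x\<in>carrier L. x [^] (n::nat) = c"
proof -
  define P where "P = \<one> # replicate (n - 1) \<zero> @ [\<ominus> c]"
  have P: "P \<in> carrier (poly_ring L)"
    using c by (auto simp: P_def univ_poly_def polynomial_def)
  have deg: "Polynomials.degree P = n" using n by (simp add: P_def)
  have "splitted P" using roots_over_carrier[OF P] .
  then have "roots P \<noteq> {#}" unfolding splitted_def using deg n by auto
  then obtain x where "x \<in># roots P" by blast
  then have x: "is_root P x" using roots_mem_iff_is_root[OF P] by auto
  then have xc: "x \<in> carrier L" by (auto simp: is_root_def)
  have "eval (replicate k \<zero> @ [\<ominus> c]) x = \<ominus> c" for k
    by (induction k) (use c xc in auto)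
  then have "eval P x = x [^] n \<oplus> \<ominus> c" using n c xc by (simp add: P_def)
  then have "x [^] n \<oplus> \<ominus> c = \<zero>" using x by (simp add: is_root_def)
  then have "x [^] n = c" using c xc by (metis a_minus_def nat_pow_closed r_right_minus_eq)
  then show ?thesis using xc by blast
qed

text \<open>Induction on the number of generators. In the relation for the last one, 1 - t a(n) is
  invertible, so that generator is t times a combination of the others; substituting it keeps the
  remaining relations in the same shape.\<close>

lemma nakayama_span:
  fixes e :: "nat \<Rightarrow> 'k::field" and R :: "'k set"
  assumes add: "\<And>x y. x \<in> R \<Longrightarrow> y \<in> R \<Longrightarrow> x + y \<in> R" and mult: "\<And>x y. x \<in> R \<Longrightarrow> y \<in> R \<Longrightarrow> x * y \<in> R"
    and t: "t \<in> R" and unit: "\<And>r. r \<in> R \<Longrightarrow> \<exists>s\<in>R. s * (1 - t * r) = 1"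
    and rel: "\<forall>i<n. \<exists>a. (\<forall>j. a j \<in> R) \<and> e i = t * (\<Sum>j<n. a j * e j)"
  shows "\<forall>i<n. e i = 0"
  using rel
proof (induction n)
  case (Suc n)
  then obtain a where a: "\<And>j. a j \<in> R" "e n = t * (\<Sum>j<Suc n. a j * e j)" by blast
  obtain s where s: "s \<in> R" "s * (1 - t * a n) = 1" using unit a by blast
  have "(1 - t * a n) * e n = t * (\<Sum>j<n. a j * e j)" using a(2) by (simp add: algebra_simps)
  then have "s * ((1 - t * a n) * e n) = s * (t * (\<Sum>j<n. a j * e j))" by simp
  moreover have "s * ((1 - t * a n) * e n) = e n" using s(2) by (simp add: mult.assoc[symmetric])
  moreover have "s * (t * (\<Sum>j<n. a j * e j)) = t * (\<Sum>j<n. (s * a j) * e j)" by (simp add: sum_distrib_left mult_ac)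
  ultimately have en: "e n = t * (\<Sum>j<n. (s * a j) * e j)" by simp
  have "\<exists>a. (\<forall>j. a j \<in> R) \<and> e i = t * (\<Sum>j<n. a j * e j)" if "i < n" for i
  proof -
    obtain b where b: "\<And>j. b j \<in> R" "e i = t * (\<Sum>j<Suc n. b j * e j)"
      using Suc.prems[rule_format, OF less_SucI[OF \<open>i < n\<close>]] by blast
    have "e i = t * (\<Sum>j<n. b j * e j) + t * (b n * e n)" unfolding b(2) by (simp add: distrib_left)
    also have "t * (b n * e n) = t * (\<Sum>j<n. b n * t * s * a j * e j)"
      by (subst en) (simp add: sum_distrib_left mult_ac)
    finally have "e i = t * (\<Sum>j<n. (b j + b n * t * s * a j) * e j)"
      by (simp add: distrib_left distrib_right sum.distrib)
    moreover have "\<forall>j. b j + b n * t * s * a j \<in> R" using b(1) a(1) s(1) t by (intro allI add mult)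
    ultimately show ?thesis by (intro exI conjI)
  qed
  then have "\<forall>i<n. e i = 0" using Suc.IH by blast
  then show ?case using en by (auto simp: less_Suc_eq)
qed simp

locale base =
  fixes p :: nat and R :: "'k::field set" and \<phi> :: "'k \<Rightarrow> 'k" and \<pi> :: "nat \<Rightarrow> 'k"
  assumes p: "Factorial_Ring.prime p" "odd p"
    and subring: "subring R ring_of_type_algebra"
    and dvr: "complete_dvr_at p (sub_of_type R)"
    and residue: "algebraically_closed (sub_of_type R Quot p_ideal p (sub_of_type R) 1)"
    and frob: "frobenius_lift p (sub_of_type R) \<phi>"
    and roots: "\<pi> 0 = of_nat p" "\<And>m. \<pi> (Suc m) ^ p = \<pi> m"
begin

abbreviation "\<O> \<equiv> sub_of_type R"

lemma R_closed: "0 \<in> R" "1 \<in> R" "x \<in> R \<Longrightarrow> y \<in> R \<Longrightarrow> x + y \<in> R" "x \<in> R \<Longrightarrow> y \<in> R \<Longrightarrow> x * y \<in> R" "x \<in> R \<Longrightarrow> - x \<in> R"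
proof -
  interpret T: ring "ring_of_type_algebra :: 'k ring" by (rule ring_from_type_algebra)
  note E = subringE[OF subring]
  have "\<ominus>\<^bsub>ring_of_type_algebra\<^esub> x = - x" for x :: 'k
    by (rule T.minus_equality) (auto simp: ring_of_type_algebra_def)
  then show "0 \<in> R" "1 \<in> R" "x \<in> R \<Longrightarrow> y \<in> R \<Longrightarrow> x + y \<in> R" "x \<in> R \<Longrightarrow> y \<in> R \<Longrightarrow> x * y \<in> R" "x \<in> R \<Longrightarrow> - x \<in> R"
    using E by (auto simp: ring_of_type_algebra_def)
qed

lemma R_of_nat [simp]: "of_nat n \<in> R"
  by (induction n) (auto intro: R_closed)

lemma R_pow: "x \<in> R \<Longrightarrow> x ^ n \<in> R"
  by (induction n) (auto intro: R_closed)

lemma cring_O: "cring \<O>"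
  by (rule sub_of_type_cring) (auto intro: R_closed)

sublocale O: cring \<O> by (rule cring_O)

lemma p_gt: "p > 1" using p(1) by (rule prime_gt_1_nat)

lemma max_ideal: "maximalideal (p_ideal p \<O> 1) \<O>" using dvr unfolding complete_dvr_at_def by blast

lemma p_ideal_O: "x \<in> p_ideal p \<O> n \<longleftrightarrow> (\<exists>c\<in>R. x = of_nat p ^ n * c)"
  unfolding O.p_ideal_iff by simp

lemma pcong_O: "pcong p \<O> n a b \<longleftrightarrow> a \<in> R \<and> b \<in> R \<and> (\<exists>c\<in>R. a = b + of_nat p ^ n * c)"
  unfolding pcong_def by simp

text \<open>Otherwise the maximal ideal would be zero and \<open>R\<close> a field, which
  \<open>discrete_valuation_ring\<close> excludes.\<close>

lemma p_nonzero: "of_nat p \<noteq> (0::'k)"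
proof
  assume "of_nat p = (0::'k)"
  then have "p_ideal p \<O> 1 = {\<zero>\<^bsub>\<O>\<^esub>}" using R_closed(1) p_ideal_O[of _ 1] by auto
  then have "Ring.field \<O>" using max_ideal O.zeromaximalideal_eq_field by simp
  then show False using dvr unfolding complete_dvr_at_def discrete_valuation_ring_def by blast
qed

lemma one_notin_pR: "c \<in> R \<Longrightarrow> of_nat p * c \<noteq> 1"
proof
  assume c: "c \<in> R" "of_nat p * c = 1"
  then have "1 \<in> p_ideal p \<O> 1" using p_ideal_O[of 1 1] by auto
  then have "p_ideal p \<O> 1 = carrier \<O>"
    using ideal.one_imp_carrier[OF O.p_ideal_ideal] by simp
  then show False using maximalideal.I_notcarr[OF max_ideal] by simp
qed

lemma to_O_bij: "bij_betw (to_completion p \<O>) R (carrier (p_completion p \<O>))"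
  using dvr unfolding complete_dvr_at_def by simp

lemma R_separated:
  assumes "x \<in> R" "\<And>n. \<exists>c\<in>R. x = of_nat p ^ n * c" shows "x = 0"
proof -
  have "to_completion p \<O> x n = to_completion p \<O> 0 n" for n
    using assms R_closed(1) by (subst O.to_completion_eq_iff) (auto simp: pcong_O)
  then have "to_completion p \<O> x = to_completion p \<O> 0" by auto
  then show ?thesis using to_O_bij assms R_closed(1) by (auto simp: bij_betw_def inj_on_def)
qed

text \<open>The geometric series converges: the map to the completion is onto, which gives the
  limit, and injective, which gives the exact equation.\<close>

lemma one_minus_p_unit:
  assumes r: "r \<in> R" shows "\<exists>s\<in>R. s * (1 - of_nat p * r) = 1"
proof -
  let ?C = "p_completion p \<O>"
  interpret C: cring ?C by (rule O.completion_cring)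
  define t where "t n = (\<Sum>i<n. (of_nat p * r) ^ i)" for n
  have t: "t n \<in> R" for n unfolding t_def by (induction n) (auto intro!: R_closed R_pow r)
  have "t (Suc n) = t n + of_nat p ^ n * r ^ n" for n by (simp add: t_def power_mult_distrib)
  then have "coherent p \<O> t" unfolding coherent_def pcong_O
    using t R_pow[OF r] by blast
  then have "lim_seq p \<O> t \<in> carrier ?C" by (rule O.lim_seq_in)
  then obtain s where s: "s \<in> R" "lim_seq p \<O> t = to_completion p \<O> s"
    using to_O_bij unfolding bij_betw_def by auto
  have "\<exists>c\<in>R. s * (1 - of_nat p * r) - 1 = of_nat p ^ n * c" for n
  proof -
    have "to_completion p \<O> s n = to_completion p \<O> (t n) n" using s(2) by (metis lim_seq_def)
    then have "pcong p \<O> n s (t n)" using O.to_completion_eq_iff s t by simp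
    then obtain c where c: "c \<in> R" "s = t n + of_nat p ^ n * c" unfolding pcong_O by blast
    have "t n * (1 - of_nat p * r) = 1 - (of_nat p * r) ^ n"
      using one_diff_power_eq[of "of_nat p * r" n] by (simp add: t_def mult.commute)
    then have "s * (1 - of_nat p * r) - 1 = of_nat p ^ n * (c * (1 + - (of_nat p * r)) + - (r ^ n))"
      unfolding c by (simp add: algebra_simps power_mult_distrib)
    moreover have "c * (1 + - (of_nat p * r)) + - (r ^ n) \<in> R" using c r by (intro R_closed R_pow) auto
    ultimately show ?thesis by blast
  qed
  moreover have "s * (1 + - (of_nat p * r)) + - 1 \<in> R" using s r by (intro R_closed) auto
  ultimately have "s * (1 - of_nat p * r) - 1 = 0" by (intro R_separated) auto
  then show ?thesis using s by auto
qed

lemma unit_mod_p: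
  assumes c: "c \<in> R" "\<not> (\<exists>d\<in>R. c = of_nat p * d)"
  shows "\<exists>d\<in>R. \<exists>r\<in>R. d * c = 1 + of_nat p * r"
proof -
  let ?Q = "\<O> Quot p_ideal p \<O> 1"
  interpret Q: algebraically_closed ?Q by (rule residue)
  have c1: "to_completion p \<O> c 1 \<in> carrier ?Q" using O.quot_carrier c by auto
  have "to_completion p \<O> c 1 \<noteq> \<zero>\<^bsub>?Q\<^esub>"
  proof
    assume "to_completion p \<O> c 1 = \<zero>\<^bsub>?Q\<^esub>"
    also have "\<zero>\<^bsub>?Q\<^esub> = to_completion p \<O> 0 1"
      using ring_hom_zero[OF O.to_completion_hom O.ring_axioms Q.ring_axioms] by simp
    finally have "pcong p \<O> 1 c 0" using O.to_completion_eq_iff c R_closed by simp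
    then show False using c by (auto simp: pcong_O)
  qed
  then obtain U where U: "U \<in> carrier ?Q" "U \<otimes>\<^bsub>?Q\<^esub> to_completion p \<O> c 1 = \<one>\<^bsub>?Q\<^esub>"
    using Q.field_Units c1 by (metis Diff_iff Q.Units_l_inv_ex singletonD)
  then obtain d where d: "d \<in> R" "U = to_completion p \<O> d 1" using O.quot_carrier by auto
  have "to_completion p \<O> (d * c) 1 = to_completion p \<O> 1 1"
    using U d c ring_hom_mult[OF O.to_completion_hom] ring_hom_one[OF O.to_completion_hom] by fastforce
  then have "pcong p \<O> 1 (d * c) 1" using O.to_completion_eq_iff[of "d * c" 1] c d R_closed by simp
  then show ?thesis using d by (auto simp: pcong_O)
qed

lemma phi_hom: "\<phi> \<in> ring_hom \<O> \<O>" using frob by (simp add: frobenius_lift_def)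

lemma phi_frob: "a \<in> R \<Longrightarrow> pcong p \<O> 1 (\<phi> a) (a ^ p)"
proof -
  assume a: "a \<in> R"
  have "\<phi> a \<ominus>\<^bsub>\<O>\<^esub> a [^]\<^bsub>\<O>\<^esub> p \<in> p_ideal p \<O> 1" using frob a by (simp add: frobenius_lift_def)
  then show ?thesis using O.pcong_iff_minus[of "\<phi> a" "a ^ p" p 1] a ring_hom_closed[OF phi_hom] R_pow by simp
qed

text \<open>Surjective because the residue field is perfect, so that \<phi> is onto modulo p, and
  \<open>R\<close> is complete. Injective because an element of the kernel is divisible by p again
  and again, and \<open>R\<close> is separated. Both halves are needed to extend \<phi> to an
  automorphism.\<close>

lemma phi_bij: "bij_betw \<phi> R R"
proof -
  note pc = ring_hom_closed[OF phi_hom, simplified]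
  let ?Q = "\<O> Quot p_ideal p \<O> 1"
  interpret Q: algebraically_closed ?Q by (rule residue)
  interpret to1: ring_hom_cring \<O> ?Q "\<lambda>a. to_completion p \<O> a 1"
    using O.to_completion_hom Q.is_cring cring_O by (simp add: ring_hom_cring_def ring_hom_cring_axioms_def)
  \<comment> \<open>A p-th root of c in the residue field lifts to some a, and \<phi>(a) is
    congruent to a^p.\<close>
  have modp: "\<exists>a\<in>carrier \<O>. pcong p \<O> 1 c (\<phi> a)" if c: "c \<in> carrier \<O>" for c
  proof -
    have "to_completion p \<O> c 1 \<in> carrier ?Q" using c O.quot_carrier by auto
    from Q.exists_root_power[OF this, of p] p_gt
    obtain U where U: "U \<in> carrier ?Q" "U [^]\<^bsub>?Q\<^esub> p = to_completion p \<O> c 1" by auto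
    then obtain a where a: "a \<in> R" "U = to_completion p \<O> a 1" using O.quot_carrier by auto
    have "to_completion p \<O> (a ^ p) 1 = to_completion p \<O> c 1"
      using U a ring_hom_pow'[OF cring_O Q.is_cring O.to_completion_hom, of a p] by simp
    then have "pcong p \<O> 1 (a ^ p) c" using O.to_completion_eq_iff a c R_pow by simp
    then have "pcong p \<O> 1 c (\<phi> a)" using phi_frob[OF a(1)] O.pcong_sym O.pcong_trans by blast
    then show ?thesis using a by auto
  qed
  have surj: "\<exists>a\<in>R. \<phi> a = r" if r: "r \<in> R" for r
  proof -
    have "to_completion p \<O> r \<in> carrier (p_completion p \<O>)"
      using r ring_hom_closed[OF O.to_completion_ring_hom] by simp
    from completion_map_surj[OF cring_O cring_O phi_hom modp this]
    obtain s where s: "s \<in> carrier (p_completion p \<O>)" "completion_map p \<O> \<phi> s = to_completion p \<O> r" by blast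
    obtain a where a: "a \<in> R" "s = to_completion p \<O> a" using s to_O_bij by (auto simp: bij_betw_def)
    then have "to_completion p \<O> (\<phi> a) = to_completion p \<O> r"
      using s completion_map_hom(2)[OF cring_O cring_O phi_hom] by simp
    then have "\<phi> a = r" using to_O_bij a r pc by (auto simp: bij_betw_def inj_on_def)
    then show ?thesis using a by blast
  qed
  have phi_p: "\<phi> (of_nat n * x) = of_nat n * \<phi> x" if "x \<in> R" for n x
    using ring_hom_nmult[OF cring_O cring_O phi_hom, of x n] that by simp
  have inj0: "x = 0" if x: "x \<in> R" "\<phi> x = 0" for x
  proof -
    \<comment> \<open>If y were not divisible by p, some d y would equal 1 + p r; applying \<phi>
      gives 0 = 1 + p \<phi>(r), so p would be a unit.\<close>
    have step: "\<exists>d\<in>R. y = of_nat p * d \<and> \<phi> d = 0" if y: "y \<in> R" "\<phi> y = 0" for y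
    proof -
      have "\<exists>d\<in>R. y = of_nat p * d"
      proof (rule ccontr)
        assume "\<not> ?thesis"
        then obtain d r where d: "d \<in> R" "r \<in> R" "d * y = 1 + of_nat p * r" using unit_mod_p y by blast
        have "1 + of_nat p * \<phi> r = \<phi> (1 + of_nat p * r)"
          using d R_closed ring_hom_add[OF phi_hom] ring_hom_one[OF phi_hom] by (simp add: phi_p)
        also have "\<dots> = 0" using d(3)[symmetric] ring_hom_mult[OF phi_hom, of d y] d y by simp
        finally have "of_nat p * (- \<phi> r) = 1" by (simp add: add_eq_0_iff)
        then show False using one_notin_pR[OF R_closed(5)[OF pc[OF d(2)]]] by blast
      qed
      then obtain d where d: "d \<in> R" "y = of_nat p * d" by blast
      then have "of_nat p * \<phi> d = 0" using y phi_p by simp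
      then show ?thesis using d p_nonzero by auto
    qed
    have "\<exists>c\<in>R. x = of_nat p ^ n * c \<and> \<phi> c = 0" for n
    proof (induction n)
      case 0 then show ?case using x by auto
    next
      case (Suc n)
      then obtain c where c: "c \<in> R" "x = of_nat p ^ n * c" "\<phi> c = 0" by blast
      obtain d where "d \<in> R" "c = of_nat p * d" "\<phi> d = 0" using step c by blast
      then show ?case using c by (intro bexI[of _ d]) auto
    qed
    then show ?thesis using x by (intro R_separated) blast+
  qed
  have "inj_on \<phi> R"
  proof (rule inj_onI)
    fix x y assume xy: "x \<in> R" "y \<in> R" "\<phi> x = \<phi> y"
    have xmy: "x - y \<in> R" using xy R_closed(3)[of x "- y"] R_closed(5) by simp
    have "\<phi> x = \<phi> ((x - y) + y)" by simp
    also have "\<dots> = \<phi> (x - y) + \<phi> y" using ring_hom_add[OF phi_hom, of "x - y" y] xmy xy by simp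
    finally have "\<phi> (x - y) = 0" using xy by simp
    then show "x = y" using inj0[OF xmy] by simp
  qed
  then show ?thesis unfolding bij_betw_def using surj pc by blast
qed

section \<open>The ring generated by the roots of p\<close>

definition exps :: "rat set" where "exps = {q. \<exists>k m. q = of_nat k / of_nat (p ^ m)}"

text \<open>The power of p with exponent q, formed from the fixed roots. The choice is harmless:
  \<open>root_power\<close> makes \<open>\<pi> m ^ k\<close> depend only on the fraction
  \<open>k / p ^ m\<close>, as \<open>rpow_eq\<close> confirms.\<close>

definition rpow :: "rat \<Rightarrow> 'k" where
  "rpow q = (SOME x. \<exists>k m. q = of_nat k / of_nat (p ^ m) \<and> x = \<pi> m ^ k)"

lemma root_power: "\<pi> (m + d) ^ (p ^ d) = \<pi> m"
proof (induction d)
  case (Suc d)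
  have "\<pi> (m + Suc d) ^ (p ^ Suc d) = (\<pi> (Suc (m + d)) ^ p) ^ (p ^ d)"
    by (simp add: power_mult mult.commute flip: power_mult)
  then show ?case using Suc roots by simp
qed simp

lemma rpow_eq: "rpow (of_nat k / of_nat (p ^ m)) = \<pi> m ^ k"
proof -
  have eq: "\<pi> m ^ k = \<pi> m' ^ k'" if "m \<le> m'" "(of_nat k / of_nat (p ^ m) :: rat) = of_nat k' / of_nat (p ^ m')" for m m' k k'
  proof -
    from le_Suc_ex[OF that(1)] obtain d where d: "m' = m + d" by blast
    have "p > 0" using p_gt by simp
    then have "(of_nat k' :: rat) = of_nat (k * p ^ d)" using that d by (simp add: field_simps power_add)
    then have "k' = k * p ^ d" using of_nat_eq_iff by blast
    then show ?thesis using root_power[of m d] d by (simp add: power_mult mult.commute[of k])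
  qed
  have "\<exists>k' m'. (of_nat k / of_nat (p ^ m) :: rat) = of_nat k' / of_nat (p ^ m') \<and> rpow (of_nat k / of_nat (p ^ m)) = \<pi> m' ^ k'"
    unfolding rpow_def by (rule someI[of _ "\<pi> m ^ k"]) blast
  then show ?thesis using eq by (metis nat_le_linear)
qed

lemma exps_I: "of_nat k / of_nat (p ^ m) \<in> exps" unfolding exps_def by blast

lemma exps_common:
  assumes "finite A" "A \<subseteq> exps"
  shows "\<exists>m. \<forall>q\<in>A. \<exists>k. q = of_nat k / of_nat (p ^ m)"
  using assms
proof (induction A)
  case (insert q A)
  then obtain m where m: "\<And>q. q \<in> A \<Longrightarrow> \<exists>k. q = of_nat k / of_nat (p ^ m)" by auto
  obtain k m' where q: "q = of_nat k / of_nat (p ^ m')" using insert.prems unfolding exps_def by auto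
  have up: "\<exists>k'. (of_nat k / of_nat (p ^ a) :: rat) = of_nat k' / of_nat (p ^ (a + b))" for k a b
    using p_gt by (intro exI[of _ "k * p ^ b"]) (simp add: power_add)
  have "\<forall>x\<in>insert q A. \<exists>k. x = of_nat k / of_nat (p ^ (m + m'))"
    using m q up[of _ m m'] up[of k m' m] by (auto simp: add.commute)
  then show ?case by blast
qed simp

lemma exps_two: "a \<in> exps \<Longrightarrow> b \<in> exps \<Longrightarrow> \<exists>m k l. a = of_nat k / of_nat (p ^ m) \<and> b = of_nat l / of_nat (p ^ m)"
  using exps_common[of "{a, b}"] by auto

lemma exps_add: "a \<in> exps \<Longrightarrow> b \<in> exps \<Longrightarrow> a + b \<in> exps"
  using exps_two[of a b] exps_I by (metis add_divide_distrib of_nat_add)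

lemma rpow_add: "a \<in> exps \<Longrightarrow> b \<in> exps \<Longrightarrow> rpow (a + b) = rpow a * rpow b"
  using exps_two[of a b] rpow_eq by (metis add_divide_distrib of_nat_add power_add)

abbreviation "\<F> \<equiv> sub_of_type (UNIV :: 'k set)"

lemma F_cring: "cring \<F>" by (rule sub_of_type_cring) auto

lemma F_finsum: "finite A \<Longrightarrow> (\<Oplus>\<^bsub>\<F>\<^esub>x\<in>A. f x) = (\<Sum>x\<in>A. f x)"
proof (induction A rule: finite_induct)
  interpret F: cring \<F> by (rule F_cring)
  { case empty show ?case by simp }
  case (insert x A) then show ?case by (subst F.finsum_insert) auto
qed

text \<open>Think of \<open>f\<close> as an element of \<open>R[T^(1/p^\<infinity>)]\<close>: \<psi>
  acts on the coefficients and T is sent to p. Comparing \<psi> = \<phi> with the identity shows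
  whether \<phi> descends to the ring generated by the roots.\<close>

definition root_eval :: "('k \<Rightarrow> 'k) \<Rightarrow> (rat \<Rightarrow>\<^sub>0 'k) \<Rightarrow> 'k" where
  "root_eval \<psi> = lin_ext \<F> (\<lambda>q c. \<psi> c * rpow q)"

lemma root_eval_eq: "root_eval \<psi> f = (\<Sum>q\<in>Poly_Mapping.keys f. \<psi> (poly_mapping.lookup f q) * rpow q)"
  unfolding root_eval_def lin_ext_def by (rule F_finsum) simp

lemma hom_O:
  assumes "\<psi> \<in> ring_hom \<O> \<O>"
  shows "x \<in> R \<Longrightarrow> \<psi> x \<in> R" "x \<in> R \<Longrightarrow> y \<in> R \<Longrightarrow> \<psi> (x + y) = \<psi> x + \<psi> y"
    "x \<in> R \<Longrightarrow> y \<in> R \<Longrightarrow> \<psi> (x * y) = \<psi> x * \<psi> y" "\<psi> 1 = 1" "\<psi> 0 = 0" "\<psi> (of_nat n) = of_nat n"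
proof -
  show *: "x \<in> R \<Longrightarrow> \<psi> x \<in> R" "x \<in> R \<Longrightarrow> y \<in> R \<Longrightarrow> \<psi> (x + y) = \<psi> x + \<psi> y"
    "x \<in> R \<Longrightarrow> y \<in> R \<Longrightarrow> \<psi> (x * y) = \<psi> x * \<psi> y" "\<psi> 1 = 1" "\<psi> 0 = 0" for x y
    using ring_hom_closed[OF assms] ring_hom_add[OF assms] ring_hom_mult[OF assms]
      ring_hom_one[OF assms] ring_hom_zero[OF assms O.ring_axioms O.ring_axioms] by auto
  show "\<psi> (of_nat n) = of_nat n"
    using ring_hom_nmult[OF cring_O cring_O assms, of 1 n] *(4) R_closed(2) by simp
qed

lemma root_eval_ext:
  assumes "\<psi> \<in> ring_hom \<O> \<O>"
  shows "multiplicative_extension \<F> R exps (\<lambda>q c. \<psi> c * rpow q)"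
proof -
  interpret F: cring \<F> by (rule F_cring)
  show ?thesis
    by unfold_locales
      (simp_all add: hom_O[OF assms] R_closed exps_add rpow_add algebra_simps)
qed

lemma root_eval_hom:
  assumes "\<psi> \<in> ring_hom \<O> \<O>" "f \<in> supported R exps"
  shows "g \<in> supported R exps \<Longrightarrow> root_eval \<psi> (f + g) = root_eval \<psi> f + root_eval \<psi> g"
    "g \<in> supported R exps \<Longrightarrow> root_eval \<psi> (f * g) = root_eval \<psi> f * root_eval \<psi> g"
    "g \<in> supported R exps \<Longrightarrow> f + g \<in> supported R exps"
    "g \<in> supported R exps \<Longrightarrow> f * g \<in> supported R exps"
    "c \<in> R \<Longrightarrow> q \<in> exps \<Longrightarrow> root_eval \<psi> (Poly_Mapping.single q c) = \<psi> c * rpow q"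
    "c \<in> R \<Longrightarrow> q \<in> exps \<Longrightarrow> Poly_Mapping.single q c \<in> supported R exps"
proof -
  interpret multiplicative_extension \<F> R exps "\<lambda>q c. \<psi> c * rpow q" by (rule root_eval_ext[OF assms(1)])
  show "g \<in> supported R exps \<Longrightarrow> root_eval \<psi> (f + g) = root_eval \<psi> f + root_eval \<psi> g"
    "g \<in> supported R exps \<Longrightarrow> root_eval \<psi> (f * g) = root_eval \<psi> f * root_eval \<psi> g"
    "g \<in> supported R exps \<Longrightarrow> f + g \<in> supported R exps"
    "g \<in> supported R exps \<Longrightarrow> f * g \<in> supported R exps"
    "c \<in> R \<Longrightarrow> q \<in> exps \<Longrightarrow> root_eval \<psi> (Poly_Mapping.single q c) = \<psi> c * rpow q"
    "c \<in> R \<Longrightarrow> q \<in> exps \<Longrightarrow> Poly_Mapping.single q c \<in> supported R exps"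
    unfolding root_eval_def using lin_ext_add[OF assms(2)] lin_ext_mult[OF assms(2)] lin_ext_single supported_single
      supported_add[OF assms(2)] supported_mult[OF assms(2)] by auto
qed

lemma sub_id_hom: "(\<lambda>x. x) \<in> ring_hom \<O> \<O>" by (auto simp: ring_hom_def)

text \<open>Exponents are brought below \<open>p ^ m\<close> by
  \<open>\<pi> m ^ (p ^ m) = p\<close>. As every \<psi> fixes p, the same coefficients
  \<open>d\<close> serve all \<psi> at once, which is the point of the quantifier order.\<close>

lemma root_eval_reduce:
  assumes f: "f \<in> supported R exps" and m: "\<forall>q\<in>Poly_Mapping.keys f. \<exists>k. q = of_nat k / of_nat (p ^ m)"
  shows "\<exists>d. (\<forall>i. d i \<in> R) \<and> (\<forall>\<psi>\<in>ring_hom \<O> \<O>. root_eval \<psi> f = (\<Sum>i<p ^ m. \<psi> (d i) * \<pi> m ^ i))"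
proof -
  let ?N = "p ^ m" and ?q = "\<lambda>k. of_nat k / of_nat (p ^ m) :: rat"
  have N: "?N > 0" using p_gt by simp
  have inj: "inj ?q" using N by (auto simp: inj_on_def)
  have "finite (?q -` Poly_Mapping.keys f)" by (rule finite_vimageI[OF _ inj]) simp
  then obtain M where M: "\<And>k. ?q k \<in> Poly_Mapping.keys f \<Longrightarrow> k < M"
    by (metis finite_nat_set_iff_bounded vimageI)
  define c where "c k = poly_mapping.lookup f (?q k)" for k
  have c: "c k \<in> R" for k using f by (auto simp: c_def supported_def)
  \<comment> \<open>The monomial of degree \<open>j * p ^ m + i\<close> in \<open>\<pi> m\<close>
    contributes \<open>p ^ j\<close> times its coefficient to degree i; \<open>M\<close> bounds the
    numerators that occur.\<close>
  define d where "d i = (\<Sum>j<M. c (j * ?N + i) * of_nat p ^ j)" for i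
  have sumR: "(\<Sum>j<n. g j) \<in> R" if "\<And>j. g j \<in> R" for g and n :: nat
    using that by (induction n) (auto intro: R_closed)
  have d: "d i \<in> R" for i unfolding d_def by (rule sumR, rule R_closed(4), rule c, rule R_pow, rule R_of_nat)
  have piN: "\<pi> m ^ ?N = of_nat p" using root_power[of 0 m] roots by simp
  have "root_eval \<psi> f = (\<Sum>i<?N. \<psi> (d i) * \<pi> m ^ i)" if psi: "\<psi> \<in> ring_hom \<O> \<O>" for \<psi>
  proof -
    have psum: "\<psi> (\<Sum>j<n. g j) = (\<Sum>j<n. \<psi> (g j))" if "\<And>j. g j \<in> R" for g and n :: nat
      using that by (induction n) (auto simp: hom_O[OF psi] sumR)
    have ppow: "\<psi> (of_nat p ^ j) = of_nat p ^ j" for j using hom_O(6)[OF psi, of "p ^ j"] by simp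
    have "root_eval \<psi> f = (\<Sum>q\<in>?q ` {..<M * ?N}. \<psi> (poly_mapping.lookup f q) * rpow q)"
      unfolding root_eval_eq
    proof (rule sum.mono_neutral_left)
      show "Poly_Mapping.keys f \<subseteq> ?q ` {..<M * ?N}"
      proof
        fix q assume q: "q \<in> Poly_Mapping.keys f"
        then obtain k where k: "q = ?q k" using m by blast
        then have "k < M" using M q by blast
        also have "M \<le> M * ?N" by (rule order_trans[OF _ mult_le_mono2[OF Suc_leI[OF N], of M]]) simp
        finally show "q \<in> ?q ` {..<M * ?N}" using k by blast
      qed
    qed (auto simp: in_keys_iff hom_O[OF psi])
    also have "\<dots> = (\<Sum>k<M * ?N. \<psi> (c k) * \<pi> m ^ k)"
      unfolding c_def using rpow_eq[of _ m] inj by (subst sum.reindex) (auto simp: inj_on_def)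
    also have "\<dots> = (\<Sum>j<M. \<Sum>k\<in>{j * ?N..<j * ?N + ?N}. \<psi> (c k) * \<pi> m ^ k)"
      by (rule sum.nat_group[symmetric])
    also have "\<dots> = (\<Sum>j<M. \<Sum>i<?N. \<psi> (c (j * ?N + i)) * \<pi> m ^ (j * ?N + i))"
    proof (rule sum.cong[OF refl])
      fix j
      show "(\<Sum>k\<in>{j * ?N..<j * ?N + ?N}. \<psi> (c k) * \<pi> m ^ k) = (\<Sum>i<?N. \<psi> (c (j * ?N + i)) * \<pi> m ^ (j * ?N + i))"
        using sum.shift_bounds_nat_ivl[of "\<lambda>k. \<psi> (c k) * \<pi> m ^ k" 0 "j * ?N" ?N] by (simp add: atLeast0LessThan add.commute)
    qed
    also have "\<dots> = (\<Sum>j<M. \<Sum>i<?N. \<psi> (c (j * ?N + i)) * of_nat p ^ j * \<pi> m ^ i)"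
    proof -
      have "\<pi> m ^ (j * ?N + i) = of_nat p ^ j * \<pi> m ^ i" for i j
        by (simp only: power_add mult.commute[of j] power_mult piN)
      then show ?thesis by (simp only: mult.assoc)
    qed
    also have "\<dots> = (\<Sum>i<?N. \<Sum>j<M. \<psi> (c (j * ?N + i)) * of_nat p ^ j * \<pi> m ^ i)"
      by (rule sum.swap)
    also have "\<dots> = (\<Sum>i<?N. \<psi> (d i) * \<pi> m ^ i)"
    proof (rule sum.cong[OF refl])
      fix i
      have "\<psi> (d i) = (\<Sum>j<M. \<psi> (c (j * ?N + i)) * of_nat p ^ j)"
      proof -
        have "c (j * ?N + i) * of_nat p ^ j \<in> R" for j by (intro R_closed(4) c R_pow R_of_nat)
        then show ?thesis unfolding d_def using c R_pow[OF R_of_nat]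
          by (subst psum) (simp_all add: hom_O(3)[OF psi] ppow)
      qed
      then show "(\<Sum>j<M. \<psi> (c (j * ?N + i)) * of_nat p ^ j * \<pi> m ^ i) = \<psi> (d i) * \<pi> m ^ i"
        by (simp add: sum_distrib_right)
    qed
    finally show ?thesis .
  qed
  then show ?thesis using d by blast
qed

definition KK :: "'k set" where "KK = root_eval (\<lambda>x. x) ` supported R exps"

lemma KK_ring:
  "x \<in> KK \<Longrightarrow> y \<in> KK \<Longrightarrow> x + y \<in> KK" "x \<in> KK \<Longrightarrow> y \<in> KK \<Longrightarrow> x * y \<in> KK"
  using root_eval_hom[OF sub_id_hom] unfolding KK_def by (auto simp: image_iff) metis+

lemma KK_mono: "c \<in> R \<Longrightarrow> c * \<pi> m ^ k \<in> KK"
proof -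
  assume c: "c \<in> R"
  have z: "(0 :: rat \<Rightarrow>\<^sub>0 'k) \<in> supported R exps" by (auto simp: supported_def R_closed)
  have "root_eval (\<lambda>x. x) (Poly_Mapping.single (of_nat k / of_nat (p ^ m)) c) = c * \<pi> m ^ k"
    using root_eval_hom(5)[OF sub_id_hom z c exps_I] rpow_eq by simp
  then show ?thesis unfolding KK_def using root_eval_hom(6)[OF sub_id_hom z c exps_I] by (metis imageI)
qed

lemma KK_R: "c \<in> R \<Longrightarrow> c \<in> KK" using KK_mono[of c 0 0] by simp

text \<open>If p x = 1, multiplying by powers of \<open>\<pi> m\<close> shows that each of the
  powers below \<open>p ^ m\<close> is p times an \<open>R\<close>-combination of these powers. By
  \<open>nakayama_span\<close> they all vanish, including \<open>\<pi> m ^ 0 = 1\<close>.\<close>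

lemma one_notin_pKK:
  assumes "x \<in> KK" shows "of_nat p * x \<noteq> 1"
proof
  assume one: "of_nat p * x = 1"
  obtain f where f: "f \<in> supported R exps" "x = root_eval (\<lambda>x. x) f" using assms unfolding KK_def by auto
  obtain m where m: "\<forall>q\<in>Poly_Mapping.keys f. \<exists>k. q = of_nat k / of_nat (p ^ m)"
    using exps_common[of "Poly_Mapping.keys f"] f by (auto simp: supported_def)
  have N: "p ^ m > 0" using p_gt by simp
  have "\<forall>i<p ^ m. \<exists>a. (\<forall>j. a j \<in> R) \<and> \<pi> m ^ i = of_nat p * (\<Sum>j<p ^ m. a j * \<pi> m ^ j)"
  proof (intro allI impI)
    fix i
    let ?s = "Poly_Mapping.single (of_nat i / of_nat (p ^ m) :: rat) (1::'k)"
    have "\<forall>q\<in>Poly_Mapping.keys (?s * f). \<exists>k. q = of_nat k / of_nat (p ^ m)"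
    proof
      fix q assume "q \<in> Poly_Mapping.keys (?s * f)"
      then obtain q' where "q' \<in> Poly_Mapping.keys f" "q = of_nat i / of_nat (p ^ m) + q'"
        using keys_mult[of ?s f] by (auto split: if_splits)
      then show "\<exists>k. q = of_nat k / of_nat (p ^ m)" using m by (metis add_divide_distrib of_nat_add)
    qed
    moreover have s: "?s \<in> supported R exps" by (rule root_eval_hom(6)[OF sub_id_hom f(1) R_closed(2) exps_I])
    ultimately obtain d where d: "\<forall>i. d i \<in> R" "root_eval (\<lambda>x. x) (?s * f) = (\<Sum>i<p ^ m. d i * \<pi> m ^ i)"
      using root_eval_reduce[OF root_eval_hom(4)[OF sub_id_hom s f(1)], of m] sub_id_hom by blast
    have "root_eval (\<lambda>x. x) (?s * f) = \<pi> m ^ i * x"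
      using root_eval_hom(2)[OF sub_id_hom s f(1)] root_eval_hom(5)[OF sub_id_hom f(1) R_closed(2) exps_I] rpow_eq[of i m] f by simp
    then have "\<pi> m ^ i = of_nat p * (\<Sum>i<p ^ m. d i * \<pi> m ^ i)"
      using one d(2) by (metis mult.left_commute mult.right_neutral)
    then show "\<exists>a. (\<forall>j. a j \<in> R) \<and> \<pi> m ^ i = of_nat p * (\<Sum>j<p ^ m. a j * \<pi> m ^ j)" using d by blast
  qed
  from nakayama_span[OF R_closed(3) R_closed(4) R_of_nat one_minus_p_unit this]
  have "\<pi> m ^ 0 = 0" using N by blast
  then show False by simp
qed

text \<open>The Eisenstein argument without a polynomial: in any relation all coefficients are
  divisible by p, so the relation can be divided by p forever, and \<open>R\<close> is
  separated.\<close>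

lemma powers_independent:
  assumes d: "\<And>i. d i \<in> R" and z: "(\<Sum>i<p ^ m. d i * \<pi> m ^ i) = 0" and i: "i < p ^ m"
  shows "d i = 0"
proof -
  let ?N = "p ^ m"
  have piN: "\<pi> m ^ ?N = of_nat p" using root_power[of 0 m] roots by simp
  have N: "?N > 0" using p_gt by simp
  have KK_sum: "(\<Sum>i\<in>A. c i * \<pi> m ^ e i) \<in> KK" if "finite A" "\<And>i. i \<in> A \<Longrightarrow> c i \<in> R" for c and e :: "nat \<Rightarrow> nat" and A
    using that
  proof (induction A)
    case empty then show ?case using KK_R R_closed by simp
  next
    case (insert a A) then show ?case using KK_ring(1)[OF KK_mono] by simp
  qed
  have div_p: "\<forall>i<?N. \<exists>c\<in>R. d i = of_nat p * c" if d: "\<And>i. d i \<in> R" and z: "(\<Sum>i<?N. d i * \<pi> m ^ i) = 0" for d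
  proof (rule ccontr)
    assume "\<not> ?thesis"
    then have ex: "\<exists>i. i < ?N \<and> \<not> (\<exists>c\<in>R. d i = of_nat p * c)" by blast
    define i0 where "i0 = (LEAST i. i < ?N \<and> \<not> (\<exists>c\<in>R. d i = of_nat p * c))"
    have i0: "i0 < ?N" "\<not> (\<exists>c\<in>R. d i0 = of_nat p * c)" using LeastI_ex[OF ex] by (auto simp: i0_def)
    have "\<forall>i. \<exists>c\<in>R. i < i0 \<longrightarrow> d i = of_nat p * c"
      using not_less_Least[of _ "\<lambda>i. i < ?N \<and> \<not> (\<exists>c\<in>R. d i = of_nat p * c)"] i0(1) R_closed(1)
      unfolding i0_def[symmetric] by (meson less_trans)
    then obtain c where c: "\<And>i. c i \<in> R" "\<And>i. i < i0 \<Longrightarrow> d i = of_nat p * c i" by metis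
    obtain s r where s: "s \<in> R" "r \<in> R" "s * d i0 = 1 + of_nat p * r" using unit_mod_p[OF d i0(2)] by blast
    \<comment> \<open>With this shift the term i0 lands in degree \<open>p ^ m - 1\<close>. Later
      terms reach degree at least \<open>p ^ m\<close> and gain a factor p; earlier ones have one in
      their coefficients.\<close>
    let ?k = "?N - 1 - i0"
    let ?A = "(\<Sum>i<i0. c i * \<pi> m ^ i) * \<pi> m ^ ?k"
    let ?B = "(\<Sum>i\<in>{i0<..<?N}. d i * \<pi> m ^ (i - i0 - 1))"
    have sh: "d i * \<pi> m ^ i * \<pi> m ^ ?k = of_nat p * (d i * \<pi> m ^ (i - i0 - 1))" if "i0 < i" for i
    proof -
      have "i + ?k = ?N + (i - i0 - 1)" using that i0 N by simp
      then have "\<pi> m ^ i * \<pi> m ^ ?k = of_nat p * \<pi> m ^ (i - i0 - 1)"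
        using piN by (metis power_add)
      then show ?thesis by (simp add: mult_ac)
    qed
    have top: "\<pi> m ^ i0 * \<pi> m ^ ?k = \<pi> m ^ (?N - 1)" using i0 by (simp flip: power_add)
    have "(\<Sum>i<?N. d i * \<pi> m ^ i) = (\<Sum>i<i0. d i * \<pi> m ^ i) + (d i0 * \<pi> m ^ i0 + (\<Sum>i\<in>{i0<..<?N}. d i * \<pi> m ^ i))"
    proof -
      have "{..<?N} = {..<i0} \<union> ({i0} \<union> {i0<..<?N})" using i0 by auto
      moreover have "(\<Sum>i\<in>{..<i0} \<union> ({i0} \<union> {i0<..<?N}). d i * \<pi> m ^ i) =
          (\<Sum>i<i0. d i * \<pi> m ^ i) + (\<Sum>i\<in>{i0} \<union> {i0<..<?N}. d i * \<pi> m ^ i)"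
        by (rule sum.union_disjoint) auto
      ultimately show ?thesis by simp
    qed
    then have "0 = ((\<Sum>i<i0. d i * \<pi> m ^ i) + (d i0 * \<pi> m ^ i0 + (\<Sum>i\<in>{i0<..<?N}. d i * \<pi> m ^ i))) * \<pi> m ^ ?k"
      using z by simp
    also have "\<dots> = (\<Sum>i<i0. d i * \<pi> m ^ i) * \<pi> m ^ ?k + (d i0 * \<pi> m ^ (?N - 1) + (\<Sum>i\<in>{i0<..<?N}. d i * \<pi> m ^ i * \<pi> m ^ ?k))"
      using top by (simp add: algebra_simps sum_distrib_left sum_distrib_right)
    also have "(\<Sum>i<i0. d i * \<pi> m ^ i) * \<pi> m ^ ?k = of_nat p * ((\<Sum>i<i0. c i * \<pi> m ^ i) * \<pi> m ^ ?k)"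
      using c(2) by (simp add: sum_distrib_left mult_ac)
    also have "(\<Sum>i\<in>{i0<..<?N}. d i * \<pi> m ^ i * \<pi> m ^ ?k) = of_nat p * (\<Sum>i\<in>{i0<..<?N}. d i * \<pi> m ^ (i - i0 - 1))"
      unfolding sum_distrib_left by (rule sum.cong[OF refl], rule sh) simp
    finally have "0 = of_nat p * ?A + (d i0 * \<pi> m ^ (?N - 1) + of_nat p * ?B)" .
    note z0 = this
    have "0 = x + (y + z) \<Longrightarrow> y = - (x + z)" for x y z :: 'k
      by (subst eq_neg_iff_add_eq_0) (simp add: ac_simps)
    from this[OF z0] have "d i0 * \<pi> m ^ (?N - 1) = - (of_nat p * ?A + of_nat p * ?B)" .
    then have e0: "d i0 * \<pi> m ^ (?N - 1) = of_nat p * (- (?A + ?B))" by (simp only: distrib_left mult_minus_right)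
    \<comment> \<open>This is \<open>\<pi> m ^ (p ^ m - 1)\<close> divided by p, found by solving
      the relation for that power with \<open>d i0\<close> invertible modulo p. What matters is that
      it lies in \<open>KK\<close>: it inverts \<open>\<pi> m\<close>, so its
      \<open>p ^ m\<close>-th power would invert p in \<open>KK\<close>.\<close>
    define w where "w = s * (- 1) * (?A + ?B) + - r * \<pi> m ^ (?N - 1)"
    have w: "w \<in> KK"
    proof -
      have k0: "s * (- 1) \<in> KK" using KK_mono[of "s * (- 1)" m 0] s R_closed by simp
      have k1: "\<pi> m ^ ?k \<in> KK" using KK_mono[of 1 m ?k] R_closed by simp
      have "?A \<in> KK" by (rule KK_ring(2)[OF KK_sum k1]) (use c in auto)
      moreover have "?B \<in> KK" by (rule KK_sum) (use d in auto)
      ultimately have "?A + ?B \<in> KK" by (rule KK_ring(1))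
      then show ?thesis unfolding w_def
        by (rule KK_ring(1)[OF KK_ring(2)[OF k0] KK_mono]) (use s R_closed in auto)
    qed
    have "(1 + of_nat p * r) * \<pi> m ^ (?N - 1) = s * (d i0 * \<pi> m ^ (?N - 1))" using s(3) by (simp add: mult.assoc[symmetric])
    then have h: "(1 + of_nat p * r) * \<pi> m ^ (?N - 1) = s * (of_nat p * (- (?A + ?B)))" by (simp only: e0)
    have gen: "q = P * (s * (- 1) * x + - r * q)" if h: "(1 + P * r) * q = s * (P * (- x))" for P q x :: 'k
    proof -
      have "q = (1 + P * r) * q - P * r * q" by (simp add: algebra_simps)
      also have "\<dots> = P * (s * (- 1) * x + - r * q)" unfolding h by (simp add: algebra_simps)
      finally show ?thesis .
    qed
    from gen[OF h] have "\<pi> m ^ (?N - 1) = of_nat p * w" unfolding w_def .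
    moreover have "\<pi> m * \<pi> m ^ (?N - 1) = of_nat p" using piN N by (simp flip: power_Suc)
    ultimately have "of_nat p * (\<pi> m * w) = of_nat p * 1" by (simp add: mult_ac)
    then have "\<pi> m * w = 1" using p_nonzero mult_left_cancel by blast
    then have "(\<pi> m * w) ^ ?N = 1" by simp
    then have "of_nat p * w ^ ?N = 1" using piN by (simp add: power_mult_distrib)
    moreover have "w ^ n \<in> KK" for n
      by (induction n) (use w KK_ring KK_mono[of 1 m 0] R_closed in auto)
    ultimately show False using one_notin_pKK by blast
  qed
  \<comment> \<open>The quotients satisfy the same relation because p cancels in the field, so
    \<open>div_p\<close> applies to them again.\<close>
  have "\<exists>c. (\<forall>i. c i \<in> R) \<and> (\<forall>i<?N. d i = of_nat p ^ n * c i) \<and> (\<Sum>i<?N. c i * \<pi> m ^ i) = 0" for n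
  proof (induction n)
    case 0 then show ?case using d z by (intro exI[of _ d]) auto
  next
    case (Suc n)
    then obtain c where c: "\<And>i. c i \<in> R" "\<And>i. i < ?N \<Longrightarrow> d i = of_nat p ^ n * c i" "(\<Sum>i<?N. c i * \<pi> m ^ i) = 0" by blast
    have "\<forall>i. \<exists>b\<in>R. i < ?N \<longrightarrow> c i = of_nat p * b" using div_p[OF c(1) c(3)] R_closed(1) by blast
    then obtain b where b: "\<And>i. b i \<in> R" "\<And>i. i < ?N \<Longrightarrow> c i = of_nat p * b i" by metis
    have "of_nat p * (\<Sum>i<?N. b i * \<pi> m ^ i) = 0" using c(3) b by (simp add: sum_distrib_left mult_ac)
    then have "(\<Sum>i<?N. b i * \<pi> m ^ i) = 0" using p_nonzero by simp
    then show ?case using b c by (intro exI[of _ b]) (auto simp: mult_ac)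
  qed
  then have "\<exists>c\<in>R. d i = of_nat p ^ n * c" for n using i by blast
  then show ?thesis using R_separated d by blast
qed

text \<open>Both sides say that all reduced coefficients vanish, since an injective \<psi> creates
  no new zeros. For \<psi> = \<phi> this makes the coefficientwise extension well defined and
  injective.\<close>

lemma root_eval_zero_iff:
  assumes "f \<in> supported R exps" "\<psi> \<in> ring_hom \<O> \<O>" "inj_on \<psi> R"
  shows "root_eval \<psi> f = 0 \<longleftrightarrow> root_eval (\<lambda>x. x) f = 0"
proof -
  obtain m where m: "\<forall>q\<in>Poly_Mapping.keys f. \<exists>k. q = of_nat k / of_nat (p ^ m)"
    using exps_common[of "Poly_Mapping.keys f"] assms by (auto simp: supported_def)
  obtain d where d: "\<And>i. d i \<in> R" "\<And>\<psi>. \<psi> \<in> ring_hom \<O> \<O> \<Longrightarrow> root_eval \<psi> f = (\<Sum>i<p ^ m. \<psi> (d i) * \<pi> m ^ i)"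
    using root_eval_reduce[OF assms(1) m] by blast
  have "root_eval \<psi> f = 0 \<longleftrightarrow> (\<forall>i<p ^ m. \<psi> (d i) = 0)" if "\<psi> \<in> ring_hom \<O> \<O>" for \<psi>
    using d powers_independent[of "\<lambda>i. \<psi> (d i)" m] hom_O[OF that] that by auto
  moreover have "\<psi> (d i) = 0 \<longleftrightarrow> d i = 0" for i
    using assms(3) hom_O(5)[OF assms(2)] d(1)[of i] R_closed(1) unfolding inj_on_def by metis
  ultimately show ?thesis using assms sub_id_hom by auto
qed

end

section \<open>Isomorphisms and units of completions\<close>

lemma completion_map_iso:
  fixes p :: nat
  assumes A: "cring A" and C: "cring C" and g: "g \<in> ring_iso A C"
  shows "completion_map p C g \<in> ring_iso (p_completion p A) (p_completion p C)"
proof -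
  interpret A: cring A by (rule A)
  interpret C: cring C by (rule C)
  define g' where "g' = inv_into (carrier A) g"
  have gh: "g \<in> ring_hom A C" and gb: "bij_betw g (carrier A) (carrier C)" using g by (auto simp: ring_iso_def)
  have "g' \<in> ring_iso C A" unfolding g'_def by (rule ring_iso_set_sym[OF A.ring_axioms g])
  then have gh': "g' \<in> ring_hom C A" by (auto simp: ring_iso_def)
  note h = completion_map_hom[OF A C gh, where p = p] and h' = completion_map_hom[OF C A gh', where p = p]
  have 1: "completion_map p A g' (completion_map p C g s) = s" if "s \<in> carrier (p_completion p A)" for s
    using completion_hom_unique[OF A A ring_hom_trans[OF h(1) h'(1)] id_ring_hom _ that] h(2) h'(2)
      ring_hom_closed[OF gh] bij_betw_inv_into_left[OF gb] by (simp add: g'_def)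
  have 2: "completion_map p C g (completion_map p A g' s) = s" if "s \<in> carrier (p_completion p C)" for s
    using completion_hom_unique[OF C C ring_hom_trans[OF h'(1) h(1)] id_ring_hom _ that] h(2) h'(2)
      ring_hom_closed[OF gh'] bij_betw_inv_into_right[OF gb] by (simp add: g'_def)
  have "bij_betw (completion_map p C g) (carrier (p_completion p A)) (carrier (p_completion p C))"
    by (rule bij_betwI[where g = "completion_map p A g'"])
      (use 1 2 ring_hom_closed[OF h(1)] ring_hom_closed[OF h'(1)] in auto)
  then show ?thesis using h(1) by (simp add: ring_iso_def)
qed

lemma (in cring) completion_unit:
  assumes t: "t \<in> carrier (p_completion p R)"
  shows "\<exists>w\<in>carrier (p_completion p R).
    (\<one>\<^bsub>p_completion p R\<^esub> \<oplus>\<^bsub>p_completion p R\<^esub> [p] \<cdot>\<^bsub>p_completion p R\<^esub> t) \<otimes>\<^bsub>p_completion p R\<^esub> w = \<one>\<^bsub>p_completion p R\<^esub>"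
proof -
  define C where "C = p_completion p R"
  interpret C: cring C unfolding C_def by (rule completion_cring)
  have t: "t \<in> carrier C" using t by (simp add: C_def)
  \<comment> \<open>The inverse of 1 + p t is the fixed point of this map, which is a contraction in
    the p-adic sense: each application improves a congruence by one power.\<close>
  define f where "f = (\<lambda>w. \<one>\<^bsub>C\<^esub> \<ominus>\<^bsub>C\<^esub> [p] \<cdot>\<^bsub>C\<^esub> (t \<otimes>\<^bsub>C\<^esub> w))"
  define w where "w n = (f ^^ n) \<zero>\<^bsub>C\<^esub>" for n
  have wS: "w (Suc n) = f (w n)" for n by (simp add: w_def)
  have w: "w n \<in> carrier C" for n by (induction n) (use t in \<open>auto simp: wS f_def\<close>, simp add: w_def)
  have pt: "pcong p C (Suc n) ([p] \<cdot>\<^bsub>C\<^esub> (t \<otimes>\<^bsub>C\<^esub> a)) ([p] \<cdot>\<^bsub>C\<^esub> (t \<otimes>\<^bsub>C\<^esub> b))" if "pcong p C n a b" for a b n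
    using C.pcong_nmult[OF C.pcong_mult[OF C.pcong_refl[OF t] that], of 1] by simp
  have "pcong p C n (w (Suc n)) (w n)" for n
  proof (induction n)
    case 0 show ?case using w by simp
  next
    case (Suc n)
    show ?case unfolding wS[of "Suc n"] wS[of n] f_def using pt[OF Suc] by (intro C.pcong_minus) (auto simp: wS f_def)
  qed
  then have co: "coherent p C w" unfolding coherent_def by blast
  then obtain v where v: "v \<in> carrier C" "\<And>n. pcong p C n v (w n)"
    using completion_limit unfolding C_def by blast
  have "(\<one>\<^bsub>C\<^esub> \<oplus>\<^bsub>C\<^esub> [p] \<cdot>\<^bsub>C\<^esub> t) \<otimes>\<^bsub>C\<^esub> v = \<one>\<^bsub>C\<^esub>"
    unfolding C_def
  proof (rule completion_eqI[of _ p], unfold C_def[symmetric])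
    fix n
    have e: "(\<one>\<^bsub>C\<^esub> \<oplus>\<^bsub>C\<^esub> [p] \<cdot>\<^bsub>C\<^esub> t) \<otimes>\<^bsub>C\<^esub> v = v \<oplus>\<^bsub>C\<^esub> [p] \<cdot>\<^bsub>C\<^esub> (t \<otimes>\<^bsub>C\<^esub> v)"
      using v t by (simp add: C.l_distr C.nmult_l)
    have a: "pcong p C n v (w (Suc n))" using C.pcong_mono[OF v(2)[of "Suc n"], of n] by simp
    have b: "pcong p C n ([p] \<cdot>\<^bsub>C\<^esub> (t \<otimes>\<^bsub>C\<^esub> v)) ([p] \<cdot>\<^bsub>C\<^esub> (t \<otimes>\<^bsub>C\<^esub> w n))"
      using C.pcong_mono[OF pt[OF v(2)[of n]], of n] by simp
    have "w (Suc n) \<oplus>\<^bsub>C\<^esub> [p] \<cdot>\<^bsub>C\<^esub> (t \<otimes>\<^bsub>C\<^esub> w n) = \<one>\<^bsub>C\<^esub>"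
      using w t by (simp add: wS f_def a_minus_def C.a_assoc C.l_neg)
    then show "pcong p C n ((\<one>\<^bsub>C\<^esub> \<oplus>\<^bsub>C\<^esub> [p] \<cdot>\<^bsub>C\<^esub> t) \<otimes>\<^bsub>C\<^esub> v) \<one>\<^bsub>C\<^esub>"
      unfolding e using C.pcong_add[OF a b] by simp
  qed (use v t in auto)
  then show ?thesis using v(1) unfolding C_def by blast
qed

lemma ring_hom_inverse:
  assumes "cring A" "cring C" "h \<in> ring_hom A C" "a \<in> carrier A" "b \<in> carrier A" "a \<otimes>\<^bsub>A\<^esub> b = \<one>\<^bsub>A\<^esub>"
    "c \<in> carrier C" "h a \<otimes>\<^bsub>C\<^esub> c = \<one>\<^bsub>C\<^esub>"
  shows "h b = c"
proof -
  interpret C: cring C by fact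
  have c: "h a \<in> carrier C" "h b \<in> carrier C" using ring_hom_closed[OF assms(3)] assms by auto
  have "h a \<otimes>\<^bsub>C\<^esub> h b = \<one>\<^bsub>C\<^esub>" using ring_hom_mult[OF assms(3-5)] ring_hom_one[OF assms(3)] assms(6) by simp
  then have "h b = h b \<otimes>\<^bsub>C\<^esub> (h a \<otimes>\<^bsub>C\<^esub> c)" using assms c by simp
  also have "\<dots> = (h a \<otimes>\<^bsub>C\<^esub> h b) \<otimes>\<^bsub>C\<^esub> c" using c assms(7) by (simp add: C.m_ac)
  also have "\<dots> = c" using \<open>h a \<otimes>\<^bsub>C\<^esub> h b = \<one>\<^bsub>C\<^esub>\<close> assms(7) by simp
  finally show ?thesis .
qed

text \<open>The definite descriptions ask for extensional maps; restriction turns a constructed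
  homomorphism into the described one.\<close>

lemma ring_hom_restrict':
  assumes "cring A" "h \<in> ring_hom A C" shows "restrict h (carrier A) \<in> ring_hom A C"
proof -
  interpret cring A by fact
  show ?thesis using assms(2) by (auto simp: ring_hom_def)
qed

section \<open>The ring generated by the roots, its completion, and the automorphism\<close>

context base
begin

abbreviation "KU \<equiv> K_uncompleted R \<pi>"
abbreviation "K0 \<equiv> K_int p R \<pi>"
abbreviation "toK \<equiv> to_K_int p R \<pi>"

lemma KK_pi: "\<pi> m \<in> KK" using KK_mono[of 1 m 1] R_closed by simp

lemma KK_induct [consumes 1, case_names zero add]:
  assumes "x \<in> KK" "Q 0" "\<And>c m k y. c \<in> R \<Longrightarrow> y \<in> KK \<Longrightarrow> Q y \<Longrightarrow> Q (c * \<pi> m ^ k + y)"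
  shows "Q x"
proof -
  obtain f where f: "f \<in> supported R exps" "x = root_eval (\<lambda>x. x) f" using assms unfolding KK_def by auto
  have "f \<in> supported R exps \<and> Q (root_eval (\<lambda>x. x) f)" using f(1)
  proof (induction f rule: supported_induct)
    case zero
    then show ?case using assms(2) by (auto simp: root_eval_eq supported_def R_closed)
  next
    case (add e c g)
    then have g: "g \<in> supported R exps" "root_eval (\<lambda>x. x) g \<in> KK" unfolding KK_def by auto
    obtain k m where e: "e = of_nat k / of_nat (p ^ m)" using add(1) unfolding exps_def by blast
    note s = root_eval_hom(6)[OF sub_id_hom g(1) add(2,1)]
    have "root_eval (\<lambda>x. x) (Poly_Mapping.single e c + g) = c * \<pi> m ^ k + root_eval (\<lambda>x. x) g"
      using root_eval_hom(1)[OF sub_id_hom s g(1)] root_eval_hom(5)[OF sub_id_hom g(1) add(2,1)] rpow_eq e by simp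
    then show ?case using assms(3)[OF add(2) g(2)] add(3) root_eval_hom(3)[OF sub_id_hom s g(1)] by simp
  qed
  then show ?thesis using f by blast
qed

lemma KU_eq: "KU = sub_of_type KK"
proof -
  let ?T = "ring_of_type_algebra :: 'k ring"
  interpret T: ring ?T by (rule ring_from_type_algebra)
  have T: "carrier ?T = UNIV" "x \<otimes>\<^bsub>?T\<^esub> y = x * y" "x \<oplus>\<^bsub>?T\<^esub> y = x + y" "\<one>\<^bsub>?T\<^esub> = 1" "\<zero>\<^bsub>?T\<^esub> = 0" for x y
    by (auto simp: ring_of_type_algebra_def)
  have Tinv: "\<ominus>\<^bsub>?T\<^esub> x = - x" for x :: 'k
    by (rule T.minus_equality) (auto simp: ring_of_type_algebra_def)
  let ?G = "\<lambda>m. generate_ring ?T (insert (\<pi> m) R)"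
  have sub: "?G m \<subseteq> KK" for m
  proof
    fix x assume "x \<in> ?G m"
    then show "x \<in> KK"
    proof (induction x rule: generate_ring.induct)
      case one then show ?case using KK_R R_closed by (simp add: T)
    next
      case (incl h) then show ?case using KK_R KK_pi by auto
    next
      case (a_inv h)
      then have "(- 1) * h \<in> KK" using KK_R R_closed by (intro KK_ring) auto
      then show ?case by (simp add: Tinv)
    qed (simp_all add: T KK_ring)
  qed
  have pow: "x ^ n \<in> ?G m" if "x \<in> ?G m" for x n m
  proof (induction n)
    case 0 show ?case using generate_ring.one[of ?T "insert (\<pi> m) R"] by (simp add: T)
  next
    case (Suc n) show ?case using generate_ring.eng_mult[OF that Suc] by (simp add: T)
  qed
  \<comment> \<open>The generated rings are nested because \<open>\<pi> m\<close> is a power of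
    \<open>\<pi> (m + d)\<close>, so sums of elements from different members stay in the
    union.\<close>
  have up: "?G m \<subseteq> ?G (m + d)" for m d
  proof -
    have "\<pi> m \<in> ?G (m + d)"
      using pow[OF generate_ring.incl[of "\<pi> (m + d)"], of "m + d" "p ^ d"] root_power[of m d] by simp
    moreover have "R \<subseteq> ?G (m + d)" by (auto intro: generate_ring.incl)
    moreover have "subring (?G (m + d)) ?T" by (rule T.generate_ring_is_subring) (simp add: T)
    ultimately show ?thesis by (intro T.generate_ring_min_subring1) (auto simp: T)
  qed
  have "x \<in> (\<Union>m. ?G m)" if "x \<in> KK" for x using that
  proof (induction x rule: KK_induct)
    case zero
    then show ?case using T.zero_in_generate[of "insert (\<pi> 0) R"] by (auto simp: T)
  next
    case (add c m k y)
    then obtain l where y: "y \<in> ?G l" by blast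
    have "c * \<pi> m ^ k \<in> ?G m"
    proof -
      have c: "c \<in> ?G m" using add(1) by (intro generate_ring.incl) simp
      have "\<pi> m ^ k \<in> ?G m" by (rule pow) (intro generate_ring.incl, simp)
      from generate_ring.eng_mult[OF c this] show ?thesis by (simp add: T)
    qed
    then have "c * \<pi> m ^ k \<in> ?G (m + l)" "y \<in> ?G (m + l)" using up[of m l] up[of l m] y by (auto simp: add.commute)
    then have "c * \<pi> m ^ k + y \<in> ?G (m + l)" using generate_ring.eng_add[of _ ?T] by (auto simp: T)
    then show ?case by blast
  qed
  then have "(\<Union>m. ?G m) = KK" using sub by blast
  then show ?thesis unfolding K_uncompleted_def by simp
qed

lemma KU_cring: "cring KU"
  unfolding KU_eq
proof (rule sub_of_type_cring)
  show "1 \<in> KK" using KK_R R_closed by simp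
  fix x assume "x \<in> KK"
  then have "(- 1) * x \<in> KK" using KK_R R_closed by (intro KK_ring) auto
  then show "- x \<in> KK" by simp
qed (auto intro: KK_ring)

sublocale KU: cring KU by (rule KU_cring)

lemma K0_cring: "cring K0" unfolding K_int_def by (rule KU.completion_cring)

sublocale K0: cring K0 by (rule K0_cring)

lemma toK_hom: "toK \<in> ring_hom KU K0"
  unfolding to_K_int_def K_int_def by (rule KU.to_completion_ring_hom)

lemma toK_closed: "c \<in> R \<Longrightarrow> toK c \<in> carrier K0"
  using ring_hom_closed[OF toK_hom] KK_R by (simp add: KU_eq)

lemma K0_torsion_free:
  assumes "s \<in> carrier K0" "[p] \<cdot>\<^bsub>K0\<^esub> s = \<zero>\<^bsub>K0\<^esub>" shows "s = \<zero>\<^bsub>K0\<^esub>"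
proof -
  have "a = \<zero>\<^bsub>KU\<^esub>" if "a \<in> carrier KU" "[p] \<cdot>\<^bsub>KU\<^esub> a = \<zero>\<^bsub>KU\<^esub>" for a
    using that p_nonzero by (simp add: KU_eq)
  from KU.completion_torsion_free[OF this] assms show ?thesis unfolding K_int_def by simp
qed

text \<open>A congruence modulo p in the completion is read off from component 1, which leads back
  to \<open>one_notin_pKK\<close>.\<close>

lemma K0_one: "\<not> pcong p K0 1 \<one>\<^bsub>K0\<^esub> \<zero>\<^bsub>K0\<^esub>"
proof
  assume "pcong p K0 1 \<one>\<^bsub>K0\<^esub> \<zero>\<^bsub>K0\<^esub>"
  then have "pcong p (p_completion p KU) 1 (lim_seq p KU (\<lambda>_. \<one>\<^bsub>KU\<^esub>)) (lim_seq p KU (\<lambda>_. \<zero>\<^bsub>KU\<^esub>))"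
    unfolding K_int_def KU.lim_seq_consts .
  from KU.completion_pcongD[OF this] have "pcong p KU 1 \<one>\<^bsub>KU\<^esub> \<zero>\<^bsub>KU\<^esub>"
    unfolding lim_seq_def using KU.to_completion_eq_iff by simp
  then show False using one_notin_pKK by (auto simp: pcong_def KU_eq)
qed

text \<open>The extension of \<phi> before completion: choose a presentation of x by coefficients
  and apply \<phi> to them. Independence of the choice is \<open>phi0_rev\<close>.\<close>

definition phi0 :: "'k \<Rightarrow> 'k" where
  "phi0 x = root_eval \<phi> (SOME f. f \<in> supported R exps \<and> root_eval (\<lambda>x. x) f = x)"

text \<open>Subtraction appears as adding a multiple by the constant -1 because
  \<open>root_eval_hom\<close> offers only sums and products. Equality of two values thereby becomes
  vanishing of one.\<close>

lemma root_eval_diff: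
  assumes "\<psi> \<in> ring_hom \<O> \<O>" "f \<in> supported R exps" "g \<in> supported R exps"
  shows "f + Poly_Mapping.single 0 (- 1) * g \<in> supported R exps"
    "root_eval \<psi> (f + Poly_Mapping.single 0 (- 1) * g) = root_eval \<psi> f - root_eval \<psi> g"
proof -
  have z: "(0::rat) \<in> exps" using exps_I[of 0 0] by simp
  have m: "- 1 \<in> R" using R_closed by blast
  note s = root_eval_hom(6)[OF assms(1,2) m z]
  have "\<psi> (- 1) + 1 = \<psi> (- 1 + 1)" using hom_O(2)[OF assms(1) m R_closed(2)] hom_O(4)[OF assms(1)] by simp
  then have "\<psi> (- 1) = - 1" using hom_O(5)[OF assms(1)] by (simp add: eq_neg_iff_add_eq_0)
  moreover have "rpow 0 = 1" using rpow_eq[of 0 0] by simp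
  ultimately have "root_eval \<psi> (Poly_Mapping.single 0 (- 1)) = - 1" using root_eval_hom(5)[OF assms(1,2) m z] by simp
  then show "root_eval \<psi> (f + Poly_Mapping.single 0 (- 1) * g) = root_eval \<psi> f - root_eval \<psi> g"
    using root_eval_hom(1)[OF assms(1,2) root_eval_hom(4)[OF assms(1) s assms(3)]] root_eval_hom(2)[OF assms(1) s assms(3)] by simp
  show "f + Poly_Mapping.single 0 (- 1) * g \<in> supported R exps"
    using root_eval_hom(3)[OF assms(1,2) root_eval_hom(4)[OF assms(1) s assms(3)]] .
qed

lemma phi_inj: "inj_on \<phi> R" using phi_bij by (simp add: bij_betw_def)

lemma root_eval_eq_iff:
  assumes "f \<in> supported R exps" "g \<in> supported R exps"
  shows "root_eval \<phi> f = root_eval \<phi> g \<longleftrightarrow> root_eval (\<lambda>x. x) f = root_eval (\<lambda>x. x) g"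
  using root_eval_zero_iff[OF root_eval_diff(1)[OF phi_hom assms] phi_hom phi_inj]
  unfolding root_eval_diff(2)[OF phi_hom assms] root_eval_diff(2)[OF sub_id_hom assms] by simp

lemma phi0_rev: "f \<in> supported R exps \<Longrightarrow> phi0 (root_eval (\<lambda>x. x) f) = root_eval \<phi> f"
proof -
  assume f: "f \<in> supported R exps"
  let ?P = "\<lambda>g. g \<in> supported R exps \<and> root_eval (\<lambda>x. x) g = root_eval (\<lambda>x. x) f"
  have "?P (SOME g. ?P g)" by (rule someI[of ?P f]) (use f in simp)
  then show ?thesis unfolding phi0_def using root_eval_eq_iff f by blast
qed

text \<open>Surjectivity of \<phi> on \<open>R\<close> allows every coefficient to be replaced by a
  preimage, which makes \<open>phi0\<close> onto.\<close>

lemma root_eval_phi_image: "root_eval \<phi> ` supported R exps = KK"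
proof
  have "f \<in> supported R exps \<and> root_eval \<phi> f \<in> KK" if "f \<in> supported R exps" for f
    using that
  proof (induction f rule: supported_induct)
    case zero then show ?case using KK_R R_closed by (simp add: root_eval_eq) (auto simp: supported_def R_closed)
  next
    case (add e c g)
    obtain k m where e: "e = of_nat k / of_nat (p ^ m)" using add(1) unfolding exps_def by blast
    note s = root_eval_hom(6)[OF phi_hom _ add(2,1)]
    show ?case using add s root_eval_hom(1)[OF phi_hom s] root_eval_hom(3)[OF phi_hom s] root_eval_hom(5)[OF phi_hom _ add(2,1)]
        KK_mono[OF hom_O(1)[OF phi_hom add(2)], of m k] rpow_eq[of k m] e by (auto intro: KK_ring)
  qed
  then show "root_eval \<phi> ` supported R exps \<subseteq> KK" by blast
  show "KK \<subseteq> root_eval \<phi> ` supported R exps"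
  proof
    fix x assume "x \<in> KK"
    then show "x \<in> root_eval \<phi> ` supported R exps"
    proof (induction x rule: KK_induct)
      case zero
      then show ?case by (rule image_eqI[of _ _ 0]) (auto simp: root_eval_eq supported_def R_closed)
    next
      case (add c m k y)
      then obtain g where g: "g \<in> supported R exps" "y = root_eval \<phi> g" by blast
      obtain c' where c': "c' \<in> R" "\<phi> c' = c" using phi_bij add(1) by (metis bij_betw_imp_surj_on imageE)
      note s = root_eval_hom(6)[OF phi_hom g(1) c'(1) exps_I[of k m]]
      have "root_eval \<phi> (Poly_Mapping.single (of_nat k / of_nat (p ^ m)) c' + g) = c * \<pi> m ^ k + y"
        using root_eval_hom(1)[OF phi_hom s g(1)] root_eval_hom(5)[OF phi_hom g(1) c'(1) exps_I] g c' rpow_eq by simp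
      then show ?case using root_eval_hom(3)[OF phi_hom s g(1)] by (metis imageI)
    qed
  qed
qed

lemma phi0_iso: "phi0 \<in> ring_iso KU KU"
proof -
  have one: "root_eval \<psi> (Poly_Mapping.single 0 1) = 1" "Poly_Mapping.single 0 1 \<in> supported R exps"
    if "\<psi> \<in> ring_hom \<O> \<O>" for \<psi>
  proof -
    have z: "(0::rat) \<in> exps" using exps_I[of 0 0] by simp
    have "(0 :: rat \<Rightarrow>\<^sub>0 'k) \<in> supported R exps" by (auto simp: supported_def R_closed)
    from root_eval_hom(5,6)[OF that this R_closed(2) z] show "root_eval \<psi> (Poly_Mapping.single 0 1) = 1" "Poly_Mapping.single 0 1 \<in> supported R exps"
      using rpow_eq[of 0 0] hom_O(4)[OF that] by auto
  qed
  have "phi0 1 = 1" using phi0_rev[OF one(2)[OF phi_hom]] one(1)[OF phi_hom] one(1)[OF sub_id_hom] by simp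
  moreover have "phi0 (x + y) = phi0 x + phi0 y \<and> phi0 (x * y) = phi0 x * phi0 y" if "x \<in> KK" "y \<in> KK" for x y
  proof -
    obtain f g where fg: "f \<in> supported R exps" "x = root_eval (\<lambda>x. x) f" "g \<in> supported R exps" "y = root_eval (\<lambda>x. x) g"
      using \<open>x \<in> KK\<close> \<open>y \<in> KK\<close> unfolding KK_def by auto
    have "x + y = root_eval (\<lambda>x. x) (f + g)" "x * y = root_eval (\<lambda>x. x) (f * g)" "f + g \<in> supported R exps" "f * g \<in> supported R exps"
      using root_eval_hom(1-4)[OF sub_id_hom fg(1) fg(3)] fg by auto
    then show ?thesis using phi0_rev fg root_eval_hom(1,2)[OF phi_hom fg(1) fg(3)] by metis
  qed
  moreover have "bij_betw phi0 KK KK"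
  proof -
    have "inj_on phi0 KK" using phi0_rev root_eval_eq_iff by (auto simp: inj_on_def KK_def)
    moreover have "phi0 ` KK = root_eval \<phi> ` supported R exps" using phi0_rev unfolding KK_def by (auto simp: image_image image_iff)
    ultimately show ?thesis using root_eval_phi_image by (simp add: bij_betw_def)
  qed
  ultimately show ?thesis by (auto simp: ring_iso_def ring_hom_def KU_eq bij_betw_def)
qed

lemma phi0_gen: "c \<in> R \<Longrightarrow> phi0 c = \<phi> c" "phi0 (\<pi> m) = \<pi> m"
proof -
  have z: "(0 :: rat \<Rightarrow>\<^sub>0 'k) \<in> supported R exps" by (auto simp: supported_def R_closed)
  have *: "phi0 (c * \<pi> m ^ k) = \<phi> c * \<pi> m ^ k" if "c \<in> R" for c k m
    using phi0_rev[OF root_eval_hom(6)[OF phi_hom z that exps_I[of k m]]] root_eval_hom(5)[OF phi_hom z that exps_I[of k m]]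
      root_eval_hom(5)[OF sub_id_hom z that exps_I[of k m]] rpow_eq[of k m] by simp
  show "c \<in> R \<Longrightarrow> phi0 c = \<phi> c" using *[of c m 0] by simp
  show "phi0 (\<pi> m) = \<pi> m" using *[of 1 m 1] hom_O(4)[OF phi_hom] R_closed by simp
qed

lemma KU_hom_unique:
  assumes C: "cring C" and h: "h \<in> ring_hom KU C" and h': "h' \<in> ring_hom KU C"
    and eqR: "\<And>c. c \<in> R \<Longrightarrow> h c = h' c" and eqpi: "\<And>m. h (\<pi> m) = h' (\<pi> m)" and x: "x \<in> KK"
  shows "h x = h' x"
  using x
proof (induction x rule: KK_induct)
  case zero then show ?case using eqR R_closed by blast
next
  case (add c m k y)
  have *: "h (c * \<pi> m ^ k + y) = h c \<otimes>\<^bsub>C\<^esub> h (\<pi> m) [^]\<^bsub>C\<^esub> k \<oplus>\<^bsub>C\<^esub> h y" if h: "h \<in> ring_hom KU C" for h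
  proof -
    have k: "\<pi> m ^ k \<in> KK" using KK_mono[of 1 m k] R_closed by simp
    have "h (\<pi> m ^ k) = h (\<pi> m) [^]\<^bsub>C\<^esub> k"
      using ring_hom_pow'[OF KU_cring C h, of "\<pi> m" k] KK_pi by (simp add: KU_eq)
    then show ?thesis using ring_hom_add[OF h, of "c * \<pi> m ^ k" y] ring_hom_mult[OF h, of c "\<pi> m ^ k"]
      KK_mono[OF add(1)] add k KK_R by (simp add: KU_eq)
  qed
  show ?case unfolding *[OF h] *[OF h'] using eqR eqpi add by simp
qed

text \<open>The completion of \<open>phi0\<close> satisfies the description. Another candidate
  agrees with it on \<open>R\<close> and the roots, hence on \<open>KK\<close>, hence on the
  completion by \<open>completion_hom_unique\<close>.\<close>

lemma K_aut:
  shows "K_aut p R \<phi> \<pi> \<in> ring_iso K0 K0" "c \<in> R \<Longrightarrow> K_aut p R \<phi> \<pi> (toK c) = toK (\<phi> c)"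
proof -
  let ?P = "\<lambda>\<Phi>. \<Phi> \<in> ring_iso K0 K0 \<inter> extensional (carrier K0) \<and>
        (\<forall>r\<in>R. \<Phi> (toK r) = toK (\<phi> r)) \<and> (\<forall>m. \<Phi> (toK (\<pi> m)) = toK (\<pi> m))"
  let ?g = "completion_map p KU phi0"
  let ?\<Phi> = "restrict ?g (carrier K0)"
  have ph: "phi0 \<in> ring_hom KU KU" using phi0_iso by (simp add: ring_iso_def)
  have g: "?g \<in> ring_iso K0 K0" unfolding K_int_def by (rule completion_map_iso[OF KU_cring KU_cring phi0_iso])
  have gt: "?g (toK x) = toK (phi0 x)" if "x \<in> KK" for x
    unfolding to_K_int_def using completion_map_hom(2)[OF KU_cring KU_cring ph, where p = p and a = x] that by (simp add: KU_eq)
  have tc: "x \<in> KK \<Longrightarrow> toK x \<in> carrier K0" for x using ring_hom_closed[OF toK_hom] by (simp add: KU_eq)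
  have P: "?P ?\<Phi>"
    using K0.ring_iso_restrict[OF g, of ?\<Phi>] gt tc KK_R KK_pi by (auto simp: phi0_gen)
  have "\<exists>!\<Phi>. ?P \<Phi>"
  proof (rule ex1I[of _ ?\<Phi>])
    show "?P ?\<Phi>" by (rule P)
    fix \<Psi> assume Q: "?P \<Psi>"
    have hp: "\<Psi> \<in> ring_hom (p_completion p KU) (p_completion p KU)" "?\<Phi> \<in> ring_hom (p_completion p KU) (p_completion p KU)"
      using P Q by (auto simp: ring_iso_def K_int_def)
    have "\<Psi> (toK a) = ?\<Phi> (toK a)" if "a \<in> KK" for a
    proof -
      have "toK \<in> ring_hom KU (p_completion p KU)" using toK_hom by (simp add: K_int_def)
      from KU_hom_unique[OF KU.completion_cring ring_hom_trans[OF this hp(1)] ring_hom_trans[OF this hp(2)] _ _ that]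
      show ?thesis using P Q by simp
    qed
    then have "\<Psi> s = ?\<Phi> s" if "s \<in> carrier K0" for s
      using completion_hom_unique[OF KU_cring KU_cring hp, of s] that unfolding K_int_def to_K_int_def by (simp add: KU_eq)
    then show "\<Psi> = ?\<Phi>" using Q by (intro extensionalityI[of _ "carrier K0"]) auto
  qed
  from theI'[OF this] have "?P (K_aut p R \<phi> \<pi>)" unfolding K_aut_def .
  then show "K_aut p R \<phi> \<pi> \<in> ring_iso K0 K0" "c \<in> R \<Longrightarrow> K_aut p R \<phi> \<pi> (toK c) = toK (\<phi> c)" by auto
qed

end

section \<open>The image of a homomorphism of rings with a Frobenius lift\<close>

locale frobenius_hom = J?: cring J for J :: "('a, 'm) ring_scheme" (structure) +
  fixes p :: nat and \<phi> u :: "'a \<Rightarrow> 'a"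
  assumes p: "Factorial_Ring.prime p" "odd p"
    and phi: "\<phi> \<in> ring_hom J J" and u: "u \<in> ring_hom J J"
    and frob: "a \<in> carrier J \<Longrightarrow> pcong p J 1 (\<phi> a) (a [^] p)"
    and tf: "a \<in> carrier J \<Longrightarrow> [p] \<cdot> a = \<zero> \<Longrightarrow> a = \<zero>"
    and comm: "a \<in> carrier J \<Longrightarrow> u (\<phi> a) = \<phi> (u a)"
begin

lemma p_cancel:
  assumes "a \<in> carrier J" "b \<in> carrier J" "[p] \<cdot> a = [p] \<cdot> b" shows "a = b"
proof -
  have "[p] \<cdot> (a \<ominus> b) = \<zero>" using assms by (simp add: nmult_minus)
  then have "a \<ominus> b = \<zero>" using tf assms by blast
  then show ?thesis using assms by simp
qed

lemmas phin = ring_hom_funpow[OF phi]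

lemmas phi_ops [simp] = ring_hom_closed[OF phi] ring_hom_add[OF phi] ring_hom_mult[OF phi] ring_hom_one[OF phi]
  ring_hom_nmult[OF cring_axioms cring_axioms phi] ring_hom_pow'[OF cring_axioms cring_axioms phi]
lemmas u_ops [simp] = ring_hom_closed[OF u] ring_hom_add[OF u] ring_hom_mult[OF u] ring_hom_one[OF u]
  ring_hom_nmult[OF cring_axioms cring_axioms u] ring_hom_pow'[OF cring_axioms cring_axioms u]
lemmas phin_ops [simp] = ring_hom_closed[OF phin] ring_hom_add[OF phin] ring_hom_mult[OF phin] ring_hom_one[OF phin]
  ring_hom_nmult[OF cring_axioms cring_axioms phin] ring_hom_pow'[OF cring_axioms cring_axioms phin]

lemma u_phin: "a \<in> carrier J \<Longrightarrow> u ((\<phi> ^^ n) a) = (\<phi> ^^ n) (u a)"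
  by (induction n) (auto simp: comm)

lemma frob_iter: "a \<in> carrier J \<Longrightarrow> pcong p J 1 ((\<phi> ^^ n) a) (a [^] (p ^ n))"
proof (induction n)
  case (Suc n)
  have "pcong p J 1 (\<phi> ((\<phi> ^^ n) a)) (((\<phi> ^^ n) a) [^] p)" using frob Suc by simp
  also have "pcong p J 1 (((\<phi> ^^ n) a) [^] p) ((a [^] (p ^ n)) [^] p)" using pcong_pow Suc by blast
  finally show ?case using Suc by (simp add: nat_pow_pow mult.commute)
qed simp

definition near_image :: "nat \<Rightarrow> 'a \<Rightarrow> bool" where
  "near_image N a \<longleftrightarrow> a \<in> carrier J \<and> (\<exists>n. \<exists>w\<in>carrier J. pcong p J N ((\<phi> ^^ n) a) (u w))"

lemma near_image_carr: "near_image N a \<Longrightarrow> a \<in> carrier J" by (simp add: near_image_def)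

lemma near_imageI: "a \<in> carrier J \<Longrightarrow> w \<in> carrier J \<Longrightarrow> pcong p J N ((\<phi> ^^ n) a) (u w) \<Longrightarrow> near_image N a"
  unfolding near_image_def by blast

text \<open>Since u commutes with \<phi>, the iterate in \<open>near_image\<close> may be enlarged
  freely; two elements can thus be given a common one, and sums and products follow.\<close>

lemma near_image_lift:
  assumes "pcong p J N ((\<phi> ^^ n) a) (u w)" "a \<in> carrier J" "w \<in> carrier J"
  shows "pcong p J N ((\<phi> ^^ (k + n)) a) (u ((\<phi> ^^ k) w))"
  using pcong_hom[OF cring_axioms cring_axioms phin assms(1), of k] assms by (simp add: funpow_add u_phin)

lemma near_image_common:
  assumes "near_image N a" "near_image N b"
  obtains n v w where "v \<in> carrier J" "w \<in> carrier J" "pcong p J N ((\<phi> ^^ n) a) (u v)" "pcong p J N ((\<phi> ^^ n) b) (u w)"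
proof -
  obtain n v where v: "v \<in> carrier J" "pcong p J N ((\<phi> ^^ n) a) (u v)" using assms near_image_def by blast
  obtain m w where w: "w \<in> carrier J" "pcong p J N ((\<phi> ^^ m) b) (u w)" using assms near_image_def by blast
  have "pcong p J N ((\<phi> ^^ (m + n)) a) (u ((\<phi> ^^ m) v))" using near_image_lift v assms near_image_carr by blast
  moreover have "pcong p J N ((\<phi> ^^ (m + n)) b) (u ((\<phi> ^^ n) w))"
    using near_image_lift[OF w(2) near_image_carr[OF assms(2)] w(1), of n] by (simp add: add.commute)
  ultimately show ?thesis by (rule that[rotated 2]) (use v w in simp_all)
qed

lemma near_image_add: "near_image N a \<Longrightarrow> near_image N b \<Longrightarrow> near_image N (a \<oplus> b)"
proof -
  assume ab: "near_image N a" "near_image N b"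
  then obtain n v w where vw: "v \<in> carrier J" "w \<in> carrier J" "pcong p J N ((\<phi> ^^ n) a) (u v)" "pcong p J N ((\<phi> ^^ n) b) (u w)"
    by (rule near_image_common)
  then show ?thesis using pcong_add[OF vw(3,4)] ab near_image_carr by (intro near_imageI[of _ "v \<oplus> w" N n]) auto
qed

lemma near_image_mult: "near_image N a \<Longrightarrow> near_image N b \<Longrightarrow> near_image N (a \<otimes> b)"
proof -
  assume ab: "near_image N a" "near_image N b"
  then obtain n v w where vw: "v \<in> carrier J" "w \<in> carrier J" "pcong p J N ((\<phi> ^^ n) a) (u v)" "pcong p J N ((\<phi> ^^ n) b) (u w)"
    by (rule near_image_common)
  then show ?thesis using pcong_mult[OF vw(3,4)] ab near_image_carr by (intro near_imageI[of _ "v \<otimes> w" N n]) auto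
qed

lemma near_image_u: "w \<in> carrier J \<Longrightarrow> near_image N (u w)"
  by (rule near_imageI[of _ w N 0]) auto

lemma near_image_one: "near_image N \<one>" using near_image_u[of \<one>] by simp

lemma near_image_neg: "near_image N a \<Longrightarrow> near_image N (\<ominus> a)"
proof -
  assume a: "near_image N a"
  have "u (\<ominus> \<one>) = \<ominus> \<one>"
    using ring_hom_minus[OF cring_axioms cring_axioms u, of \<zero> \<one>] ring_hom_zero[OF u ring_axioms ring_axioms]
    by (simp add: a_minus_def)
  then have "near_image N (\<ominus> \<one>)" using near_image_u[of "\<ominus> \<one>"] by simp
  from near_image_mult[OF this a] show ?thesis using near_image_carr[OF a] by (simp add: l_minus)
qed

lemma near_image_pow: "near_image N a \<Longrightarrow> near_image N (a [^] (k::nat))"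
  by (induction k) (auto intro: near_image_one near_image_mult)

lemma near_image_zero: "near_image N \<zero>" using near_image_add[OF near_image_one near_image_neg[OF near_image_one]] by (simp add: r_neg)

lemma near_image_nmult: "near_image N a \<Longrightarrow> near_image N ([(k::nat)] \<cdot> a)"
  by (induction k) (auto simp: nmult_Suc near_image_carr intro: near_image_zero near_image_add)

lemma near_image_cong: "near_image N b \<Longrightarrow> pcong p J N a b \<Longrightarrow> near_image N a"
proof -
  assume b: "near_image N b" and ab: "pcong p J N a b"
  then obtain n w where w: "w \<in> carrier J" "pcong p J N ((\<phi> ^^ n) b) (u w)" unfolding near_image_def by blast
  have "pcong p J N ((\<phi> ^^ n) a) (u w)"
    using pcong_trans[OF pcong_hom[OF cring_axioms cring_axioms phin ab] w(2)] .
  then show ?thesis using w pcong_carr[OF ab] by (intro near_imageI)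
qed

lemma near_image_phin: "a \<in> carrier J \<Longrightarrow> near_image N ((\<phi> ^^ n) a) \<Longrightarrow> near_image N a"
proof -
  assume a: "a \<in> carrier J" "near_image N ((\<phi> ^^ n) a)"
  then obtain m w where "w \<in> carrier J" "pcong p J N ((\<phi> ^^ m) ((\<phi> ^^ n) a)) (u w)" unfolding near_image_def by blast
  then show ?thesis using a near_imageI[of a w N "m + n"] by (simp add: funpow_add)
qed

lemma near_image_p: "near_image N a \<Longrightarrow> near_image (Suc N) ([p] \<cdot> a)"
proof -
  assume a: "near_image N a"
  then obtain n w where w: "w \<in> carrier J" "pcong p J N ((\<phi> ^^ n) a) (u w)" unfolding near_image_def by blast
  then show ?thesis using pcong_nmult[OF w(2), of 1] near_image_carr[OF a] by (intro near_imageI[of _ "[p] \<cdot> w" _ n]) auto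
qed

lemma near_image_divide_image:
  assumes y: "y \<in> carrier J" and w: "w \<in> carrier J" and eq: "[p] \<cdot> y = u w"
  shows "near_image N y"
proof -
  have "pcong p J 1 ((\<phi> ^^ N) w) (w [^] (p ^ N))" using frob_iter w .
  \<comment> \<open>N iterations suffice because the error term below carries the exponent
    \<open>p ^ N - 1\<close>, which is at least N.\<close>
  then obtain v where v: "v \<in> carrier J" "(\<phi> ^^ N) w = w [^] (p ^ N) \<oplus> [p] \<cdot> v" unfolding pcong_def by auto
  have pp: "p ^ N = Suc (p ^ N - 1)" using prime_gt_0_nat[OF p(1)] by simp
  have "[p] \<cdot> ((\<phi> ^^ N) y) = (\<phi> ^^ N) (u w)" using eq[symmetric] y by simp
  also have "\<dots> = u ((\<phi> ^^ N) w)" using u_phin w by simp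
  also have "\<dots> = ([p] \<cdot> y) [^] (p ^ N) \<oplus> [p] \<cdot> (u v)" using v w eq by simp
  also have "([p] \<cdot> y) [^] (p ^ N) = [p] \<cdot> ([(p ^ (p ^ N - 1))] \<cdot> (y [^] (p ^ N)))"
  proof -
    have "p ^ (p ^ N) = p * p ^ (p ^ N - 1)" by (subst pp) (rule power_Suc)
    moreover have "y [^] (p ^ N) \<in> carrier J" using y by simp
    ultimately show ?thesis using nmult_pow[OF y, of p "p ^ N"] nmult_nmult[of "y [^] (p ^ N)" p "p ^ (p ^ N - 1)"] by simp
  qed
  finally have "[p] \<cdot> ((\<phi> ^^ N) y) = [p] \<cdot> (u v \<oplus> [(p ^ (p ^ N - 1))] \<cdot> (y [^] (p ^ N)))"
    using y v by (simp add: nmult_add a_comm)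
  then have "(\<phi> ^^ N) y = u v \<oplus> [(p ^ (p ^ N - 1))] \<cdot> (y [^] (p ^ N))" by (rule p_cancel[rotated 2]) (use y v in simp_all)
  then have "pcong p J (p ^ N - 1) ((\<phi> ^^ N) y) (u v)" using pcongI y v by simp
  moreover have "N \<le> p ^ N - 1" using less_exp[of N] power_mono[OF prime_ge_2_nat[OF p(1)], of N] by linarith
  ultimately have "pcong p J N ((\<phi> ^^ N) y) (u v)" by (rule pcong_mono)
  then show ?thesis using near_imageI y v by blast
qed

text \<open>The error \<open>p ^ Suc N\<close> times b is moved to the left, where after division by
  p it is \<open>p ^ N\<close> times b and invisible at level N. What remains is the exact case
  \<open>near_image_divide_image\<close>.\<close>

lemma near_image_saturated:
  assumes y: "y \<in> carrier J" and near_image: "near_image (Suc N) ([p] \<cdot> y)"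
  shows "near_image N y"
proof -
  obtain n w where w: "w \<in> carrier J" "pcong p J (Suc N) ((\<phi> ^^ n) ([p] \<cdot> y)) (u w)" using near_image unfolding near_image_def by blast
  then obtain b where b: "b \<in> carrier J" "[p] \<cdot> ((\<phi> ^^ n) y) = u w \<oplus> [(p ^ Suc N)] \<cdot> b" unfolding pcong_def using y by auto
  let ?y = "(\<phi> ^^ n) y \<ominus> [(p ^ N)] \<cdot> b"
  have "[p] \<cdot> ?y = u w \<oplus> [(p ^ Suc N)] \<cdot> b \<ominus> [(p ^ Suc N)] \<cdot> b" using b y by (simp add: nmult_minus nmult_nmult)
  also have "\<dots> = u w" using b w by (simp add: a_minus_def a_assoc r_neg)
  finally have "near_image N ?y" using near_image_divide_image[of ?y w] y b w by simp
  moreover have "(\<phi> ^^ n) y = ?y \<oplus> [(p ^ N)] \<cdot> b" using y b by (simp add: a_minus_def a_assoc l_neg)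
  then have "pcong p J N ((\<phi> ^^ n) y) ?y" using pcongI[of ?y b p N] y b by simp
  ultimately have "near_image N ((\<phi> ^^ n) y)" by (rule near_image_cong)
  then show ?thesis by (rule near_image_phin[OF y])
qed

text \<open>The binomial expansion to second order with remainder p^3 c. The remainder is an integer
  polynomial in y, but all that is kept of it is that it inherits \<open>near_image\<close> from
  y.\<close>

lemma power_one_plus_p:
  assumes y: "y \<in> carrier J"
  shows "\<exists>c\<in>carrier J. (\<forall>N. near_image N y \<longrightarrow> near_image N c) \<and>
    (\<one> \<oplus> [p] \<cdot> y) [^] n = \<one> \<oplus> [p] \<cdot> ([n] \<cdot> y \<oplus> [p] \<cdot> ([(n choose 2)] \<cdot> (y \<otimes> y) \<oplus> [p] \<cdot> c))"
proof (induction n)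
  case 0
  show ?case by (rule bexI[of _ \<zero>]) (auto simp: near_image_zero binomial_eq_0)
next
  case (Suc n)
  then obtain c where c: "c \<in> carrier J" "\<And>N. near_image N y \<Longrightarrow> near_image N c"
    "(\<one> \<oplus> [p] \<cdot> y) [^] n = \<one> \<oplus> [p] \<cdot> ([n] \<cdot> y \<oplus> [p] \<cdot> ([(n choose 2)] \<cdot> (y \<otimes> y) \<oplus> [p] \<cdot> c))" by blast
  let ?c = "c \<oplus> ([(n choose 2)] \<cdot> (y \<otimes> (y \<otimes> y)) \<oplus> [p] \<cdot> (c \<otimes> y))"
  have ch: "Suc n choose 2 = n + (n choose 2)" by (simp add: numeral_2_eq_2)
  have "(\<one> \<oplus> [p] \<cdot> y) [^] Suc n = \<one> \<oplus> [p] \<cdot> ([Suc n] \<cdot> y \<oplus> [p] \<cdot> ([(Suc n choose 2)] \<cdot> (y \<otimes> y) \<oplus> [p] \<cdot> ?c))"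
  proof -
    let ?C = "n choose 2" and ?y2 = "y \<otimes> y" and ?y3 = "y \<otimes> (y \<otimes> y)"
    have A: "(\<one> \<oplus> [p] \<cdot> a) \<otimes> (\<one> \<oplus> [p] \<cdot> y) = \<one> \<oplus> [p] \<cdot> ((a \<oplus> y) \<oplus> [p] \<cdot> (a \<otimes> y))" if "a \<in> carrier J" for a
      using that y by (simp add: l_distr r_distr nmult_add nmult_l nmult_r nmult_nmult a_ac)
    have B: "([n] \<cdot> y \<oplus> [p] \<cdot> b) \<otimes> y = [n] \<cdot> ?y2 \<oplus> [p] \<cdot> (b \<otimes> y)" if "b \<in> carrier J" for b
      using that y by (simp add: l_distr nmult_l)
    have D: "([?C] \<cdot> ?y2 \<oplus> [p] \<cdot> c) \<otimes> y = [?C] \<cdot> ?y3 \<oplus> [p] \<cdot> (c \<otimes> y)"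
      using c(1) y by (simp add: l_distr nmult_l m_assoc)
    let ?b = "[?C] \<cdot> ?y2 \<oplus> [p] \<cdot> c"
    have "(\<one> \<oplus> [p] \<cdot> ([n] \<cdot> y \<oplus> [p] \<cdot> ?b)) \<otimes> (\<one> \<oplus> [p] \<cdot> y) =
       \<one> \<oplus> [p] \<cdot> (([n] \<cdot> y \<oplus> [p] \<cdot> ?b \<oplus> y) \<oplus> [p] \<cdot> ([n] \<cdot> ?y2 \<oplus> [p] \<cdot> ([?C] \<cdot> ?y3 \<oplus> [p] \<cdot> (c \<otimes> y))))"
      using c(1) y by (subst A) (simp_all add: B D)
    also have "\<dots> = \<one> \<oplus> [p] \<cdot> ([Suc n] \<cdot> y \<oplus> [p] \<cdot> (?b \<oplus> ([n] \<cdot> ?y2 \<oplus> [p] \<cdot> ([?C] \<cdot> ?y3 \<oplus> [p] \<cdot> (c \<otimes> y)))))"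
      using c(1) y by (simp add: nmult_Suc nmult_add a_ac)
    also have "?b \<oplus> ([n] \<cdot> ?y2 \<oplus> [p] \<cdot> ([?C] \<cdot> ?y3 \<oplus> [p] \<cdot> (c \<otimes> y))) = [(n + ?C)] \<cdot> ?y2 \<oplus> [p] \<cdot> ?c"
      using c(1) y by (simp add: nmult_plus nmult_add a_ac)
    finally show ?thesis unfolding nat_pow_Suc c(3) ch .
  qed
  moreover have "near_image N ?c" if "near_image N y" for N
    using that c(2)[OF that] by (intro near_image_add near_image_nmult near_image_mult)
  ultimately show ?case using c(1) y by (intro bexI[of _ ?c]) auto
qed

lemma near_image_unit_image:
  assumes x: "x \<in> carrier J" "x' \<in> carrier J" "x \<otimes> x' = \<one>" and ux: "u x = x [^] p"
  shows "near_image N x" and "near_image 1 x'"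
proof -
  obtain t where t: "t \<in> carrier J" "\<phi> x = x [^] p \<oplus> [p] \<cdot> t" using frob[OF x(1)] unfolding pcong_def by auto
  define y where "y = t \<otimes> x' [^] p"
  have y: "y \<in> carrier J" using t x by (simp add: y_def)
  have inv: "x [^] k \<otimes> x' [^] k = \<one>" for k :: nat using nat_pow_distrib[OF x(1,2), of k] x(3) by simp
  have xy: "x [^] p \<otimes> y = t" unfolding y_def using t x inv[of p] m_lcomm[of "x [^] p" t "x' [^] p"] by simp
  have phx: "\<phi> x = x [^] p \<otimes> (\<one> \<oplus> [p] \<cdot> y)"
    using t(2) xy x y by (simp add: r_distr nmult_r)
  have ux': "u x' = x' [^] p"
    using ring_hom_inverse[OF cring_axioms cring_axioms u x(1,2,3), of "x' [^] p"] x inv[of p] ux by simp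
  have "x [^] (p * p) \<otimes> (\<one> \<oplus> [p] \<cdot> u y) = u (\<phi> x)"
    unfolding phx using x y by (simp add: ux nat_pow_pow)
  also have "\<dots> = \<phi> (x [^] p)" using comm x ux by simp
  also have "\<dots> = x [^] (p * p) \<otimes> (\<one> \<oplus> [p] \<cdot> y) [^] p" using phx x y by (simp add: nat_pow_distrib nat_pow_pow)
  finally have *: "x [^] (p * p) \<otimes> (\<one> \<oplus> [p] \<cdot> u y) = x [^] (p * p) \<otimes> (\<one> \<oplus> [p] \<cdot> y) [^] p" .
  have canc: "a = b" if "x [^] (p * p) \<otimes> a = x [^] (p * p) \<otimes> b" "a \<in> carrier J" "b \<in> carrier J" for a b
  proof -
    have "x' [^] (p * p) \<otimes> (x [^] (p * p) \<otimes> c) = c" if "c \<in> carrier J" for c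
      using inv[of "p * p"] x that m_assoc[of "x' [^] (p * p)" "x [^] (p * p)" c] m_comm[of "x' [^] (p * p)" "x [^] (p * p)"] by simp
    then show ?thesis using that by metis
  qed
  have "\<one> \<oplus> [p] \<cdot> u y = (\<one> \<oplus> [p] \<cdot> y) [^] p" by (rule canc[OF *]) (use y in auto)
  moreover obtain c where c: "c \<in> carrier J" "\<And>N. near_image N y \<Longrightarrow> near_image N c"
    "(\<one> \<oplus> [p] \<cdot> y) [^] p = \<one> \<oplus> [p] \<cdot> ([p] \<cdot> y \<oplus> [p] \<cdot> ([(p choose 2)] \<cdot> (y \<otimes> y) \<oplus> [p] \<cdot> c))"
    using power_one_plus_p[OF y, of p] by blast
  ultimately have "\<one> \<oplus> [p] \<cdot> u y = \<one> \<oplus> [p] \<cdot> ([p] \<cdot> y \<oplus> [p] \<cdot> ([(p choose 2)] \<cdot> (y \<otimes> y) \<oplus> [p] \<cdot> c))" by simp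
  then have "[p] \<cdot> u y = [p] \<cdot> ([p] \<cdot> y \<oplus> [p] \<cdot> ([(p choose 2)] \<cdot> (y \<otimes> y) \<oplus> [p] \<cdot> c))"
    using y c(1) by simp
  then have uy: "u y = [p] \<cdot> y \<oplus> [p] \<cdot> ([(p choose 2)] \<cdot> (y \<otimes> y) \<oplus> [p] \<cdot> c)"
    by (rule p_cancel[rotated 2]) (use y c(1) in simp_all)
  \<comment> \<open>Here oddness of p enters: the quadratic term acquires an extra p, so that u(y) =
    p (y + p g).\<close>
  have "p choose 2 = p * ((p - 1) div 2)" unfolding choose_two by (rule div_mult_swap[symmetric]) (use p(2) in simp)
  then have ch: "[(p choose 2)] \<cdot> (y \<otimes> y) = [p] \<cdot> ([((p - 1) div 2)] \<cdot> (y \<otimes> y))" using y by (simp add: nmult_nmult)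
  define g where "g = [((p - 1) div 2)] \<cdot> (y \<otimes> y) \<oplus> c"
  have g: "g \<in> carrier J" using y c(1) by (simp add: g_def)
  have "[p] \<cdot> (y \<oplus> [p] \<cdot> g) = u y"
    unfolding uy ch g_def using y c(1) by (simp add: nmult_add)
  then have z: "near_image N (y \<oplus> [p] \<cdot> g)" for N using near_image_divide_image y g by simp
  \<comment> \<open>\<open>z\<close> holds at every level, and g is built from y; knowing y at level
    N gives p g at level N + 1, and y is the difference.\<close>
  have Ey: "near_image N y" for N
  proof (induction N)
    case 0 show ?case using y g by (intro near_image_cong[OF z[of 0]]) auto
  next
    case (Suc N)
    have "near_image N g" unfolding g_def using Suc c(2)[OF Suc] by (intro near_image_add near_image_nmult near_image_mult)
    then have "near_image (Suc N) ((y \<oplus> [p] \<cdot> g) \<oplus> \<ominus> ([p] \<cdot> g))" by (intro near_image_add z near_image_neg near_image_p)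
    then show ?case using y g by (simp add: a_assoc r_neg)
  qed
  have "near_image N (u x \<otimes> (\<one> \<oplus> [p] \<cdot> y))" using Ey x by (intro near_image_mult near_image_u near_image_add near_image_one near_image_nmult) auto
  then have "near_image N (\<phi> x)" using phx ux by simp
  then show "near_image N x" using near_image_phin[of x N 1] x by simp
  \<comment> \<open>Level 1 is enough for the inverse: it is never divided by p, unlike x, from
    which the higher coordinates are produced. Modulo p, \<phi>(x') is x'^p, which equals
    u(x').\<close>
  have "pcong p J 1 ((\<phi> ^^ 1) x') (u x')" using frob[OF x(2)] ux' by simp
  then show "near_image 1 x'" using near_imageI[of x' x'] x by blast
qed

text \<open>Division by p lowers the level by one, so a hypothesis at all levels is needed to
  conclude at all levels and to continue along the sequence of coordinates.\<close>

lemma near_image_delta: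
  assumes "\<And>N. near_image N a" "b \<in> carrier J" "\<phi> a = a [^] p \<oplus> [p] \<cdot> b"
  shows "near_image N b"
proof (rule near_image_saturated[OF assms(2)])
  have a: "a \<in> carrier J" using near_image_carr assms(1) by blast
  have 1: "near_image M (\<phi> a)" for M
  proof -
    obtain n w where w: "w \<in> carrier J" "pcong p J M ((\<phi> ^^ n) a) (u w)" using assms(1) near_image_def by blast
    have "pcong p J M ((\<phi> ^^ n) (\<phi> a)) (u (\<phi> w))"
      using pcong_hom[OF cring_axioms cring_axioms phi w(2)] w(1) comm by (simp add: funpow_swap1)
    then show ?thesis by (rule near_imageI[rotated 2]) (use a w in simp_all)
  qed
  have "near_image (Suc N) (\<phi> a \<oplus> \<ominus> (a [^] p))" using 1 assms(1) by (intro near_image_add near_image_neg near_image_pow)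
  moreover have "\<phi> a \<oplus> \<ominus> (a [^] p) = [p] \<cdot> b" using assms(2,3) a a_comm[of "a [^] p" "[p] \<cdot> b"] by (simp add: a_assoc r_neg)
  ultimately show "near_image (Suc N) ([p] \<cdot> b)" by simp
qed

end

section \<open>The jet algebra\<close>

context base
begin

abbreviation "JP \<equiv> jet_poly_ring R"
abbreviation "J \<equiv> jet_algebra p R"
abbreviation "toJ \<equiv> to_jet p R"

definition jX :: "nat \<Rightarrow> nat \<Rightarrow> 'k jet_poly set" where "jX i = toJ (jet_var i)"
definition jXi :: "nat \<Rightarrow> 'k jet_poly set" where "jXi = toJ jet_inv"
definition jR :: "'k \<Rightarrow> nat \<Rightarrow> 'k jet_poly set" where "jR r = toJ (jet_const r)"

lemma JP_cring: "cring JP" by (rule jet_poly_ring_cring[OF cring_O])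

sublocale JP: cring JP by (rule JP_cring)

lemma J_cring: "cring J" unfolding jet_algebra_def by (rule JP.completion_cring)

sublocale J: cring J by (rule J_cring)

lemma toJ_hom: "toJ \<in> ring_hom JP J"
  unfolding to_jet_def jet_algebra_def by (rule JP.to_completion_ring_hom)

lemma JP_supp: "carrier JP = supported R jet_exps" by (simp add: jet_poly_ring_eq)

lemma JP_mem: "r \<in> R \<Longrightarrow> jet_const r \<in> carrier JP" "jet_var i \<in> carrier JP" "jet_inv \<in> carrier JP"
  unfolding JP_supp
  by (auto simp: jet_const_def jet_var_def jet_inv_def supported_def jet_exps_def lookup_single when_def R_closed)

lemma JP_ops: "x \<otimes>\<^bsub>JP\<^esub> y = x * y" "x \<oplus>\<^bsub>JP\<^esub> y = x + y" "\<one>\<^bsub>JP\<^esub> = 1" "\<zero>\<^bsub>JP\<^esub> = 0"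
  "x [^]\<^bsub>JP\<^esub> (n::nat) = x ^ n" "[n] \<cdot>\<^bsub>JP\<^esub> x = of_nat n * x"
  by (simp_all add: jet_poly_ring_eq)

lemma j_closed [simp]: "r \<in> R \<Longrightarrow> jR r \<in> carrier J" "jX i \<in> carrier J" "jXi \<in> carrier J"
  unfolding jR_def jX_def jXi_def using ring_hom_closed[OF toJ_hom] JP_mem by auto

lemma jX_inv: "jX 0 \<otimes>\<^bsub>J\<^esub> jXi = \<one>\<^bsub>J\<^esub>"
  unfolding jX_def jXi_def using ring_hom_mult[OF toJ_hom JP_mem(2,3), of 0] ring_hom_one[OF toJ_hom]
  by (simp add: JP_ops jet_inv_var)

lemma jX_inv_pow: "jX 0 [^]\<^bsub>J\<^esub> (n::nat) \<otimes>\<^bsub>J\<^esub> jXi [^]\<^bsub>J\<^esub> n = \<one>\<^bsub>J\<^esub>"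
  using J.nat_pow_distrib[of "jX 0" jXi n] by (simp add: jX_inv)

lemma jR_hom: "jR \<in> ring_hom \<O> J"
proof -
  have "jet_const \<in> ring_hom \<O> JP"
    by (rule ring_hom_memI) (simp_all add: JP_mem JP_ops jet_const_mult jet_const_add, simp add: jet_const_def)
  from ring_hom_trans[OF this toJ_hom] show ?thesis unfolding jR_def comp_def .
qed

text \<open>Jet polynomials have coefficients in a field where p is nonzero; completion preserves
  the absence of p-torsion.\<close>

lemma J_torsion_free:
  assumes "a \<in> carrier J" "[p] \<cdot>\<^bsub>J\<^esub> a = \<zero>\<^bsub>J\<^esub>" shows "a = \<zero>\<^bsub>J\<^esub>"
proof -
  have "f = \<zero>\<^bsub>JP\<^esub>" if "f \<in> carrier JP" "[p] \<cdot>\<^bsub>JP\<^esub> f = \<zero>\<^bsub>JP\<^esub>" for f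
  proof -
    have "of_nat p * f = 0" using that by (simp add: JP_ops)
    then have "jet_const (of_nat p) * f = 0" by (simp add: jet_const_def)
    moreover have "jet_const (inverse (of_nat p)) * jet_const (of_nat p) = (1 :: 'k jet_poly)"
      using p_nonzero by (simp add: jet_const_mult[symmetric]) (simp add: jet_const_def)
    then have "f = (jet_const (inverse (of_nat p)) * jet_const (of_nat p)) * f" by simp
    ultimately have "f = jet_const (inverse (of_nat p)) * 0" by (simp only: mult.assoc)
    then show ?thesis by (simp add: JP_ops)
  qed
  from JP.completion_torsion_free[OF this] assms show ?thesis unfolding jet_algebra_def by simp
qed

lemma J_p_cancel:
  assumes "a \<in> carrier J" "b \<in> carrier J" "[p] \<cdot>\<^bsub>J\<^esub> a = [p] \<cdot>\<^bsub>J\<^esub> b" shows "a = b"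
proof -
  have "[p] \<cdot>\<^bsub>J\<^esub> (a \<ominus>\<^bsub>J\<^esub> b) = \<zero>\<^bsub>J\<^esub>" using assms by (simp add: J.nmult_minus)
  then have "a \<ominus>\<^bsub>J\<^esub> b = \<zero>\<^bsub>J\<^esub>" by (rule J_torsion_free[rotated]) (use assms in simp)
  then show ?thesis using assms by simp
qed

lemma toJ_induct:
  assumes "f \<in> supported R {e \<in> jet_exps. Poly_Mapping.keys e \<subseteq> I}"
    and "\<And>r. r \<in> R \<Longrightarrow> Q (jet_const r)" "\<And>i. i \<in> I \<Longrightarrow> Q (jet_var i)" "Q jet_inv"
    and "\<And>f g. f \<in> carrier JP \<Longrightarrow> g \<in> carrier JP \<Longrightarrow> Q f \<Longrightarrow> Q g \<Longrightarrow> Q (f + g)"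
    and "\<And>f g. f \<in> carrier JP \<Longrightarrow> g \<in> carrier JP \<Longrightarrow> Q f \<Longrightarrow> Q g \<Longrightarrow> Q (f * g)"
  shows "Q f"
proof -
  have "f \<in> carrier JP \<and> Q f"
    using assms(1) R_closed(1,2)
  proof (rule jet_generation)
    fix f g assume "f \<in> carrier JP \<and> Q f" "g \<in> carrier JP \<and> Q g"
    then show "f + g \<in> carrier JP \<and> Q (f + g)" "f * g \<in> carrier JP \<and> Q (f * g)"
      using assms(5,6) JP.a_closed[of f g] JP.m_closed[of f g] by (auto simp: JP_ops)
  qed (auto simp: JP_mem assms(2-4))
  then show ?thesis by blast
qed

text \<open>The case \<open>p\<close> asks for Q on every multiple of p, because a general element
  is a polynomial plus such a multiple. The rule is thus made for properties that depend only on the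
  class modulo p.\<close>

lemma J_induct [consumes 1, case_names const var inv add mult p]:
  assumes F: "F \<in> carrier J"
    and const: "\<And>r. r \<in> R \<Longrightarrow> Q (jR r)" and var: "\<And>i. Q (jX i)" and inv: "Q jXi"
    and add: "\<And>f g. f \<in> carrier J \<Longrightarrow> g \<in> carrier J \<Longrightarrow> Q f \<Longrightarrow> Q g \<Longrightarrow> Q (f \<oplus>\<^bsub>J\<^esub> g)"
    and mult: "\<And>f g. f \<in> carrier J \<Longrightarrow> g \<in> carrier J \<Longrightarrow> Q f \<Longrightarrow> Q g \<Longrightarrow> Q (f \<otimes>\<^bsub>J\<^esub> g)"
    and p: "\<And>f. f \<in> carrier J \<Longrightarrow> Q ([p] \<cdot>\<^bsub>J\<^esub> f)"
  shows "Q F"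
proof -
  have poly: "Q (toJ f)" if "f \<in> carrier JP" for f
  proof (rule toJ_induct[where I = UNIV])
    show "f \<in> supported R {e \<in> jet_exps. Poly_Mapping.keys e \<subseteq> UNIV}" using that by (simp add: JP_supp)
    fix f g assume fg: "f \<in> carrier JP" "g \<in> carrier JP" "Q (toJ f)" "Q (toJ g)"
    show "Q (toJ (f + g))" "Q (toJ (f * g))"
      using add[OF _ _ fg(3,4)] mult[OF _ _ fg(3,4)] ring_hom_closed[OF toJ_hom] fg(1,2)
        ring_hom_add[OF toJ_hom fg(1,2)] ring_hom_mult[OF toJ_hom fg(1,2)] by (auto simp: JP_ops)
  qed (use const var inv in \<open>auto simp: jR_def jX_def jXi_def\<close>)
  obtain f where f: "f \<in> carrier JP" "pcong p J 1 F (toJ f)"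
    using JP.completion_approx F unfolding jet_algebra_def to_jet_def by blast
  then obtain c where c: "c \<in> carrier J" "F = toJ f \<oplus>\<^bsub>J\<^esub> [p] \<cdot>\<^bsub>J\<^esub> c" unfolding pcong_def by auto
  then show ?thesis using add[of "toJ f" "[p] \<cdot>\<^bsub>J\<^esub> c"] poly f p ring_hom_closed[OF toJ_hom] by auto
qed

text \<open>The value at the inverse of x is forced by the value at x, and passage to the limit is
  automatic by \<open>completion_hom_unique\<close>.\<close>

lemma J_hom_unique:
  assumes C: "cring C" and h: "h \<in> ring_hom J (p_completion p C)" and h': "h' \<in> ring_hom J (p_completion p C)"
    and const: "\<And>r. r \<in> R \<Longrightarrow> h (jR r) = h' (jR r)" and var: "\<And>i. h (jX i) = h' (jX i)" and F: "F \<in> carrier J"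
  shows "h F = h' F"
proof -
  interpret C: cring C by fact
  note CC = C.completion_cring[of p]
  have "h (toJ f) = h' (toJ f)" if "f \<in> carrier JP" for f
  proof (rule toJ_induct[where I = UNIV])
    show "f \<in> supported R {e \<in> jet_exps. Poly_Mapping.keys e \<subseteq> UNIV}" using that by (simp add: JP_supp)
    fix f g assume fg: "f \<in> carrier JP" "g \<in> carrier JP" "h (toJ f) = h' (toJ f)" "h (toJ g) = h' (toJ g)"
    note c = ring_hom_closed[OF toJ_hom fg(1)] ring_hom_closed[OF toJ_hom fg(2)]
    show "h (toJ (f + g)) = h' (toJ (f + g))" "h (toJ (f * g)) = h' (toJ (f * g))"
      using ring_hom_add[OF toJ_hom fg(1,2)] ring_hom_mult[OF toJ_hom fg(1,2)] fg(3,4)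
        ring_hom_add[OF h c] ring_hom_mult[OF h c] ring_hom_add[OF h' c] ring_hom_mult[OF h' c] by (simp_all add: JP_ops)
  next
    have "h (jX 0) \<otimes>\<^bsub>p_completion p C\<^esub> h' jXi = \<one>\<^bsub>p_completion p C\<^esub>"
      using ring_hom_mult[OF h', of "jX 0" jXi] ring_hom_one[OF h'] var[of 0] by (simp add: jX_inv)
    then show "h (toJ jet_inv) = h' (toJ jet_inv)"
      using ring_hom_inverse[OF J_cring CC h _ _ jX_inv, of "h' jXi"] ring_hom_closed[OF h'] by (simp add: jXi_def[symmetric])
  qed (use const var in \<open>auto simp: jR_def jX_def\<close>)
  then show ?thesis
    using completion_hom_unique[OF JP_cring C, of h p h' F] h h' F unfolding jet_algebra_def to_jet_def by simp
qed

text \<open>The universal property of the jet algebra among completed rings: coordinates take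
  arbitrary values, subject to that of x being invertible.\<close>

lemma J_hom_exists:
  assumes C: "cring C" and h: "h \<in> ring_hom \<O> (p_completion p C)"
    and v: "\<And>i. v i \<in> carrier (p_completion p C)" and w: "w \<in> carrier (p_completion p C)"
    and vw: "v 0 \<otimes>\<^bsub>p_completion p C\<^esub> w = \<one>\<^bsub>p_completion p C\<^esub>"
  shows "\<exists>g. g \<in> ring_hom J (p_completion p C) \<and> (\<forall>r\<in>R. g (jR r) = h r) \<and> (\<forall>i. g (jX i) = v i)"
proof -
  interpret C: cring C by fact
  interpret CC: cring "p_completion p C" by (rule C.completion_cring)
  interpret jet_eval "p_completion p C" R h v w
    using cring_O h v w vw by unfold_locales
  interpret e: completion_hom p JP C jev
    using JP_cring C jev_hom by unfold_locales
  show ?thesis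
  proof (intro exI conjI ballI allI)
    show "compl_ext jev \<in> ring_hom J (p_completion p C)" using e.ext_hom unfolding jet_algebra_def .
    show "compl_ext jev (jR r) = h r" if "r \<in> R" for r
      using e.ext_to_completion[OF JP_mem(1)[OF that]] jev_const[OF that] by (simp add: jR_def to_jet_def)
    show "compl_ext jev (jX i) = v i" for i
      using e.ext_to_completion[OF JP_mem(2)] jev_var by (simp add: jX_def to_jet_def)
  qed
qed

lemma toJ_frob: "toJ (jet_var i ^ p + of_nat p * jet_var (Suc i)) = jX i [^]\<^bsub>J\<^esub> p \<oplus>\<^bsub>J\<^esub> [p] \<cdot>\<^bsub>J\<^esub> jX (Suc i)"
proof -
  have "toJ (jet_var i ^ p + of_nat p * jet_var (Suc i)) =
      toJ (jet_var i [^]\<^bsub>JP\<^esub> p \<oplus>\<^bsub>JP\<^esub> [p] \<cdot>\<^bsub>JP\<^esub> jet_var (Suc i))" by (simp add: JP_ops)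
  then show ?thesis
    using ring_hom_add[OF toJ_hom, of "jet_var i [^]\<^bsub>JP\<^esub> p" "[p] \<cdot>\<^bsub>JP\<^esub> jet_var (Suc i)"]
      ring_hom_pow'[OF JP_cring J_cring toJ_hom JP_mem(2), of i p] ring_hom_nmult[OF JP_cring J_cring toJ_hom JP_mem(2), of p "Suc i"]
    by (simp add: jX_def JP_mem)
qed

abbreviation "fJ \<equiv> jet_frob p R \<phi>"

lemma fJ:
  shows "fJ \<in> ring_hom J J" "r \<in> R \<Longrightarrow> fJ (jR r) = jR (\<phi> r)"
    "fJ (jX i) = jX i [^]\<^bsub>J\<^esub> p \<oplus>\<^bsub>J\<^esub> [p] \<cdot>\<^bsub>J\<^esub> jX (Suc i)"
proof -
  let ?v = "\<lambda>i. jX i [^]\<^bsub>J\<^esub> p \<oplus>\<^bsub>J\<^esub> [p] \<cdot>\<^bsub>J\<^esub> jX (Suc i)"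
  let ?P = "\<lambda>\<psi>. \<psi> \<in> ring_hom J J \<inter> extensional (carrier J) \<and>
        (\<forall>r\<in>R. \<psi> (toJ (jet_const r)) = toJ (jet_const (\<phi> r))) \<and>
        (\<forall>i. \<psi> (toJ (jet_var i)) = toJ (jet_var i ^ p + of_nat p * jet_var (Suc i)))"
  have Peq: "?P \<psi> \<longleftrightarrow> \<psi> \<in> ring_hom J J \<inter> extensional (carrier J) \<and> (\<forall>r\<in>R. \<psi> (jR r) = jR (\<phi> r)) \<and> (\<forall>i. \<psi> (jX i) = ?v i)" for \<psi>
    by (simp only: toJ_frob jR_def[symmetric] jX_def[symmetric])
  \<comment> \<open>\<phi>(x) must be invertible for the evaluation to exist. It is x^p (1 + p t)
    with t = x' / x^p, and the second factor is a unit by completeness.\<close>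
  let ?t = "jX 1 \<otimes>\<^bsub>J\<^esub> jXi [^]\<^bsub>J\<^esub> p"
  obtain w where w: "w \<in> carrier J" "(\<one>\<^bsub>J\<^esub> \<oplus>\<^bsub>J\<^esub> [p] \<cdot>\<^bsub>J\<^esub> ?t) \<otimes>\<^bsub>J\<^esub> w = \<one>\<^bsub>J\<^esub>"
    using JP.completion_unit[of ?t p] unfolding jet_algebra_def[symmetric] by auto
  have "jX 0 [^]\<^bsub>J\<^esub> p \<otimes>\<^bsub>J\<^esub> ?t = jX 1"
    using jX_inv_pow[of p] J.m_lcomm[of "jX 0 [^]\<^bsub>J\<^esub> p" "jX 1" "jXi [^]\<^bsub>J\<^esub> p"] by simp
  then have v0: "?v 0 = jX 0 [^]\<^bsub>J\<^esub> p \<otimes>\<^bsub>J\<^esub> (\<one>\<^bsub>J\<^esub> \<oplus>\<^bsub>J\<^esub> [p] \<cdot>\<^bsub>J\<^esub> ?t)"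
    by (simp add: J.r_distr J.nmult_r)
  let ?u = "\<one>\<^bsub>J\<^esub> \<oplus>\<^bsub>J\<^esub> [p] \<cdot>\<^bsub>J\<^esub> ?t"
  have uc: "?u \<in> carrier J" by simp
  have "?v 0 \<otimes>\<^bsub>J\<^esub> (jXi [^]\<^bsub>J\<^esub> p \<otimes>\<^bsub>J\<^esub> w) = (jX 0 [^]\<^bsub>J\<^esub> p \<otimes>\<^bsub>J\<^esub> jXi [^]\<^bsub>J\<^esub> p) \<otimes>\<^bsub>J\<^esub> (?u \<otimes>\<^bsub>J\<^esub> w)"
    unfolding v0 using w(1) uc J.m_assoc J.m_lcomm[of ?u "jXi [^]\<^bsub>J\<^esub> p" w] by simp
  then have "?v 0 \<otimes>\<^bsub>J\<^esub> (jXi [^]\<^bsub>J\<^esub> p \<otimes>\<^bsub>J\<^esub> w) = \<one>\<^bsub>J\<^esub>" using w jX_inv_pow by simp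
  moreover have "(\<lambda>r. jR (\<phi> r)) \<in> ring_hom \<O> J"
    using ring_hom_trans[OF phi_hom jR_hom] by (simp add: comp_def)
  ultimately obtain g where g: "g \<in> ring_hom J J" "\<And>r. r \<in> R \<Longrightarrow> g (jR r) = jR (\<phi> r)" "\<And>i. g (jX i) = ?v i"
    using J_hom_exists[OF JP_cring, of "\<lambda>r. jR (\<phi> r)" ?v "jXi [^]\<^bsub>J\<^esub> p \<otimes>\<^bsub>J\<^esub> w"] w(1)
    unfolding jet_algebra_def[symmetric] by auto
  have ex: "?P (restrict g (carrier J))"
    unfolding Peq using ring_hom_restrict'[OF J_cring g(1)] g by simp
  have "\<exists>!\<psi>. ?P \<psi>"
  proof (rule ex1I[of _ "restrict g (carrier J)"])
    show "?P (restrict g (carrier J))" by (rule ex)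
    fix \<psi> assume P: "?P \<psi>"
    have "\<psi> F = restrict g (carrier J) F" if "F \<in> carrier J" for F
      using P ex J_hom_unique[OF JP_cring, of \<psi> "restrict g (carrier J)", OF _ _ _ _ that]
      unfolding Peq jet_algebra_def[symmetric] by simp
    then show "\<psi> = restrict g (carrier J)" using P by (intro extensionalityI[of _ "carrier J"]) auto
  qed
  from theI'[OF this] have "?P fJ" unfolding jet_frob_def .
  then show "fJ \<in> ring_hom J J" "r \<in> R \<Longrightarrow> fJ (jR r) = jR (\<phi> r)" "fJ (jX i) = ?v i"
    unfolding Peq by auto
qed

lemma fJ_frob: "F \<in> carrier J \<Longrightarrow> pcong p J 1 (fJ F) (F [^]\<^bsub>J\<^esub> p)"
proof (induction F rule: J_induct)
  case (const r)
  have "pcong p J 1 (jR (\<phi> r)) (jR (r ^ p))" by (rule pcong_hom[OF cring_O J_cring jR_hom phi_frob[OF const]])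
  then show ?case using fJ(2)[OF const] ring_hom_pow'[OF cring_O J_cring jR_hom, of r p] const by simp
next
  case (var i)
  then show ?case unfolding fJ(3) using J.pcongI[of "jX i [^]\<^bsub>J\<^esub> p" "jX (Suc i)" p 1] by simp
next
  case inv
  have c: "fJ jXi \<in> carrier J" "fJ (jX 0) \<in> carrier J" using ring_hom_closed[OF fJ(1)] by auto
  have i: "fJ jXi \<otimes>\<^bsub>J\<^esub> fJ (jX 0) = \<one>\<^bsub>J\<^esub>"
    using ring_hom_mult[OF fJ(1), of "jX 0" jXi] ring_hom_one[OF fJ(1)] c by (simp add: jX_inv J.m_comm)
  have "pcong p J 1 (fJ (jX 0)) (jX 0 [^]\<^bsub>J\<^esub> p)" unfolding fJ(3) using J.pcongI[of "jX 0 [^]\<^bsub>J\<^esub> p" "jX 1" p 1] by simp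
  \<comment> \<open>The congruence for the inverse follows by multiplying that for x with
    \<phi>(1/x) and with the p-th power of 1/x.\<close>
  from J.pcong_mult[OF J.pcong_refl[of "fJ jXi"] J.pcong_mult[OF this J.pcong_refl[of "jXi [^]\<^bsub>J\<^esub> p"]]] c
  have "pcong p J 1 (fJ jXi \<otimes>\<^bsub>J\<^esub> (fJ (jX 0) \<otimes>\<^bsub>J\<^esub> jXi [^]\<^bsub>J\<^esub> p)) (fJ jXi \<otimes>\<^bsub>J\<^esub> (jX 0 [^]\<^bsub>J\<^esub> p \<otimes>\<^bsub>J\<^esub> jXi [^]\<^bsub>J\<^esub> p))" by simp
  moreover have "fJ jXi \<otimes>\<^bsub>J\<^esub> (fJ (jX 0) \<otimes>\<^bsub>J\<^esub> jXi [^]\<^bsub>J\<^esub> p) = jXi [^]\<^bsub>J\<^esub> p"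
    using c i by (simp add: J.m_assoc[symmetric])
  ultimately show ?case using c by (simp add: jX_inv_pow J.pcong_sym)
next
  case (add f g)
  have "pcong p J 1 (fJ f \<oplus>\<^bsub>J\<^esub> fJ g) (f [^]\<^bsub>J\<^esub> p \<oplus>\<^bsub>J\<^esub> g [^]\<^bsub>J\<^esub> p)" using add by (intro J.pcong_add)
  then show ?case using J.pcong_sym[OF J.pcong_frobenius_add[OF p(1) add(1,2)]] J.pcong_trans ring_hom_add[OF fJ(1) add(1,2)] by metis
next
  case (mult f g)
  then show ?case using J.pcong_mult[OF mult(3,4)] by (simp add: ring_hom_mult[OF fJ(1)] J.nat_pow_distrib)
next
  case (p f)
  have "pcong p J 1 ([p] \<cdot>\<^bsub>J\<^esub> fJ f) \<zero>\<^bsub>J\<^esub>" using J.pcong_p_zero[of "fJ f" p 1] ring_hom_closed[OF fJ(1) p] by simp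
  moreover have "pcong p J 1 (([p] \<cdot>\<^bsub>J\<^esub> f) [^]\<^bsub>J\<^esub> p) (\<zero>\<^bsub>J\<^esub> [^]\<^bsub>J\<^esub> p)"
    using J.pcong_pow[OF J.pcong_p_zero[OF p, of p 1]] by simp
  then have "pcong p J 1 (([p] \<cdot>\<^bsub>J\<^esub> f) [^]\<^bsub>J\<^esub> p) \<zero>\<^bsub>J\<^esub>" using p_gt J.nat_pow_zero[of p] by simp
  ultimately show ?case using J.pcong_sym J.pcong_trans ring_hom_nmult[OF J_cring J_cring fJ(1) p] by metis
qed

abbreviation "dJ \<equiv> jet_delta p R \<phi>"

text \<open>Existence of the quotient is the Frobenius congruence \<open>fJ_frob\<close>, uniqueness
  is absence of p-torsion; together they replace the description by an equation.\<close>

lemma dJ: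
  assumes F: "F \<in> carrier J"
  shows "dJ F \<in> carrier J" "fJ F = F [^]\<^bsub>J\<^esub> p \<oplus>\<^bsub>J\<^esub> [p] \<cdot>\<^bsub>J\<^esub> dJ F"
    "G \<in> carrier J \<Longrightarrow> fJ F = F [^]\<^bsub>J\<^esub> p \<oplus>\<^bsub>J\<^esub> [p] \<cdot>\<^bsub>J\<^esub> G \<Longrightarrow> dJ F = G"
proof -
  let ?P = "\<lambda>G. G \<in> carrier J \<and> [p] \<cdot>\<^bsub>J\<^esub> G = fJ F \<ominus>\<^bsub>J\<^esub> F [^]\<^bsub>J\<^esub> p"
  have fc: "fJ F \<in> carrier J" using ring_hom_closed[OF fJ(1) F] .
  have eq: "?P G \<longleftrightarrow> G \<in> carrier J \<and> fJ F = F [^]\<^bsub>J\<^esub> p \<oplus>\<^bsub>J\<^esub> [p] \<cdot>\<^bsub>J\<^esub> G" for G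
  proof -
    have "a = b \<oplus>\<^bsub>J\<^esub> c \<longleftrightarrow> c = a \<ominus>\<^bsub>J\<^esub> b" if "a \<in> carrier J" "b \<in> carrier J" "c \<in> carrier J" for a b c
      using that J.a_lcomm[of b c "\<ominus>\<^bsub>J\<^esub> b"] by (auto simp: a_minus_def J.a_ac J.r_neg1 J.r_neg2 J.r_neg J.l_neg)
    from this[OF fc, of "F [^]\<^bsub>J\<^esub> p" "[p] \<cdot>\<^bsub>J\<^esub> G"] show ?thesis using F by auto
  qed
  obtain G0 where G: "G0 \<in> carrier J" "fJ F = F [^]\<^bsub>J\<^esub> p \<oplus>\<^bsub>J\<^esub> [p] \<cdot>\<^bsub>J\<^esub> G0"
    using fJ_frob[OF F] unfolding pcong_def by auto
  have ex: "\<exists>!G. ?P G"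
  proof (rule ex1I[of _ G0])
    show "?P G0" using G eq by blast
    fix H assume H: "?P H"
    have "?P G0" using G eq by blast
    then show "H = G0" using H J_p_cancel[of H G0] by simp
  qed
  have dd: "dJ F = (THE G. ?P G)" unfolding jet_delta_def p_derivation_def ..
  from theI'[OF ex] have "?P (dJ F)" unfolding dd .
  then show "dJ F \<in> carrier J" "fJ F = F [^]\<^bsub>J\<^esub> p \<oplus>\<^bsub>J\<^esub> [p] \<cdot>\<^bsub>J\<^esub> dJ F" using eq by auto
  show "dJ F = G" if "G \<in> carrier J" "fJ F = F [^]\<^bsub>J\<^esub> p \<oplus>\<^bsub>J\<^esub> [p] \<cdot>\<^bsub>J\<^esub> G"
    unfolding dd by (rule the1_equality[OF ex]) (use that eq in blast)
qed

lemma dJ_jX: "dJ (jX i) = jX (Suc i)"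
  by (rule dJ(3)) (simp_all add: fJ(3))

end

section \<open>The jet map of the p-power homomorphism\<close>

locale base_map = base +
  fixes u :: "'a jet_poly \<Rightarrow> 'a jet_poly"
  assumes u_hom: "u \<in> ring_hom (laurent_ring R) (laurent_ring R)"
    and u_const: "\<And>r. r \<in> R \<Longrightarrow> u (jet_const r) = jet_const r"
    and u_var: "u (jet_var 0) = jet_var 0 ^ p"
begin

abbreviation "uJ \<equiv> jet_map p R \<phi> u"

text \<open>The forced values of the jet map: x^(i) is \<delta> applied i times to x, so its image
  is \<delta> applied i times to x^p.\<close>

definition dX :: "nat \<Rightarrow> nat \<Rightarrow> 'a jet_poly set" where "dX i = (dJ ^^ i) (jX 0 [^]\<^bsub>J\<^esub> p)"

lemma dX_closed [simp]: "dX i \<in> carrier J"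
  by (induction i) (auto simp: dX_def dJ)

lemma laurent_sub: "carrier (laurent_ring R) \<subseteq> carrier JP"
  unfolding laurent_ring_eq JP_supp by (auto simp: supported_def jet_exps_def)

lemma laurent_ops: "x \<otimes>\<^bsub>laurent_ring R\<^esub> y = x * y" "x \<oplus>\<^bsub>laurent_ring R\<^esub> y = x + y" "\<one>\<^bsub>laurent_ring R\<^esub> = 1"
  by (simp_all add: laurent_ring_eq)

lemma laurent_mem: "r \<in> R \<Longrightarrow> jet_const r \<in> carrier (laurent_ring R)"
    "jet_var 0 \<in> carrier (laurent_ring R)" "jet_inv \<in> carrier (laurent_ring R)"
  unfolding laurent_ring_eq
  by (auto simp: jet_const_def jet_var_def jet_inv_def supported_def lookup_single when_def R_closed lookup_one)

text \<open>The map is constructed by values on coordinates, and \<phi>-compatibility is proved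
  before \<delta>-compatibility: the former can be tested on generators by
  \<open>J_hom_unique\<close>, whereas \<delta> is not additive.\<close>

lemma uJ:
  shows "uJ \<in> ring_hom J J" "r \<in> R \<Longrightarrow> uJ (jR r) = jR r" "uJ (jX i) = dX i"
    "F \<in> carrier J \<Longrightarrow> uJ (fJ F) = fJ (uJ F)"
proof -
  let ?P = "\<lambda>v. v \<in> ring_hom J J \<inter> extensional (carrier J) \<and>
        (\<forall>b\<in>carrier (laurent_ring R). v (toJ b) = toJ (u b)) \<and>
        (\<forall>F\<in>carrier J. v (dJ F) = dJ (v F))"
  have "dX 0 \<otimes>\<^bsub>J\<^esub> jXi [^]\<^bsub>J\<^esub> p = \<one>\<^bsub>J\<^esub>" by (simp add: dX_def jX_inv_pow)
  then obtain g where g: "g \<in> ring_hom J J" "\<And>r. r \<in> R \<Longrightarrow> g (jR r) = jR r" "\<And>i. g (jX i) = dX i"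
    using J_hom_exists[OF JP_cring, of jR dX "jXi [^]\<^bsub>J\<^esub> p"] jR_hom
    unfolding jet_algebra_def[symmetric] by auto
  have comm: "g (fJ F) = fJ (g F)" if "F \<in> carrier J" for F
  proof -
    have "(g \<circ> fJ) F = (fJ \<circ> g) F"
    proof (rule J_hom_unique[OF JP_cring, where h = "g \<circ> fJ" and h' = "fJ \<circ> g", folded jet_algebra_def])
      show "g \<circ> fJ \<in> ring_hom J J" "fJ \<circ> g \<in> ring_hom J J" using ring_hom_trans fJ(1) g(1) by blast+
      show "(g \<circ> fJ) (jR r) = (fJ \<circ> g) (jR r)" if "r \<in> R" for r
        using that g(2) fJ(2) ring_hom_closed[OF phi_hom] by simp
      \<comment> \<open>Both sides are \<phi> of \<open>dX i\<close>; the left one is expanded by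
        the equation defining \<delta>.\<close>
      show "(g \<circ> fJ) (jX i) = (fJ \<circ> g) (jX i)" for i
        using dJ(2)[OF dX_closed, of i] by (simp add: fJ(3) ring_hom_add[OF g(1)] g(3) ring_hom_pow'[OF J_cring J_cring g(1)]
            ring_hom_nmult[OF J_cring J_cring g(1)]) (simp add: dX_def)
    qed (rule that)
    then show ?thesis by simp
  qed
  have gd: "g (dJ F) = dJ (g F)" if F: "F \<in> carrier J" for F
  proof (rule dJ(3)[symmetric])
    show "g F \<in> carrier J" "g (dJ F) \<in> carrier J" using ring_hom_closed[OF g(1)] F dJ(1) by auto
    have "fJ (g F) = g (F [^]\<^bsub>J\<^esub> p \<oplus>\<^bsub>J\<^esub> [p] \<cdot>\<^bsub>J\<^esub> dJ F)" using comm[OF F] dJ(2)[OF F] by simp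
    then show "fJ (g F) = g F [^]\<^bsub>J\<^esub> p \<oplus>\<^bsub>J\<^esub> [p] \<cdot>\<^bsub>J\<^esub> g (dJ F)"
      using F dJ(1)[OF F] by (simp add: ring_hom_add[OF g(1)] ring_hom_pow'[OF J_cring J_cring g(1)]
            ring_hom_nmult[OF J_cring J_cring g(1)])
  qed
  have gu: "g (toJ b) = toJ (u b)" if b: "b \<in> carrier (laurent_ring R)" for b
  proof -
    have L: "b \<in> supported R {e \<in> jet_exps. Poly_Mapping.keys e \<subseteq> {0}}"
    proof -
      have "Poly_Mapping.keys e \<subseteq> {0}" if "\<forall>i\<ge>1. poly_mapping.lookup e i = 0" for e :: "nat \<Rightarrow>\<^sub>0 int"
        using that by (fastforce simp: in_keys_iff Suc_le_eq)
      then show ?thesis using b unfolding laurent_ring_eq by (auto simp: supported_def jet_exps_def subset_iff)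
    qed
    let ?L = "carrier (laurent_ring R)"
    note Lmem = laurent_mem
    have Lring: "f + g \<in> ?L" "f * g \<in> ?L" if "f \<in> ?L" "g \<in> ?L" for f g
    proof -
      have fg: "f \<in> carrier JP" "g \<in> carrier JP" using that laurent_sub by auto
      then have "f + g \<in> carrier JP" "f * g \<in> carrier JP"
        using JP.a_closed[of f g] JP.m_closed[of f g] by (auto simp: JP_ops)
      moreover have "\<forall>i\<ge>1. poly_mapping.lookup e i = 0" if "e \<in> Poly_Mapping.keys (f + g)" for e
      proof -
        have "e \<in> Poly_Mapping.keys f \<or> e \<in> Poly_Mapping.keys g" using that keys_add[of f g] by blast
        then show ?thesis using \<open>f \<in> ?L\<close> \<open>g \<in> ?L\<close> unfolding laurent_ring_eq supported_def by (auto simp: subset_iff)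
      qed
      moreover have "\<forall>i\<ge>1. poly_mapping.lookup e i = 0" if e: "e \<in> Poly_Mapping.keys (f * g)" for e
      proof -
        obtain a b where "e = a + b" "a \<in> Poly_Mapping.keys f" "b \<in> Poly_Mapping.keys g"
          using e keys_mult[of f g] by blast
        then show ?thesis using \<open>f \<in> ?L\<close> \<open>g \<in> ?L\<close> unfolding laurent_ring_eq supported_def by (auto simp: lookup_add subset_iff)
      qed
      ultimately show "f + g \<in> ?L" "f * g \<in> ?L" unfolding laurent_ring_eq JP_supp supported_def by auto
    qed
    have "b \<in> ?L \<and> g (toJ b) = toJ (u b)"
      using L
    proof (rule jet_generation[OF _ R_closed(1,2)])
      fix f h assume fh: "f \<in> ?L \<and> g (toJ f) = toJ (u f)" "h \<in> ?L \<and> g (toJ h) = toJ (u h)"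
      then have c: "f \<in> ?L" "h \<in> ?L" "f \<in> carrier JP" "h \<in> carrier JP" "u f \<in> carrier JP" "u h \<in> carrier JP"
        using laurent_sub ring_hom_closed[OF u_hom] by auto
      note t = ring_hom_closed[OF toJ_hom]
      show "f + h \<in> ?L \<and> g (toJ (f + h)) = toJ (u (f + h))"
        using fh c Lring(1)[OF c(1,2)] ring_hom_add[OF toJ_hom c(3,4)] ring_hom_add[OF toJ_hom c(5,6)] ring_hom_add[OF u_hom c(1,2)]
          ring_hom_add[OF g(1) t[OF c(3)] t[OF c(4)]] by (simp add: JP_ops laurent_ops)
      show "f * h \<in> ?L \<and> g (toJ (f * h)) = toJ (u (f * h))"
        using fh c Lring(2)[OF c(1,2)] ring_hom_mult[OF toJ_hom c(3,4)] ring_hom_mult[OF toJ_hom c(5,6)] ring_hom_mult[OF u_hom c(1,2)]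
          ring_hom_mult[OF g(1) t[OF c(3)] t[OF c(4)]] by (simp add: JP_ops laurent_ops)
    next
      show "jet_const r \<in> ?L \<and> g (toJ (jet_const r)) = toJ (u (jet_const r))" if "r \<in> R" for r
        using g(2)[OF that] u_const[OF that] Lmem that by (simp add: jR_def)
      show "jet_var i \<in> ?L \<and> g (toJ (jet_var i)) = toJ (u (jet_var i))" if "i \<in> {0}" for i
        using that g(3)[of 0] Lmem(2) ring_hom_pow'[OF JP_cring J_cring toJ_hom JP_mem(2), of 0 p]
        by (simp add: jX_def dX_def u_var JP_ops)
      have ui: "u jet_inv \<in> carrier JP" using ring_hom_closed[OF u_hom Lmem(3)] laurent_sub by blast
      have "u (jet_var 0) * u jet_inv = 1"
        using ring_hom_mult[OF u_hom Lmem(2,3)] ring_hom_one[OF u_hom] by (simp add: laurent_ops jet_inv_var)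
      then have "toJ (u (jet_var 0)) \<otimes>\<^bsub>J\<^esub> toJ (u jet_inv) = \<one>\<^bsub>J\<^esub>"
        using ring_hom_mult[OF toJ_hom _ ui, of "u (jet_var 0)"] ring_hom_one[OF toJ_hom] ring_hom_closed[OF u_hom Lmem(2)] laurent_sub
        by (auto simp: JP_ops)
      moreover have "toJ (u (jet_var 0)) = g (jX 0)"
        using g(3)[of 0] ring_hom_pow'[OF JP_cring J_cring toJ_hom JP_mem(2), of 0 p]
        by (simp add: jX_def dX_def u_var JP_ops)
      ultimately have "g jXi = toJ (u jet_inv)"
        using ring_hom_inverse[OF J_cring J_cring g(1) _ _ jX_inv, of "toJ (u jet_inv)"] ring_hom_closed[OF toJ_hom ui] by simp
      then show "jet_inv \<in> ?L \<and> g (toJ jet_inv) = toJ (u jet_inv)" using Lmem(3) by (simp add: jXi_def)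
    qed
    then show ?thesis by blast
  qed
  have toJL: "toJ b \<in> carrier J" if "b \<in> carrier (laurent_ring R)" for b
    using that laurent_sub ring_hom_closed[OF toJ_hom] by blast
  have ex: "?P (restrict g (carrier J))"
    using ring_hom_restrict'[OF J_cring g(1)] gu gd dJ(1) toJL ring_hom_closed[OF g(1)] by simp
  \<comment> \<open>Compatibility with \<delta> carries the value at x on to each x^(i+1) =
    \<delta>(x^(i)), so agreement with u on the Laurent ring determines v.\<close>
  have char: "v (jR r) = jR r \<and> v (jX i) = dX i" if P: "?P v" and r: "r \<in> R" for v r i
  proof -
    have "v (jR r) = jR r" "v (jX 0) = dX 0"
      using laurent_mem(1)[OF r] laurent_mem(2) P r u_const[OF r] u_var ring_hom_pow'[OF JP_cring J_cring toJ_hom JP_mem(2), of 0 p]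
      by (simp_all add: jR_def jX_def dX_def JP_ops)
    moreover have "v (jX i) = dX i" for i
    proof (induction i)
      case (Suc i)
      have "v (jX (Suc i)) = v (dJ (jX i))" by (simp add: dJ_jX)
      also have "\<dots> = dJ (v (jX i))" using P by simp
      finally show ?case using Suc by (simp add: dX_def)
    qed (rule calculation(2))
    ultimately show ?thesis by blast
  qed
  have uniq: "\<exists>!v. ?P v"
  proof (rule ex1I[of _ "restrict g (carrier J)"])
    show "?P (restrict g (carrier J))" by (rule ex)
    fix v assume P: "?P v"
    have "v F = restrict g (carrier J) F" if "F \<in> carrier J" for F
    proof (rule J_hom_unique[OF JP_cring, where h = v and h' = "restrict g (carrier J)", folded jet_algebra_def])
      show "v \<in> ring_hom J J" using P by blast
      show "restrict g (carrier J) \<in> ring_hom J J" by (rule ring_hom_restrict'[OF J_cring g(1)])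
      show "v (jR r) = restrict g (carrier J) (jR r)" if "r \<in> R" for r
        using conjunct1[OF char[OF P that]] g(2)[OF that] that by simp
      show "v (jX i) = restrict g (carrier J) (jX i)" for i
        using conjunct2[OF char[OF P R_closed(1)]] g(3) by simp
    qed (rule that)
    then show "v = restrict g (carrier J)" using P by (intro extensionalityI[of _ "carrier J"]) auto
  qed
  have eq: "uJ = restrict g (carrier J)" unfolding jet_map_def using the1_equality[OF uniq, of "restrict g (carrier J)", OF ex] .
  show "uJ \<in> ring_hom J J" unfolding eq by (rule ring_hom_restrict'[OF J_cring g(1)])
  show "r \<in> R \<Longrightarrow> uJ (jR r) = jR r" "uJ (jX i) = dX i" unfolding eq using g by auto
  show "uJ (fJ F) = fJ (uJ F)" if "F \<in> carrier J"
    unfolding eq using comm[OF that] that ring_hom_closed[OF fJ(1) that] by simp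
qed

sublocale FH: frobenius_hom J p fJ uJ
  by unfold_locales (fact p fJ(1) uJ(1) fJ_frob J_torsion_free uJ(4))+

lemma image_mod_p:
  assumes "F \<in> carrier J"
  shows "\<exists>n. \<exists>w\<in>carrier J. pcong p J 1 ((fJ ^^ n) F) (uJ w)"
proof -
  have u0: "uJ (jX 0) = jX 0 [^]\<^bsub>J\<^esub> p" by (simp add: uJ(3) dX_def)
  note x = FH.near_image_unit_image[OF j_closed(2,3) jX_inv u0]
  have var: "FH.near_image N (jX i)" for N i
  proof (induction i arbitrary: N)
    case 0 show ?case by (rule x(1))
  next
    case (Suc i) show ?case by (rule FH.near_image_delta[OF Suc]) (simp_all add: fJ(3))
  qed
  have "FH.near_image 1 F" using assms
  proof (induction F rule: J_induct)
    case (const r) then show ?case using FH.near_image_u[of "jR r" 1] uJ(2) by simp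
  next
    case (p f)
    \<comment> \<open>Level 0 is an empty condition; multiplication by p lifts it to level
      1.\<close>
    have "FH.near_image 0 f" using p uJ(1) ring_hom_closed[OF uJ(1) p] by (intro FH.near_imageI[of f f 0 0]) auto
    from FH.near_image_p[OF this] show ?case by simp
  qed (use var x(2) FH.near_image_add FH.near_image_mult in auto)
  then show ?thesis unfolding FH.near_image_def by blast
qed

text \<open>Raising \<phi>(x) \<equiv> x^p to the p-th power improves the congruence from p to p^2,
  so one factor p survives the division in \<delta>(x^p).\<close>

lemma uJ_var_1: "pcong p J 1 (uJ (jX 1)) \<zero>\<^bsub>J\<^esub>"
proof -
  let ?y = "jX 0 [^]\<^bsub>J\<^esub> p"
  have "pcong p J 1 (fJ (jX 0)) ?y" using fJ_frob by simp
  from J.pcong_pow_p[OF p(1) this[unfolded One_nat_def]]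
  have "pcong p J 2 (fJ ?y) (?y [^]\<^bsub>J\<^esub> p)"
    by (simp add: ring_hom_pow'[OF J_cring J_cring fJ(1)] numeral_2_eq_2)
  then obtain c where c: "c \<in> carrier J" "fJ ?y = ?y [^]\<^bsub>J\<^esub> p \<oplus>\<^bsub>J\<^esub> [(p ^ 2)] \<cdot>\<^bsub>J\<^esub> c" unfolding pcong_def by auto
  then have "dJ ?y = [p] \<cdot>\<^bsub>J\<^esub> c"
    by (intro dJ(3)) (simp_all add: J.nmult_nmult power2_eq_square)
  then show ?thesis using J.pcong_p_zero[OF c(1), of p 1] by (simp add: uJ(3) dX_def)
qed

end

section \<open>Quotients and tensor products\<close>

lemma (in cring) coset_eq_iff:
  assumes "ideal I R" "a \<in> carrier R" "b \<in> carrier R"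
  shows "I +> a = I +> b \<longleftrightarrow> a \<ominus> b \<in> I"
  using quotient_eq_iff_same_a_r_cos[OF assms] by simp

lemma (in cring) mem_coset:
  assumes "ideal I R" "a \<in> carrier R" "b \<in> I +> a"
  shows "b \<in> carrier R" "I +> b = I +> a"
proof -
  interpret I: ideal I R by fact
  show "b \<in> carrier R" using I.a_elemrcos_carrier[OF assms(2,3)] .
  show "I +> b = I +> a" using a_repr_independence[OF assms(3,2) I.a_subgroup] by simp
qed

lemma (in cring) coset_map_hom:
  assumes I: "ideal I R" and h: "h \<in> ring_hom R R" and hI: "\<And>z. z \<in> I \<Longrightarrow> h z \<in> I"
  shows "z \<in> carrier R \<Longrightarrow> coset_map R I h (I +> z) = I +> h z"
    and "coset_map R I h \<in> ring_hom (R Quot I) (R Quot I)"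
proof -
  interpret I: ideal I R by (rule I)
  note hc = ring_hom_closed[OF h]
  show val: "coset_map R I h (I +> z) = I +> h z" if z: "z \<in> carrier R" for z
  proof -
    have "I +> h y = I +> h z" if y: "y \<in> I +> z" for y
    proof -
      note m = mem_coset[OF I z y]
      then have "y \<ominus> z \<in> I" using coset_eq_iff[OF I] z by simp
      then have "h y \<ominus> h z \<in> I" using hI ring_hom_minus[OF cring_axioms cring_axioms h m(1) z] by metis
      then show ?thesis using coset_eq_iff[OF I] hc z m by simp
    qed
    moreover have "z \<in> I +> z" using I.a_rcos_self z by simp
    ultimately show ?thesis unfolding coset_map_def by blast
  qed
  have q: "(+>) I \<in> ring_hom R (R Quot I)" by (rule I.rcos_ring_hom)
  have rep: "\<exists>z\<in>carrier R. U = I +> z" if "U \<in> carrier (R Quot I)" for U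
    using that by (auto simp: FactRing_def A_RCOSETS_def')
  show "coset_map R I h \<in> ring_hom (R Quot I) (R Quot I)"
  proof (rule ring_hom_memI)
    fix U V assume UV: "U \<in> carrier (R Quot I)" "V \<in> carrier (R Quot I)"
    obtain y z where yz: "y \<in> carrier R" "U = I +> y" "z \<in> carrier R" "V = I +> z" using rep UV by metis
    show "coset_map R I h (U \<otimes>\<^bsub>R Quot I\<^esub> V) = coset_map R I h U \<otimes>\<^bsub>R Quot I\<^esub> coset_map R I h V"
      using yz hc by (simp add: ring_hom_mult[OF q, symmetric] val ring_hom_mult[OF h])
    show "coset_map R I h (U \<oplus>\<^bsub>R Quot I\<^esub> V) = coset_map R I h U \<oplus>\<^bsub>R Quot I\<^esub> coset_map R I h V"
      using yz hc by (simp add: ring_hom_add[OF q, symmetric] val ring_hom_add[OF h])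
  next
    fix U assume "U \<in> carrier (R Quot I)"
    then obtain z where "z \<in> carrier R" "U = I +> z" using rep by blast
    then show "coset_map R I h U \<in> carrier (R Quot I)" using val hc ring_hom_closed[OF q] by simp
  next
    show "coset_map R I h \<one>\<^bsub>R Quot I\<^esub> = \<one>\<^bsub>R Quot I\<^esub>"
      using ring_hom_one[OF q] val[OF one_closed] ring_hom_one[OF h] by simp
  qed
qed

text \<open>In the product of formal tensors the right factor sits inside the function being
  extended; distributivity on that side is additivity of \<open>frag_extend\<close> in its
  function.\<close>

lemma frag_extend_fun_diff:
  fixes f g :: "'b \<Rightarrow> 'a \<Rightarrow>\<^sub>0 int"
  shows "frag_extend (\<lambda>x. f x - g x) c = frag_extend f c - frag_extend g c"
proof -
  have "frag_cmul k (a - b) = frag_cmul k a - frag_cmul k b" for k and a b :: "'a \<Rightarrow>\<^sub>0 int"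
    by (rule poly_mapping_eqI) (simp add: lookup_minus right_diff_distrib)
  then show ?thesis by (simp add: frag_extend_def sum_subtractf)
qed

locale tensor =
  fixes S :: "'s set" and \<alpha> :: "'s \<Rightarrow> 'a" and \<gamma> :: "'s \<Rightarrow> 'c"
    and A :: "('a, 'm) ring_scheme" and C :: "('c, 'n) ring_scheme"
  assumes A: "cring A" and C: "cring C"
    and \<alpha>: "\<And>s. s \<in> S \<Longrightarrow> \<alpha> s \<in> carrier A" and \<gamma>: "\<And>s. s \<in> S \<Longrightarrow> \<gamma> s \<in> carrier C"
begin

sublocale A: cring A by (rule A)
sublocale C: cring C by (rule C)

abbreviation "FT \<equiv> formal_tensors A C"
abbreviation "TI \<equiv> tensor_ideal S \<alpha> \<gamma> A C"
abbreviation "TR \<equiv> tensor_ring S \<alpha> \<gamma> A C"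

lemma FT_simps: "carrier FT = {z. Poly_Mapping.keys z \<subseteq> carrier A \<times> carrier C}"
  "z \<otimes>\<^bsub>FT\<^esub> w = frag_extend (\<lambda>(a, c). frag_extend (\<lambda>(a', c'). frag_of (a \<otimes>\<^bsub>A\<^esub> a', c \<otimes>\<^bsub>C\<^esub> c')) w) z"
  "z \<oplus>\<^bsub>FT\<^esub> w = z + w" "\<one>\<^bsub>FT\<^esub> = frag_of (\<one>\<^bsub>A\<^esub>, \<one>\<^bsub>C\<^esub>)" "\<zero>\<^bsub>FT\<^esub> = 0"
  by (auto simp: formal_tensors_def)

lemma FT_of [simp]: "frag_of (a, c) \<otimes>\<^bsub>FT\<^esub> frag_of (a', c') = frag_of (a \<otimes>\<^bsub>A\<^esub> a', c \<otimes>\<^bsub>C\<^esub> c')"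
  by (simp add: FT_simps)

lemma FT_diff_l: "(z - z') \<otimes>\<^bsub>FT\<^esub> w = z \<otimes>\<^bsub>FT\<^esub> w - z' \<otimes>\<^bsub>FT\<^esub> w"
  by (simp add: FT_simps frag_extend_diff)

lemma FT_diff_r: "z \<otimes>\<^bsub>FT\<^esub> (w - w') = z \<otimes>\<^bsub>FT\<^esub> w - z \<otimes>\<^bsub>FT\<^esub> w'"
  by (simp add: FT_simps frag_extend_diff case_prod_unfold frag_extend_fun_diff)

lemma FT_0 [simp]: "0 \<otimes>\<^bsub>FT\<^esub> w = 0" "w \<otimes>\<^bsub>FT\<^esub> 0 = 0"
  using FT_diff_l[of 0 0 w] FT_diff_r[of w 0 0] by auto

text \<open>Free abelian groups come with an induction by differences. Bilinearity is therefore
  stated with subtraction, and each ring law reduces to pairs \<open>frag_of (a, c)\<close>.\<close>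

lemma FT_induct [consumes 1, case_names zero one diff]:
  assumes "z \<in> carrier FT" "P 0" "\<And>a c. a \<in> carrier A \<Longrightarrow> c \<in> carrier C \<Longrightarrow> P (frag_of (a, c))"
    "\<And>a b. P a \<Longrightarrow> P b \<Longrightarrow> P (a - b)"
  shows "P z"
proof -
  have "Poly_Mapping.keys z \<subseteq> carrier A \<times> carrier C" using assms(1) by (simp add: FT_simps)
  then show ?thesis by (induction z rule: frag_induction) (use assms(2-4) in auto)
qed

lemma FT_mem: "0 \<in> carrier FT" "a \<in> carrier A \<Longrightarrow> c \<in> carrier C \<Longrightarrow> frag_of (a, c) \<in> carrier FT"
  "z \<in> carrier FT \<Longrightarrow> w \<in> carrier FT \<Longrightarrow> z - w \<in> carrier FT"
  "z \<in> carrier FT \<Longrightarrow> w \<in> carrier FT \<Longrightarrow> z + w \<in> carrier FT"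
  using keys_diff[of z w] keys_add[of z w] by (auto simp: FT_simps)

lemma FT_closed:
  assumes "z \<in> carrier FT" "w \<in> carrier FT" shows "z \<otimes>\<^bsub>FT\<^esub> w \<in> carrier FT"
  using assms(1)
proof (induction z rule: FT_induct)
  case (one a c)
  show ?case using assms(2)
    by (induction w rule: FT_induct) (use one in \<open>simp_all add: FT_mem FT_diff_r\<close>)
qed (simp_all add: FT_mem FT_diff_l)

lemma FT_comm:
  assumes "z \<in> carrier FT" "w \<in> carrier FT" shows "z \<otimes>\<^bsub>FT\<^esub> w = w \<otimes>\<^bsub>FT\<^esub> z"
  using assms(1)
proof (induction z rule: FT_induct)
  case (one a c)
  show ?case using assms(2)
    by (induction w rule: FT_induct) (use one in \<open>simp_all add: FT_diff_r FT_diff_l A.m_comm C.m_comm\<close>)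
qed (simp_all add: FT_diff_l FT_diff_r)

lemma FT_assoc:
  assumes "x \<in> carrier FT" "y \<in> carrier FT" "z \<in> carrier FT"
  shows "(x \<otimes>\<^bsub>FT\<^esub> y) \<otimes>\<^bsub>FT\<^esub> z = x \<otimes>\<^bsub>FT\<^esub> (y \<otimes>\<^bsub>FT\<^esub> z)"
  using assms(1)
proof (induction x rule: FT_induct)
  case (one a c)
  note ac = one
  show ?case using assms(2)
  proof (induction y rule: FT_induct)
    case (one a' c')
    show ?case using assms(3)
      by (induction z rule: FT_induct) (use one ac in \<open>simp_all add: FT_diff_r FT_diff_l A.m_assoc C.m_assoc\<close>)
  qed (simp_all add: FT_diff_l FT_diff_r)
qed (simp_all add: FT_diff_l FT_diff_r)

lemma FT_one:
  assumes "z \<in> carrier FT" shows "\<one>\<^bsub>FT\<^esub> \<otimes>\<^bsub>FT\<^esub> z = z"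
  using assms
proof (induction z rule: FT_induct)
  case (one a c)
  then show ?case by (simp add: FT_simps(4))
qed (simp_all add: FT_diff_r)

lemma FT_cring: "cring FT"
proof (rule cringI)
  show "abelian_group FT"
  proof (rule abelian_groupI)
    fix x assume "x \<in> carrier FT"
    then show "\<exists>y\<in>carrier FT. y \<oplus>\<^bsub>FT\<^esub> x = \<zero>\<^bsub>FT\<^esub>"
      using FT_mem(3)[OF FT_mem(1), of x] by (intro bexI[of _ "0 - x"]) (simp_all add: FT_simps)
  qed (auto simp: FT_mem FT_simps(3,5) add_ac)
  show "Group.comm_monoid FT"
    by (intro comm_monoidI FT_closed FT_assoc FT_one FT_comm) (auto simp: FT_simps(1,4))
  fix x y z
  have "(x - (0 - y)) \<otimes>\<^bsub>FT\<^esub> z = x \<otimes>\<^bsub>FT\<^esub> z - (0 - y \<otimes>\<^bsub>FT\<^esub> z)" unfolding FT_diff_l by simp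
  then show "(x \<oplus>\<^bsub>FT\<^esub> y) \<otimes>\<^bsub>FT\<^esub> z = x \<otimes>\<^bsub>FT\<^esub> z \<oplus>\<^bsub>FT\<^esub> y \<otimes>\<^bsub>FT\<^esub> z" by (simp add: FT_simps(3))
qed

sublocale FT: cring FT by (rule FT_cring)

lemma FT_minus: "z \<in> carrier FT \<Longrightarrow> w \<in> carrier FT \<Longrightarrow> z \<ominus>\<^bsub>FT\<^esub> w = z - w"
proof -
  assume zw: "z \<in> carrier FT" "w \<in> carrier FT"
  have "\<ominus>\<^bsub>FT\<^esub> w = 0 - w" by (rule FT.minus_equality) (use zw FT_mem(3)[OF FT_mem(1) zw(2)] in \<open>simp_all add: FT_simps(3,5)\<close>)
  then show ?thesis by (simp add: a_minus_def FT_simps(3))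
qed

lemma relationsI:
  "a \<in> carrier A \<Longrightarrow> a' \<in> carrier A \<Longrightarrow> c \<in> carrier C \<Longrightarrow>
    frag_of (a \<oplus>\<^bsub>A\<^esub> a', c) - frag_of (a, c) - frag_of (a', c) \<in> tensor_relations S \<alpha> \<gamma> A C"
  "a \<in> carrier A \<Longrightarrow> c \<in> carrier C \<Longrightarrow> c' \<in> carrier C \<Longrightarrow>
    frag_of (a, c \<oplus>\<^bsub>C\<^esub> c') - frag_of (a, c) - frag_of (a, c') \<in> tensor_relations S \<alpha> \<gamma> A C"
  "s \<in> S \<Longrightarrow> a \<in> carrier A \<Longrightarrow> c \<in> carrier C \<Longrightarrow>
    frag_of (\<alpha> s \<otimes>\<^bsub>A\<^esub> a, c) - frag_of (a, \<gamma> s \<otimes>\<^bsub>C\<^esub> c) \<in> tensor_relations S \<alpha> \<gamma> A C"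
  unfolding tensor_relations_def by blast+

lemma relationsE:
  assumes "x \<in> tensor_relations S \<alpha> \<gamma> A C"
  obtains (left) a a' c where "x = frag_of (a \<oplus>\<^bsub>A\<^esub> a', c) - frag_of (a, c) - frag_of (a', c)"
      "a \<in> carrier A" "a' \<in> carrier A" "c \<in> carrier C"
    | (right) a c c' where "x = frag_of (a, c \<oplus>\<^bsub>C\<^esub> c') - frag_of (a, c) - frag_of (a, c')"
      "a \<in> carrier A" "c \<in> carrier C" "c' \<in> carrier C"
    | (scalar) s a c where "x = frag_of (\<alpha> s \<otimes>\<^bsub>A\<^esub> a, c) - frag_of (a, \<gamma> s \<otimes>\<^bsub>C\<^esub> c)"
      "s \<in> S" "a \<in> carrier A" "c \<in> carrier C"
  using assms unfolding tensor_relations_def Un_iff mem_Collect_eq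
  apply (elim disjE exE conjE)
  subgoal by (rule left; assumption)
  subgoal by (rule right; assumption)
  subgoal by (rule scalar; assumption)
  done

lemma relations_mem: "tensor_relations S \<alpha> \<gamma> A C \<subseteq> carrier FT"
proof
  fix x assume "x \<in> tensor_relations S \<alpha> \<gamma> A C"
  then show "x \<in> carrier FT"
    by (cases rule: relationsE) (simp_all add: FT_mem \<alpha> \<gamma>)
qed

lemma TI_ideal: "ideal TI FT"
  unfolding tensor_ideal_def by (rule FT.genideal_ideal[OF relations_mem])

lemma relations_TI: "x \<in> tensor_relations S \<alpha> \<gamma> A C \<Longrightarrow> x \<in> TI"
  unfolding tensor_ideal_def using FT.genideal_self[OF relations_mem] by blast

lemma TI_minimal: "ideal I FT \<Longrightarrow> tensor_relations S \<alpha> \<gamma> A C \<subseteq> I \<Longrightarrow> TI \<subseteq> I"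
  unfolding tensor_ideal_def by (rule FT.genideal_minimal)

lemma TR_cring: "cring TR"
  unfolding tensor_ring_def by (rule ideal.quotient_is_cring[OF TI_ideal FT_cring])

sublocale TR: cring TR by (rule TR_cring)

lemma quot_hom: "(+>\<^bsub>FT\<^esub>) TI \<in> ring_hom FT TR"
  unfolding tensor_ring_def by (rule ideal.rcos_ring_hom[OF TI_ideal])

definition tens :: "'a \<Rightarrow> 'c \<Rightarrow> ('a \<times> 'c \<Rightarrow>\<^sub>0 int) set" where "tens a c = TI +>\<^bsub>FT\<^esub> frag_of (a, c)"

lemma tens_closed [simp]: "a \<in> carrier A \<Longrightarrow> c \<in> carrier C \<Longrightarrow> tens a c \<in> carrier TR"
  unfolding tens_def using ring_hom_closed[OF quot_hom] FT_mem by blast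

lemma tens_mult: "a \<in> carrier A \<Longrightarrow> c \<in> carrier C \<Longrightarrow> a' \<in> carrier A \<Longrightarrow> c' \<in> carrier C \<Longrightarrow>
    tens a c \<otimes>\<^bsub>TR\<^esub> tens a' c' = tens (a \<otimes>\<^bsub>A\<^esub> a') (c \<otimes>\<^bsub>C\<^esub> c')"
  unfolding tens_def using ring_hom_mult[OF quot_hom, of "frag_of (a, c)" "frag_of (a', c')"] FT_mem by simp

lemma tens_one: "\<one>\<^bsub>TR\<^esub> = tens \<one>\<^bsub>A\<^esub> \<one>\<^bsub>C\<^esub>"
  unfolding tens_def using ring_hom_one[OF quot_hom] by (simp add: FT_simps)

lemma tens_pow: "a \<in> carrier A \<Longrightarrow> c \<in> carrier C \<Longrightarrow>
    tens a c [^]\<^bsub>TR\<^esub> (n::nat) = tens (a [^]\<^bsub>A\<^esub> n) (c [^]\<^bsub>C\<^esub> n)"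
  by (induction n) (simp_all add: tens_one tens_mult)

lemma tens_add:
  assumes "a \<in> carrier A" "a' \<in> carrier A" "c \<in> carrier C"
  shows "tens (a \<oplus>\<^bsub>A\<^esub> a') c = tens a c \<oplus>\<^bsub>TR\<^esub> tens a' c"
proof -
  let ?x = "frag_of (a \<oplus>\<^bsub>A\<^esub> a', c)" and ?y = "frag_of (a, c)" and ?z = "frag_of (a', c)"
  have m: "?x \<in> carrier FT" "?y \<in> carrier FT" "?z \<in> carrier FT" using assms FT_mem by auto
  have "?x - ?y - ?z \<in> TI" using relations_TI[OF relationsI(1)[OF assms]] .
  then have "?x \<ominus>\<^bsub>FT\<^esub> (?y \<oplus>\<^bsub>FT\<^esub> ?z) \<in> TI"
    using FT_minus[OF m(1) FT.a_closed[OF m(2,3)]] by (simp add: FT_simps(3) diff_diff_add)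
  then have "TI +>\<^bsub>FT\<^esub> ?x = TI +>\<^bsub>FT\<^esub> (?y \<oplus>\<^bsub>FT\<^esub> ?z)"
    using FT.coset_eq_iff[OF TI_ideal m(1) FT.a_closed[OF m(2,3)]] by blast
  then show ?thesis unfolding tens_def using ring_hom_add[OF quot_hom m(2,3)] by simp
qed

lemma tens_nmult:
  assumes "a \<in> carrier A" "c \<in> carrier C"
  shows "tens ([(k::nat)] \<cdot>\<^bsub>A\<^esub> a) c = [k] \<cdot>\<^bsub>TR\<^esub> tens a c"
proof (induction k)
  case 0
  have "tens \<zero>\<^bsub>A\<^esub> c \<oplus>\<^bsub>TR\<^esub> tens \<zero>\<^bsub>A\<^esub> c = tens \<zero>\<^bsub>A\<^esub> c" using tens_add[of "\<zero>\<^bsub>A\<^esub>" "\<zero>\<^bsub>A\<^esub>" c] assms by simp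
  then show ?case using assms TR.add.l_cancel_one[of "tens \<zero>\<^bsub>A\<^esub> c" "tens \<zero>\<^bsub>A\<^esub> c"] by simp
next
  case (Suc k)
  then show ?case using assms by (simp add: A.nmult_Suc TR.nmult_Suc tens_add)
qed

lemma tens_pcong:
  assumes "pcong p A n a b" "c \<in> carrier C" shows "pcong p TR n (tens a c) (tens b c)"
proof -
  obtain x where "x \<in> carrier A" "a = b \<oplus>\<^bsub>A\<^esub> [(p ^ n)] \<cdot>\<^bsub>A\<^esub> x" "b \<in> carrier A" using assms unfolding pcong_def by auto
  then show ?thesis using assms(2) by (simp add: tens_add tens_nmult TR.pcongI)
qed

lemma TR_induct [consumes 1, case_names tens minus]:
  assumes "U \<in> carrier TR" "\<And>a c. a \<in> carrier A \<Longrightarrow> c \<in> carrier C \<Longrightarrow> P (tens a c)"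
    "\<And>U V. U \<in> carrier TR \<Longrightarrow> V \<in> carrier TR \<Longrightarrow> P U \<Longrightarrow> P V \<Longrightarrow> P (U \<ominus>\<^bsub>TR\<^esub> V)"
  shows "P U"
proof -
  have zero: "P \<zero>\<^bsub>TR\<^esub>"
    using assms(3)[OF _ _ assms(2)[OF A.one_closed C.one_closed] assms(2)[OF A.one_closed C.one_closed]]
    by (simp add: a_minus_def TR.r_neg)
  obtain z where z: "z \<in> carrier FT" "U = TI +>\<^bsub>FT\<^esub> z"
    using assms(1) unfolding tensor_ring_def by (auto simp: FactRing_def A_RCOSETS_def')
  have "z \<in> carrier FT \<and> P (TI +>\<^bsub>FT\<^esub> z)" using z(1)
  proof (induction z rule: FT_induct)
    case zero
    have "TI +>\<^bsub>FT\<^esub> 0 = \<zero>\<^bsub>TR\<^esub>"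
      using ring_hom_zero[OF quot_hom FT.ring_axioms TR.ring_axioms] by (simp add: FT_simps(5))
    then show ?case using \<open>P \<zero>\<^bsub>TR\<^esub>\<close> FT_mem by simp
  next
    case (one a c)
    then show ?case using assms(2)[OF one] FT_mem by (simp add: tens_def)
  next
    case (diff a b)
    then show ?case
      using assms(3)[of "TI +>\<^bsub>FT\<^esub> a" "TI +>\<^bsub>FT\<^esub> b"] ring_hom_closed[OF quot_hom] FT_mem(3)[of a b]
        ring_hom_minus[OF FT_cring TR_cring quot_hom, of a b] FT_minus[of a b] by simp
  qed
  then show ?thesis using z by blast
qed

text \<open>The maps are only semilinear: \<sigma> records their common effect on scalars, which is
  \<phi> for \<Phi> and the identity for the jet map. A scalar relation for s goes to the one for
  \<sigma>(s).\<close>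

lemma tensor_map_hom:
  assumes f: "f \<in> ring_hom A A" and g: "g \<in> ring_hom C C"
    and \<sigma>: "\<And>s. s \<in> S \<Longrightarrow> \<sigma> s \<in> S \<and> f (\<alpha> s) = \<alpha> (\<sigma> s) \<and> g (\<gamma> s) = \<gamma> (\<sigma> s)"
  shows "tensor_map S \<alpha> \<gamma> A C f g \<in> ring_hom TR TR"
    and "a \<in> carrier A \<Longrightarrow> c \<in> carrier C \<Longrightarrow> tensor_map S \<alpha> \<gamma> A C f g (tens a c) = tens (f a) (g c)"
proof -
  let ?h = "frag_extend (\<lambda>(a, c). frag_of (f a, g c))"
  note fc = ring_hom_closed[OF f] and gc = ring_hom_closed[OF g]
  have hm: "?h z \<in> carrier FT" if "z \<in> carrier FT" for z
    using that by (induction z rule: FT_induct) (simp_all add: FT_mem fc gc frag_extend_diff)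
  have hmult: "?h (z \<otimes>\<^bsub>FT\<^esub> w) = ?h z \<otimes>\<^bsub>FT\<^esub> ?h w" if "z \<in> carrier FT" "w \<in> carrier FT" for z w
    using that(1)
  proof (induction z rule: FT_induct)
    case (one a c)
    show ?case using that(2)
      by (induction w rule: FT_induct)
        (use one in \<open>simp_all add: FT_diff_r frag_extend_diff ring_hom_mult[OF f] ring_hom_mult[OF g]\<close>)
  qed (simp_all add: FT_diff_l frag_extend_diff)
  have h: "?h \<in> ring_hom FT FT"
    by (rule ring_hom_memI)
      (simp_all add: hm hmult, simp_all add: FT_simps(3,4) frag_extend_add ring_hom_one[OF f] ring_hom_one[OF g])
  have hr: "ring_hom_ring FT FT ?h"
    by (rule ring_hom_ringI2[OF FT.ring_axioms FT.ring_axioms h])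
  \<comment> \<open>The preimage of the relation ideal is an ideal, so it is enough that it contains
    the generating relations.\<close>
  have "TI \<subseteq> {r \<in> carrier FT. ?h r \<in> TI}"
  proof (rule TI_minimal)
    show "ideal {r \<in> carrier FT. ?h r \<in> TI} FT" by (rule ring_hom_ring.ideal_vimage[OF hr TI_ideal])
    show "tensor_relations S \<alpha> \<gamma> A C \<subseteq> {r \<in> carrier FT. ?h r \<in> TI}"
    proof
      fix x assume x: "x \<in> tensor_relations S \<alpha> \<gamma> A C"
      have "?h x \<in> tensor_relations S \<alpha> \<gamma> A C"
        using x
      proof (cases rule: relationsE)
        case (left a a' c)
        then show ?thesis using relationsI(1)[of "f a" "f a'" "g c"] fc gc
          by (simp add: frag_extend_diff ring_hom_add[OF f])
      next
        case (right a c c')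
        then show ?thesis using relationsI(2)[of "f a" "g c" "g c'"] fc gc
          by (simp add: frag_extend_diff ring_hom_add[OF g])
      next
        case (scalar s a c)
        then show ?thesis using relationsI(3)[of "\<sigma> s" "f a" "g c"] fc gc \<sigma>[OF scalar(2)] \<alpha> \<gamma>
          by (simp add: frag_extend_diff ring_hom_mult[OF f] ring_hom_mult[OF g])
      qed
      then show "x \<in> {r \<in> carrier FT. ?h r \<in> TI}" using relations_TI subsetD[OF relations_mem x] by simp
    qed
  qed
  then have hI: "\<And>z. z \<in> TI \<Longrightarrow> ?h z \<in> TI" by blast
  show "tensor_map S \<alpha> \<gamma> A C f g \<in> ring_hom TR TR"
    unfolding tensor_map_def tensor_ring_def by (rule FT.coset_map_hom(2)[OF TI_ideal h hI])
  show "tensor_map S \<alpha> \<gamma> A C f g (tens a c) = tens (f a) (g c)" if "a \<in> carrier A" "c \<in> carrier C"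
    using FT.coset_map_hom(1)[OF TI_ideal h hI FT_mem(2)[OF that]] unfolding tensor_map_def tens_def by simp
qed

text \<open>Needed for the evaluation to \<bbbK>\<degree> only. The additive extension is
  multiplicative on generators, and its kernel is an ideal containing the relations.\<close>

lemma tensor_hom_exists:
  assumes D: "cring D" and f: "f \<in> ring_hom A D" and g: "g \<in> ring_hom C D"
    and fg: "\<And>s. s \<in> S \<Longrightarrow> f (\<alpha> s) = g (\<gamma> s)"
  shows "\<exists>\<Theta>\<in>ring_hom TR D. \<forall>a\<in>carrier A. \<forall>c\<in>carrier C. \<Theta> (tens a c) = f a \<otimes>\<^bsub>D\<^esub> g c"
proof -
  interpret D: cring D by (rule D)
  note fc = ring_hom_closed[OF f] and gc = ring_hom_closed[OF g]
  define T where "T = (\<lambda>(a, c) (n::int). [n] \<cdot>\<^bsub>D\<^esub> (f a \<otimes>\<^bsub>D\<^esub> g c))"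
  interpret L: linear_extension D UNIV "carrier A \<times> carrier C" T
    by unfold_locales (auto simp: T_def fc gc D.add.int_pow_mult add_pow_int_ge[of 0])
  define H where "H = lin_ext D T"
  have supp: "z \<in> supported UNIV (carrier A \<times> carrier C) \<longleftrightarrow> z \<in> carrier FT" for z
    by (simp add: supported_def FT_simps)
  have Hc: "H z \<in> carrier D" if "z \<in> carrier FT" for z using L.lin_ext_closed that supp H_def by simp
  have Hadd: "H (z + w) = H z \<oplus>\<^bsub>D\<^esub> H w" if "z \<in> carrier FT" "w \<in> carrier FT" for z w
    using L.lin_ext_add that supp H_def by simp
  have Hdiff: "H (z - w) = H z \<ominus>\<^bsub>D\<^esub> H w" if "z \<in> carrier FT" "w \<in> carrier FT" for z w
  proof -
    have "H z = H (z - w) \<oplus>\<^bsub>D\<^esub> H w" using Hadd[of "z - w" w] that FT_mem(3) by simp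
    then show ?thesis using that Hc FT_mem(3)[OF that] by (simp add: a_minus_def D.a_assoc D.r_neg)
  qed
  have Hof: "H (frag_of (a, c)) = f a \<otimes>\<^bsub>D\<^esub> g c" if "a \<in> carrier A" "c \<in> carrier C" for a c
    unfolding H_def using that fc gc by (subst L.lin_ext_single) (auto simp: T_def)
  have H0: "H 0 = \<zero>\<^bsub>D\<^esub>" by (simp add: H_def lin_ext_def)
  have Hmult: "z \<in> carrier FT \<and> H (z \<otimes>\<^bsub>FT\<^esub> w) = H z \<otimes>\<^bsub>D\<^esub> H w" if z: "z \<in> carrier FT" and w: "w \<in> carrier FT" for z w
    using z
  proof (induction z rule: FT_induct)
    case (one a c)
    have "w \<in> carrier FT \<and> H (frag_of (a, c) \<otimes>\<^bsub>FT\<^esub> w) = H (frag_of (a, c)) \<otimes>\<^bsub>D\<^esub> H w" using w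
    proof (induction w rule: FT_induct)
      case (one a' c')
      note fcs = fc[OF \<open>a \<in> carrier A\<close>] fc[OF one(1)] gc[OF \<open>c \<in> carrier C\<close>] gc[OF one(2)]
      show ?case using one \<open>a \<in> carrier A\<close> \<open>c \<in> carrier C\<close> fcs
        by (simp add: Hof FT_mem ring_hom_mult[OF f] ring_hom_mult[OF g] D.m_ac)
    next
      case (diff x y)
      then show ?case using one Hc FT_closed[OF FT_mem(2)[OF one]]
        by (simp add: FT_diff_r Hdiff FT_mem a_minus_def D.r_distr D.r_minus)
    qed (use one Hc FT_mem in \<open>simp_all add: H0 FT_mem\<close>)
    then show ?case using FT_mem one by simp
  next
    case (diff x y)
    then show ?case using w Hc FT_closed
      by (simp add: FT_diff_l Hdiff FT_mem a_minus_def D.l_distr D.l_minus)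
  qed (use w Hc in \<open>simp_all add: H0 FT_mem\<close>)
  note Hm = conjunct2[OF Hmult]
  have Hhom: "H \<in> ring_hom FT D"
  proof (rule ring_hom_memI)
    show "H \<one>\<^bsub>FT\<^esub> = \<one>\<^bsub>D\<^esub>" using ring_hom_one[OF f] ring_hom_one[OF g] by (simp add: FT_simps(4) Hof)
  qed (use Hc Hm Hadd in \<open>simp_all add: FT_simps(3)\<close>)
  have "ring_hom_ring FT D H"
    by (rule ring_hom_ringI2[OF FT.ring_axioms D.ring_axioms Hhom])
  note kernel_ideal = ring_hom_ring.kernel_is_ideal[OF this]
  have "TI \<subseteq> a_kernel FT D H"
  proof (rule TI_minimal[OF kernel_ideal])
    show "tensor_relations S \<alpha> \<gamma> A C \<subseteq> a_kernel FT D H"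
    proof
      fix x assume x: "x \<in> tensor_relations S \<alpha> \<gamma> A C"
      have "H x = \<zero>\<^bsub>D\<^esub>"
        using x
      proof (cases rule: relationsE)
        case x: (left a a' c)
        have "H x = (f a \<oplus>\<^bsub>D\<^esub> f a') \<otimes>\<^bsub>D\<^esub> g c \<ominus>\<^bsub>D\<^esub> f a \<otimes>\<^bsub>D\<^esub> g c \<ominus>\<^bsub>D\<^esub> f a' \<otimes>\<^bsub>D\<^esub> g c"
          using x by (simp add: Hdiff Hof FT_mem ring_hom_add[OF f])
        then show ?thesis using fc gc x by (simp add: D.l_distr a_minus_def D.a_ac D.r_neg D.r_neg1 D.r_neg2)
      next
        case x: (right a c c')
        have "H x = f a \<otimes>\<^bsub>D\<^esub> (g c \<oplus>\<^bsub>D\<^esub> g c') \<ominus>\<^bsub>D\<^esub> f a \<otimes>\<^bsub>D\<^esub> g c \<ominus>\<^bsub>D\<^esub> f a \<otimes>\<^bsub>D\<^esub> g c'"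
          using x by (simp add: Hdiff Hof FT_mem ring_hom_add[OF g])
        then show ?thesis using fc gc x by (simp add: D.r_distr a_minus_def D.a_ac D.r_neg D.r_neg1 D.r_neg2)
      next
        case x: (scalar s a c)
        have "H x = f (\<alpha> s) \<otimes>\<^bsub>D\<^esub> f a \<otimes>\<^bsub>D\<^esub> g c \<ominus>\<^bsub>D\<^esub> f a \<otimes>\<^bsub>D\<^esub> (f (\<alpha> s) \<otimes>\<^bsub>D\<^esub> g c)"
          using x \<alpha>[OF x(2)] \<gamma>[OF x(2)] fg[OF x(2)] by (simp add: Hdiff Hof FT_mem ring_hom_mult[OF f] ring_hom_mult[OF g])
        then show ?thesis using fc gc x \<alpha>[OF x(2)] by (simp add: D.m_ac a_minus_def D.r_neg)
      qed
      then show "x \<in> a_kernel FT D H" using subsetD[OF relations_mem x]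
        unfolding a_kernel_def' mem_Collect_eq by (rule conjI[rotated])
    qed
  qed
  then have TI0: "\<And>z. z \<in> TI \<Longrightarrow> H z = \<zero>\<^bsub>D\<^esub>" unfolding a_kernel_def' by blast
  have Hcos: "H ` (TI +>\<^bsub>FT\<^esub> z) = {H z}" if z: "z \<in> carrier FT" for z
  proof -
    have "H y = H z" if y: "y \<in> TI +>\<^bsub>FT\<^esub> z" for y
    proof -
      note m = FT.mem_coset[OF TI_ideal z y]
      then have "H (y \<ominus>\<^bsub>FT\<^esub> z) = \<zero>\<^bsub>D\<^esub>" using TI0 FT.coset_eq_iff[OF TI_ideal m(1) z] by simp
      then show ?thesis using ring_hom_minus[OF FT_cring D Hhom m(1) z] Hc m(1) z by simp
    qed
    moreover interpret TI: ideal TI FT by (rule TI_ideal)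
    have "z \<in> TI +>\<^bsub>FT\<^esub> z" using TI.a_rcos_self z by simp
    ultimately show ?thesis by blast
  qed
  \<comment> \<open>By \<open>Hcos\<close> the image of a coset under H is a singleton, so no
    representative has to be chosen.\<close>
  define \<Theta> where "\<Theta> U = the_elem (H ` U)" for U
  have Th: "\<Theta> (TI +>\<^bsub>FT\<^esub> z) = H z" if "z \<in> carrier FT" for z unfolding \<Theta>_def Hcos[OF that] by simp
  have rep: "\<exists>z\<in>carrier FT. U = TI +>\<^bsub>FT\<^esub> z" if "U \<in> carrier TR" for U
    using that unfolding tensor_ring_def by (auto simp: FactRing_def A_RCOSETS_def')
  have "\<Theta> \<in> ring_hom TR D"
  proof (rule ring_hom_memI)
    fix U V assume UV: "U \<in> carrier TR" "V \<in> carrier TR"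
    obtain y z where yz: "y \<in> carrier FT" "U = TI +>\<^bsub>FT\<^esub> y" "z \<in> carrier FT" "V = TI +>\<^bsub>FT\<^esub> z" using rep UV by metis
    show "\<Theta> (U \<otimes>\<^bsub>TR\<^esub> V) = \<Theta> U \<otimes>\<^bsub>D\<^esub> \<Theta> V"
      using yz by (simp add: ring_hom_mult[OF quot_hom, symmetric] Th Hm FT_closed)
    show "\<Theta> (U \<oplus>\<^bsub>TR\<^esub> V) = \<Theta> U \<oplus>\<^bsub>D\<^esub> \<Theta> V"
      using yz by (simp add: ring_hom_add[OF quot_hom, symmetric] Th ring_hom_add[OF Hhom])
  next
    fix U assume "U \<in> carrier TR"
    then obtain z where "z \<in> carrier FT" "U = TI +>\<^bsub>FT\<^esub> z" using rep by blast
    then show "\<Theta> U \<in> carrier D" using Th Hc by simp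
  next
    show "\<Theta> \<one>\<^bsub>TR\<^esub> = \<one>\<^bsub>D\<^esub>" using ring_hom_one[OF quot_hom] Th[OF FT.one_closed] ring_hom_one[OF Hhom] by simp
  qed
  moreover have "\<Theta> (tens a c) = f a \<otimes>\<^bsub>D\<^esub> g c" if "a \<in> carrier A" "c \<in> carrier C" for a c
    unfolding tens_def using Th[OF FT_mem(2)[OF that]] Hof[OF that] by simp
  ultimately show ?thesis by blast
qed

end

section \<open>Direct limits and localization\<close>

locale direct_limit =
  fixes A :: "('a, 'm) ring_scheme" (structure) and \<Phi> :: "'a \<Rightarrow> 'a"
  assumes A: "cring A" and Phi: "\<Phi> \<in> ring_hom A A"
begin

sublocale A: cring A by (rule A)

abbreviation "D \<equiv> dirlim A \<Phi>"
abbreviation "cls \<equiv> dirlim_class A \<Phi>"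

lemmas Phin = ring_hom_funpow[OF Phi]

lemmas Phin_ops [simp] = ring_hom_closed[OF Phin] ring_hom_add[OF Phin] ring_hom_mult[OF Phin] ring_hom_one[OF Phin]
  ring_hom_nmult[OF A A Phin] ring_hom_pow'[OF A A Phin] ring_hom_zero[OF Phin A.ring_axioms A.ring_axioms]

lemma rel_iff: "((n, a), (m, b)) \<in> dirlim_rel A \<Phi> \<longleftrightarrow> a \<in> carrier A \<and> b \<in> carrier A \<and>
    (\<exists>i j. n + i = m + j \<and> (\<Phi> ^^ i) a = (\<Phi> ^^ j) b)"
  by (simp add: dirlim_rel_def)

lemma rel_equiv: "equiv (UNIV \<times> carrier A) (dirlim_rel A \<Phi>)"
proof (rule equivI)
  show "dirlim_rel A \<Phi> \<subseteq> (UNIV \<times> carrier A) \<times> (UNIV \<times> carrier A)" by (auto simp: dirlim_rel_def)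
  show "refl_on (UNIV \<times> carrier A) (dirlim_rel A \<Phi>)"
    by (rule refl_onI) (auto simp: dirlim_rel_def)
  show "sym (dirlim_rel A \<Phi>)"
    by (rule symI) (auto simp: rel_iff, metis)
  show "trans (dirlim_rel A \<Phi>)"
  proof (rule transI)
    fix x y z assume xy: "(x, y) \<in> dirlim_rel A \<Phi>" and yz: "(y, z) \<in> dirlim_rel A \<Phi>"
    obtain n a m b l c where e: "x = (n, a)" "y = (m, b)" "z = (l, c)" by (metis surj_pair)
    obtain i j where ij: "n + i = m + j" "(\<Phi> ^^ i) a = (\<Phi> ^^ j) b" "a \<in> carrier A" using xy e rel_iff by auto
    obtain k q where kq: "m + k = l + q" "(\<Phi> ^^ k) b = (\<Phi> ^^ q) c" "c \<in> carrier A" using yz e rel_iff by auto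
    \<comment> \<open>The middle element is pushed to a stage common to both relations; this works
      because iterates of \<Phi> commute.\<close>
    have "(\<Phi> ^^ (k + i)) a = (\<Phi> ^^ k) ((\<Phi> ^^ j) b)" using ij by (simp add: funpow_add)
    also have "\<dots> = (\<Phi> ^^ j) ((\<Phi> ^^ k) b)" by (simp flip: funpow_add comp_apply[of "\<Phi> ^^ _" "\<Phi> ^^ _"] add: add.commute)
    also have "\<dots> = (\<Phi> ^^ (j + q)) c" using kq by (simp add: funpow_add)
    finally have "(\<Phi> ^^ (k + i)) a = (\<Phi> ^^ (j + q)) c" .
    moreover have "n + (k + i) = l + (j + q)" using ij kq by simp
    ultimately show "(x, z) \<in> dirlim_rel A \<Phi>" using ij kq e rel_iff by blast
  qed
qed

lemma cls_eq_iff: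
  assumes "a \<in> carrier A" "b \<in> carrier A"
  shows "cls n a = cls m b \<longleftrightarrow> (\<exists>i j. n + i = m + j \<and> (\<Phi> ^^ i) a = (\<Phi> ^^ j) b)"
  unfolding dirlim_class_def using equiv_class_eq_iff[OF rel_equiv, of "(n, a)" "(m, b)"] assms rel_iff
    eq_equiv_class_iff[OF rel_equiv, of "(n, a)" "(m, b)"] by auto

lemma cls_shift: "a \<in> carrier A \<Longrightarrow> cls n a = cls (n + k) ((\<Phi> ^^ k) a)"
  by (subst cls_eq_iff) (auto intro!: exI[of _ k] exI[of _ 0])

lemma mem_cls: "(m, b) \<in> cls n a \<Longrightarrow> a \<in> carrier A \<Longrightarrow> b \<in> carrier A \<and> cls m b = cls n a"
  unfolding dirlim_class_def using rel_iff equiv_class_eq[OF rel_equiv, of "(n, a)" "(m, b)"] by auto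

lemma cls_self: "a \<in> carrier A \<Longrightarrow> (n, a) \<in> cls n a"
  unfolding dirlim_class_def using equiv_class_self[OF rel_equiv, of "(n, a)"] by simp

lemma D_carrier: "U \<in> carrier D \<longleftrightarrow> (\<exists>n. \<exists>a\<in>carrier A. U = cls n a)"
  by (auto simp: dirlim_def dirlim_class_def quotient_def)

text \<open>Treats addition and multiplication together. The definition combines arbitrary
  representatives; once both classes are written at one stage l, the operation is that of the ring
  at stage l.\<close>

lemma cls_op:
  assumes op: "\<And>x y. x \<in> carrier A \<Longrightarrow> y \<in> carrier A \<Longrightarrow> f x y \<in> carrier A"
    "\<And>x y k. x \<in> carrier A \<Longrightarrow> y \<in> carrier A \<Longrightarrow> (\<Phi> ^^ k) (f x y) = f ((\<Phi> ^^ k) x) ((\<Phi> ^^ k) y)"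
    and a: "a \<in> carrier A" and b: "b \<in> carrier A"
  shows "(\<Union>(n, a)\<in>cls l a. \<Union>(m, b)\<in>cls l b. cls (n + m) (f ((\<Phi> ^^ m) a) ((\<Phi> ^^ n) b))) = cls l (f a b)"
proof -
  have "cls (n + m) (f ((\<Phi> ^^ m) a') ((\<Phi> ^^ n) b')) = cls l (f a b)"
    if a': "(n, a') \<in> cls l a" and b': "(m, b') \<in> cls l b" for n a' m b'
  proof -
    have ac: "a' \<in> carrier A" "b' \<in> carrier A" and ea: "cls n a' = cls l a" and eb: "cls m b' = cls l b"
      using mem_cls[OF a' a] mem_cls[OF b' b] by auto
    obtain i j where ij: "n + i = l + j" "(\<Phi> ^^ i) a' = (\<Phi> ^^ j) a" using ea cls_eq_iff ac a by blast
    obtain i' j' where ij': "m + i' = l + j'" "(\<Phi> ^^ i') b' = (\<Phi> ^^ j') b" using eb cls_eq_iff ac b by blast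
    have com: "(\<Phi> ^^ q) ((\<Phi> ^^ r) x) = (\<Phi> ^^ (q + r)) x" for q r x by (simp add: funpow_add)
    have 1: "(\<Phi> ^^ (i + i')) ((\<Phi> ^^ m) a') = (\<Phi> ^^ (l + j' + j)) a"
    proof -
      have "(\<Phi> ^^ (i + i')) ((\<Phi> ^^ m) a') = (\<Phi> ^^ (m + i')) ((\<Phi> ^^ i) a')" by (simp only: com add_ac)
      then show ?thesis unfolding ij(2) ij'(1) by (simp only: com)
    qed
    have 2: "(\<Phi> ^^ (i + i')) ((\<Phi> ^^ n) b') = (\<Phi> ^^ (l + j + j')) b"
    proof -
      have "(\<Phi> ^^ (i + i')) ((\<Phi> ^^ n) b') = (\<Phi> ^^ (n + i)) ((\<Phi> ^^ i') b')" by (simp only: com add_ac)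
      then show ?thesis unfolding ij'(2) ij(1) by (simp only: com)
    qed
    have "(\<Phi> ^^ (i + i')) (f ((\<Phi> ^^ m) a') ((\<Phi> ^^ n) b')) = (\<Phi> ^^ (l + j + j')) (f a b)"
      using ac a b 1 2 by (simp add: op(2) add_ac)
    moreover have "n + m + (i + i') = l + (l + j + j')" using ij ij' by simp
    moreover have "f ((\<Phi> ^^ m) a') ((\<Phi> ^^ n) b') \<in> carrier A" using op(1) ac by simp
    ultimately show ?thesis using cls_eq_iff[OF _ op(1)[OF a b], of "f ((\<Phi> ^^ m) a') ((\<Phi> ^^ n) b')" "n + m" l] by blast
  qed
  note eq = this
  have "(\<Union>(n, a)\<in>cls l a. \<Union>(m, b)\<in>cls l b. cls (n + m) (f ((\<Phi> ^^ m) a) ((\<Phi> ^^ n) b))) =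
      (\<Union>x\<in>cls l a. \<Union>y\<in>cls l b. cls l (f a b))"
    by (intro SUP_cong refl, simp only: split_paired_all prod.case, intro SUP_cong refl,
        simp only: split_paired_all prod.case eq)
  also have "\<dots> = cls l (f a b)" using cls_self[OF a, of l] cls_self[OF b, of l] by (simp add: SUP_constant) blast
  finally show ?thesis .
qed

lemma cls_mult: "a \<in> carrier A \<Longrightarrow> b \<in> carrier A \<Longrightarrow> cls n a \<otimes>\<^bsub>D\<^esub> cls n b = cls n (a \<otimes> b)"
  using cls_op[of "(\<otimes>)" a b n] by (simp add: dirlim_def)

lemma cls_add: "a \<in> carrier A \<Longrightarrow> b \<in> carrier A \<Longrightarrow> cls n a \<oplus>\<^bsub>D\<^esub> cls n b = cls n (a \<oplus> b)"
  using cls_op[of "(\<oplus>)" a b n] by (simp add: dirlim_def)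

lemma cls_one: "\<one>\<^bsub>D\<^esub> = cls n \<one>" using cls_shift[of \<one> 0 n] by (simp add: dirlim_def)
lemma cls_zero: "\<zero>\<^bsub>D\<^esub> = cls n \<zero>" using cls_shift[of \<zero> 0 n] by (simp add: dirlim_def)

lemma cls_closed [simp]: "a \<in> carrier A \<Longrightarrow> cls n a \<in> carrier D" using D_carrier by blast

lemma D_common2:
  assumes "U \<in> carrier D" "V \<in> carrier D"
  obtains n a b where "a \<in> carrier A" "b \<in> carrier A" "U = cls n a" "V = cls n b"
proof -
  obtain n a m b where ab: "a \<in> carrier A" "b \<in> carrier A" "U = cls n a" "V = cls m b" using assms D_carrier by auto
  then have "U = cls (n + m) ((\<Phi> ^^ m) a)" "V = cls (n + m) ((\<Phi> ^^ n) b)"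
    using cls_shift[of a n m] cls_shift[of b m n] by (auto simp: add.commute)
  then show ?thesis by (rule that[rotated 2]) (use ab in simp_all)
qed

lemma D_common3:
  assumes "U \<in> carrier D" "V \<in> carrier D" "W \<in> carrier D"
  obtains n a b c where "a \<in> carrier A" "b \<in> carrier A" "c \<in> carrier A" "U = cls n a" "V = cls n b" "W = cls n c"
proof -
  obtain n a b where ab: "a \<in> carrier A" "b \<in> carrier A" "U = cls n a" "V = cls n b" using D_common2[OF assms(1,2)] .
  obtain m c where c: "c \<in> carrier A" "W = cls m c" using assms D_carrier by auto
  have "U = cls (n + m) ((\<Phi> ^^ m) a)" "V = cls (n + m) ((\<Phi> ^^ m) b)" "W = cls (n + m) ((\<Phi> ^^ n) c)"
    using cls_shift[of a n m] cls_shift[of b n m] cls_shift[of c m n] ab c by (auto simp: add.commute)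
  then show ?thesis by (rule that[rotated 3]) (use ab c in simp_all)
qed

lemma D_cring: "cring D"
proof (rule cringI)
  show "abelian_group D"
  proof (rule abelian_groupI)
    fix x y assume xy: "x \<in> carrier D" "y \<in> carrier D"
    from D_common2[OF xy] obtain n a b where ab: "a \<in> carrier A" "b \<in> carrier A" "x = cls n a" "y = cls n b" .
    then show "x \<oplus>\<^bsub>D\<^esub> y \<in> carrier D" "x \<oplus>\<^bsub>D\<^esub> y = y \<oplus>\<^bsub>D\<^esub> x" by (simp_all add: cls_add A.a_comm)
    fix z assume z: "z \<in> carrier D"
    from D_common3[OF xy z] obtain n a b c where "a \<in> carrier A" "b \<in> carrier A" "c \<in> carrier A" "x = cls n a" "y = cls n b" "z = cls n c" .
    then show "x \<oplus>\<^bsub>D\<^esub> y \<oplus>\<^bsub>D\<^esub> z = x \<oplus>\<^bsub>D\<^esub> (y \<oplus>\<^bsub>D\<^esub> z)" by (simp add: cls_add A.a_assoc)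
  next
    fix x assume "x \<in> carrier D"
    then obtain n a where a: "a \<in> carrier A" "x = cls n a" using D_carrier by auto
    then show "\<zero>\<^bsub>D\<^esub> \<oplus>\<^bsub>D\<^esub> x = x" by (simp add: cls_zero[of n] cls_add)
    show "\<exists>y\<in>carrier D. y \<oplus>\<^bsub>D\<^esub> x = \<zero>\<^bsub>D\<^esub>"
      using a by (intro bexI[of _ "cls n (\<ominus> a)"]) (simp_all add: cls_zero[of n] cls_add A.l_neg)
  qed (simp add: cls_zero[of 0])
  show "Group.comm_monoid D"
  proof (rule comm_monoidI)
    fix x y assume xy: "x \<in> carrier D" "y \<in> carrier D"
    from D_common2[OF xy] obtain n a b where ab: "a \<in> carrier A" "b \<in> carrier A" "x = cls n a" "y = cls n b" .
    then show "x \<otimes>\<^bsub>D\<^esub> y \<in> carrier D" "x \<otimes>\<^bsub>D\<^esub> y = y \<otimes>\<^bsub>D\<^esub> x" by (simp_all add: cls_mult A.m_comm)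
    fix z assume z: "z \<in> carrier D"
    from D_common3[OF xy z] obtain n a b c where "a \<in> carrier A" "b \<in> carrier A" "c \<in> carrier A" "x = cls n a" "y = cls n b" "z = cls n c" .
    then show "x \<otimes>\<^bsub>D\<^esub> y \<otimes>\<^bsub>D\<^esub> z = x \<otimes>\<^bsub>D\<^esub> (y \<otimes>\<^bsub>D\<^esub> z)" by (simp add: cls_mult A.m_assoc)
  next
    fix x assume "x \<in> carrier D"
    then obtain n a where a: "a \<in> carrier A" "x = cls n a" using D_carrier by auto
    then show "\<one>\<^bsub>D\<^esub> \<otimes>\<^bsub>D\<^esub> x = x" by (simp add: cls_one[of n] cls_mult)
  qed (simp add: cls_one[of 0])
  fix x y z assume xyz: "x \<in> carrier D" "y \<in> carrier D" "z \<in> carrier D"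
  from D_common3[OF xyz] obtain n a b c where "a \<in> carrier A" "b \<in> carrier A" "c \<in> carrier A" "x = cls n a" "y = cls n b" "z = cls n c" .
  then show "(x \<oplus>\<^bsub>D\<^esub> y) \<otimes>\<^bsub>D\<^esub> z = x \<otimes>\<^bsub>D\<^esub> z \<oplus>\<^bsub>D\<^esub> y \<otimes>\<^bsub>D\<^esub> z" by (simp add: cls_mult cls_add A.l_distr)
qed

sublocale D: cring D by (rule D_cring)

lemma cls_hom: "cls n \<in> ring_hom A D"
  by (rule ring_hom_memI) (simp_all add: cls_mult cls_add cls_one[of n])

lemma dirlim_map:
  assumes g: "g \<in> ring_hom A A" and comm: "\<And>a. a \<in> carrier A \<Longrightarrow> g (\<Phi> a) = \<Phi> (g a)"
  shows "a \<in> carrier A \<Longrightarrow> dirlim_map A \<Phi> g (cls n a) = cls n (g a)"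
    and "dirlim_map A \<Phi> g \<in> ring_hom D D"
proof -
  note gc = ring_hom_closed[OF g]
  have commn: "g ((\<Phi> ^^ k) a) = (\<Phi> ^^ k) (g a)" if "a \<in> carrier A" for a k
    by (induction k) (use that comm in \<open>simp_all\<close>)
  show val: "dirlim_map A \<Phi> g (cls n a) = cls n (g a)" if a: "a \<in> carrier A" for n a
  proof -
    have "cls m (g b) = cls n (g a)" if mb: "(m, b) \<in> cls n a" for m b
    proof -
      have b: "b \<in> carrier A" "cls m b = cls n a" using mem_cls[OF mb a] by auto
      then obtain i j where ij: "m + i = n + j" "(\<Phi> ^^ i) b = (\<Phi> ^^ j) a" using cls_eq_iff a by blast
      then have "(\<Phi> ^^ i) (g b) = (\<Phi> ^^ j) (g a)" using commn a b by metis
      then show ?thesis using cls_eq_iff[of "g b" "g a" m n] gc a b ij by blast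
    qed
    then show ?thesis unfolding dirlim_map_def using cls_self[OF a] by blast
  qed
  show "dirlim_map A \<Phi> g \<in> ring_hom D D"
  proof (rule ring_hom_memI)
    fix x y assume xy: "x \<in> carrier D" "y \<in> carrier D"
    from D_common2[OF xy] obtain n a b where ab: "a \<in> carrier A" "b \<in> carrier A" "x = cls n a" "y = cls n b" .
    then show "dirlim_map A \<Phi> g (x \<otimes>\<^bsub>D\<^esub> y) = dirlim_map A \<Phi> g x \<otimes>\<^bsub>D\<^esub> dirlim_map A \<Phi> g y"
      "dirlim_map A \<Phi> g (x \<oplus>\<^bsub>D\<^esub> y) = dirlim_map A \<Phi> g x \<oplus>\<^bsub>D\<^esub> dirlim_map A \<Phi> g y"
      using gc by (simp_all add: cls_mult cls_add val ring_hom_mult[OF g] ring_hom_add[OF g])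
  next
    fix x assume "x \<in> carrier D"
    then show "dirlim_map A \<Phi> g x \<in> carrier D" using D_carrier val gc by fastforce
  next
    show "dirlim_map A \<Phi> g \<one>\<^bsub>D\<^esub> = \<one>\<^bsub>D\<^esub>" using val[of \<one> 0] ring_hom_one[OF g] by (simp add: cls_one[of 0])
  qed
qed

end

section \<open>Inverting p\<close>

context cring
begin

text \<open>The free factor \<open>p ^ k\<close> in the relation is what makes it transitive in the
  presence of p-torsion.\<close>

lemma frac_equiv: "equiv (UNIV \<times> carrier R) (frac_rel p R)"
proof (rule equivI)
  show "frac_rel p R \<subseteq> (UNIV \<times> carrier R) \<times> (UNIV \<times> carrier R)" by (auto simp: frac_rel_def)
  show "refl_on (UNIV \<times> carrier R) (frac_rel p R)" by (rule refl_onI) (auto simp: frac_rel_def)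
  show "sym (frac_rel p R)" by (rule symI) (auto simp: frac_rel_def, metis)
  show "trans (frac_rel p R)"
  proof (rule transI)
    fix x y z assume xy: "(x, y) \<in> frac_rel p R" and yz: "(y, z) \<in> frac_rel p R"
    obtain n a m b l c where e: "x = (n, a)" "y = (m, b)" "z = (l, c)" by (metis surj_pair)
    obtain k where k: "[(p ^ (k + m))] \<cdot> a = [(p ^ (k + n))] \<cdot> b" "a \<in> carrier R" "b \<in> carrier R" using xy e by (auto simp: frac_rel_def)
    obtain q where q: "[(p ^ (q + l))] \<cdot> b = [(p ^ (q + m))] \<cdot> c" "c \<in> carrier R" using yz e by (auto simp: frac_rel_def)
    have nn: "[(p ^ i)] \<cdot> ([(p ^ j)] \<cdot> a) = [(p ^ (i + j))] \<cdot> a" if "a \<in> carrier R" for i j a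
      using that by (simp add: nmult_nmult power_add)
    have "[(p ^ (k + q + m + l))] \<cdot> a = [(p ^ (q + l))] \<cdot> ([(p ^ (k + m))] \<cdot> a)"
      by (subst nn[OF k(2)]) (simp add: add_ac)
    also have "\<dots> = [(p ^ (k + n))] \<cdot> ([(p ^ (q + l))] \<cdot> b)"
      unfolding k(1) nn[OF k(3)] by (simp add: add_ac)
    also have "\<dots> = [(p ^ (k + q + m + n))] \<cdot> c" unfolding q(1) nn[OF q(2)] by (simp add: add_ac)
    finally show "(x, z) \<in> frac_rel p R" using e k q by (auto simp: frac_rel_def)
  qed
qed

lemma invert_p_map_class:
  assumes g: "g \<in> ring_hom R R" and a: "a \<in> carrier R"
  shows "invert_p_map p R g (frac_class p R n a) = frac_class p R n (g a)"
proof -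
  note gc = ring_hom_closed[OF g]
  have "frac_class p R m (g b) = frac_class p R n (g a)" if "(m, b) \<in> frac_class p R n a" for m b
  proof -
    obtain k where k: "[(p ^ (k + m))] \<cdot> a = [(p ^ (k + n))] \<cdot> b" "b \<in> carrier R"
      using \<open>(m, b) \<in> frac_class p R n a\<close> by (auto simp: frac_class_def frac_rel_def)
    then have "[(p ^ (k + m))] \<cdot> g a = [(p ^ (k + n))] \<cdot> g b"
      using ring_hom_nmult[OF cring_axioms cring_axioms g] a by metis
    then have "((n, g a), (m, g b)) \<in> frac_rel p R" using gc a k by (auto simp: frac_rel_def)
    then show ?thesis unfolding frac_class_def using equiv_class_eq[OF frac_equiv] by metis
  qed
  moreover have "(n, a) \<in> frac_class p R n a"
    unfolding frac_class_def using equiv_class_self[OF frac_equiv, of "(n, a)"] a by simp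
  ultimately show ?thesis unfolding invert_p_map_def by blast
qed

lemma invert_p_map_surj:
  assumes g: "g \<in> ring_hom R R" and surj: "\<And>a. a \<in> carrier R \<Longrightarrow> \<exists>b\<in>carrier R. g b = a"
  shows "invert_p_map p R g ` carrier (invert_p p R) = carrier (invert_p p R)"
proof -
  have c: "U \<in> carrier (invert_p p R) \<longleftrightarrow> (\<exists>n. \<exists>a\<in>carrier R. U = frac_class p R n a)" for U
    by (auto simp: invert_p_def frac_class_def quotient_def)
  show ?thesis
  proof (intro equalityI subsetI)
    fix U assume "U \<in> invert_p_map p R g ` carrier (invert_p p R)"
    then obtain V where V: "V \<in> carrier (invert_p p R)" "U = invert_p_map p R g V" by (rule imageE)
    then obtain n a where a: "a \<in> carrier R" "U = invert_p_map p R g (frac_class p R n a)" using c[of V] by auto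
    then have "U = frac_class p R n (g a)" using invert_p_map_class[OF g a(1)] by simp
    then show "U \<in> carrier (invert_p p R)" using c[of U] ring_hom_closed[OF g a(1)] by blast
  next
    fix U assume "U \<in> carrier (invert_p p R)"
    then obtain n a where a: "a \<in> carrier R" "U = frac_class p R n a" using c[of U] by auto
    then obtain b where b: "b \<in> carrier R" "g b = a" using surj by blast
    then have "U = invert_p_map p R g (frac_class p R n b)" using invert_p_map_class[OF g] a by simp
    then show "U \<in> invert_p_map p R g ` carrier (invert_p p R)"
      using c[of "frac_class p R n b"] b(1) by blast
  qed
qed

text \<open>An element of the kernel survives localization exactly when no power of p kills it; its
  fraction with denominator 1 then differs from zero but has the same image.\<close>

lemma invert_p_map_not_inj:
  assumes g: "g \<in> ring_hom R R" and t: "t \<in> carrier R" "g t = \<zero>" and nt: "\<And>k. [(p ^ k)] \<cdot> t \<noteq> \<zero>"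
  shows "\<not> inj_on (invert_p_map p R g) (carrier (invert_p p R))"
proof
  assume inj: "inj_on (invert_p_map p R g) (carrier (invert_p p R))"
  have c: "frac_class p R n a \<in> carrier (invert_p p R)" if "a \<in> carrier R" for n a
    using that by (auto simp: invert_p_def frac_class_def quotient_def)
  have "invert_p_map p R g (frac_class p R 0 t) = invert_p_map p R g (frac_class p R 0 \<zero>)"
    using t ring_hom_zero[OF g ring_axioms ring_axioms] by (simp add: invert_p_map_class[OF g])
  then have "frac_class p R 0 t = frac_class p R 0 \<zero>" using inj c t(1) by (simp add: inj_on_def)
  then have "((0, t), (0, \<zero>)) \<in> frac_rel p R"
    unfolding frac_class_def using eq_equiv_class_iff[OF frac_equiv, of "(0, t)" "(0, \<zero>)"] t(1) by simp
  then obtain k where "[(p ^ k)] \<cdot> t = [(p ^ k)] \<cdot> \<zero>" by (auto simp: frac_rel_def)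
  then show False using nt by simp
qed

end

section \<open>Surjectivity and the kernel\<close>

context base_map
begin

abbreviation "kA \<equiv> K_aut p R \<phi> \<pi>"

sublocale T: tensor R "\<lambda>r. to_jet p R (jet_const r)" "to_K_int p R \<pi>" J K0
  by unfold_locales (auto simp: J_cring K0_cring toK_closed jR_def[symmetric])

abbreviation "AA \<equiv> ring_A p R \<pi>"

lemma AA_eq: "AA = T.TR" by (simp add: ring_A_def)

lemma AA_cring: "cring AA" unfolding AA_eq by (rule T.TR_cring)

sublocale AA: cring AA by (rule AA_cring)

abbreviation "AH \<equiv> ring_A_hat p R \<pi>"

lemma AH_eq: "AH = p_completion p AA" by (simp add: ring_A_hat_def)

lemma AH_cring: "cring AH" unfolding AH_eq by (rule AA.completion_cring)

sublocale AH: cring AH by (rule AH_cring)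

lemma kA_hom: "kA \<in> ring_hom K0 K0" using K_aut(1) by (simp add: ring_iso_def)

definition mPhi where "mPhi = map_A p R \<pi> fJ kA"
definition mU where "mU = map_A p R \<pi> uJ (\<lambda>c. c)"

lemma mPhi: "mPhi \<in> ring_hom AA AA"
  "a \<in> carrier J \<Longrightarrow> c \<in> carrier K0 \<Longrightarrow> mPhi (T.tens a c) = T.tens (fJ a) (kA c)"
proof -
  have s: "\<phi> s \<in> R \<and> fJ (toJ (jet_const s)) = toJ (jet_const (\<phi> s)) \<and> kA (toK s) = toK (\<phi> s)" if "s \<in> R" for s
    using that fJ(2)[OF that] K_aut(2)[OF that] hom_O(1)[OF phi_hom that] by (simp add: jR_def)
  show "mPhi \<in> ring_hom AA AA" unfolding mPhi_def map_A_def AA_eq by (rule T.tensor_map_hom(1)[OF fJ(1) kA_hom s])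
  show "a \<in> carrier J \<Longrightarrow> c \<in> carrier K0 \<Longrightarrow> mPhi (T.tens a c) = T.tens (fJ a) (kA c)"
    unfolding mPhi_def map_A_def by (rule T.tensor_map_hom(2)[OF fJ(1) kA_hom s])
qed

lemma mU: "mU \<in> ring_hom AA AA"
  "a \<in> carrier J \<Longrightarrow> c \<in> carrier K0 \<Longrightarrow> mU (T.tens a c) = T.tens (uJ a) c"
proof -
  have s: "s \<in> R \<and> uJ (toJ (jet_const s)) = toJ (jet_const s) \<and> toK s = toK s" if "s \<in> R" for s
    using that uJ(2)[OF that] by (simp add: jR_def)
  have i: "(\<lambda>c. c) \<in> ring_hom K0 K0" using id_ring_hom[of K0] by (simp add: id_def)
  show "mU \<in> ring_hom AA AA" unfolding mU_def map_A_def AA_eq by (rule T.tensor_map_hom(1)[OF uJ(1) i s])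
  show "a \<in> carrier J \<Longrightarrow> c \<in> carrier K0 \<Longrightarrow> mU (T.tens a c) = T.tens (uJ a) c"
    unfolding mU_def map_A_def by (rule T.tensor_map_hom(2)[OF uJ(1) i s])
qed

text \<open>On pure tensors this is \<phi>-compatibility in the jet factor; the other factor is
  moved by \<open>kA\<close> alone.\<close>

lemma mU_mPhi: "t \<in> carrier AA \<Longrightarrow> mU (mPhi t) = mPhi (mU t)"
  unfolding AA_eq
proof (induction t rule: T.TR_induct)
  case (tens a c)
  then show ?case using uJ(4) ring_hom_closed[OF fJ(1)] ring_hom_closed[OF uJ(1)] ring_hom_closed[OF kA_hom]
    by (simp add: mPhi mU)
next
  case (minus U V)
  note h = mPhi(1)[unfolded AA_eq] and h' = mU(1)[unfolded AA_eq]
  show ?case using minus ring_hom_closed[OF h] ring_hom_closed[OF h']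
    by (simp add: ring_hom_minus[OF T.TR_cring T.TR_cring h] ring_hom_minus[OF T.TR_cring T.TR_cring h'])
qed

abbreviation "PhiH \<equiv> Phi_A_hat p R \<phi> \<pi>"
abbreviation "toA \<equiv> to_completion p AA"

definition uH where "uH = completion_map p AA mU"

lemma PhiH: "PhiH \<in> ring_hom AH AH" "t \<in> carrier AA \<Longrightarrow> PhiH (toA t) = toA (mPhi t)"
  using completion_map_hom[OF AA_cring AA_cring mPhi(1), where p = p]
  unfolding Phi_A_hat_def mPhi_def[symmetric] AH_eq by auto

lemma uH: "uH \<in> ring_hom AH AH" "t \<in> carrier AA \<Longrightarrow> uH (toA t) = toA (mU t)"
  using completion_map_hom[OF AA_cring AA_cring mU(1), where p = p] unfolding uH_def AH_eq by auto

lemma uH_PhiH: "s \<in> carrier AH \<Longrightarrow> uH (PhiH s) = PhiH (uH s)"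
proof -
  assume s: "s \<in> carrier AH"
  note h = ring_hom_trans[OF PhiH(1) uH(1), unfolded AH_eq] and h' = ring_hom_trans[OF uH(1) PhiH(1), unfolded AH_eq]
  have "(uH \<circ> PhiH) s = (PhiH \<circ> uH) s"
  proof (rule completion_hom_unique[OF AA_cring AA_cring h h'])
    show "(uH \<circ> PhiH) (toA a) = (PhiH \<circ> uH) (toA a)" if "a \<in> carrier AA" for a
      using that ring_hom_closed[OF mPhi(1)] ring_hom_closed[OF mU(1)] by (simp add: PhiH uH mU_mPhi)
  qed (use s AH_eq in simp)
  then show ?thesis by simp
qed

sublocale L: direct_limit AH PhiH
  by (rule direct_limit.intro[OF AH_cring PhiH(1)])

abbreviation "BB \<equiv> ring_B p R \<phi> \<pi>"

lemma BB_eq: "BB = L.D" by (simp add: ring_B_def)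

definition uB where "uB = dirlim_map AH PhiH uH"

lemma uB: "uB \<in> ring_hom BB BB" "a \<in> carrier AH \<Longrightarrow> uB (L.cls n a) = L.cls n (uH a)"
  unfolding uB_def BB_eq using L.dirlim_map[OF uH(1) uH_PhiH] by auto

lemma toA_hom: "toA \<in> ring_hom AA AH" unfolding AH_eq by (rule AA.to_completion_ring_hom)

lemma toA_closed: "t \<in> carrier AA \<Longrightarrow> toA t \<in> carrier AH" using ring_hom_closed[OF toA_hom] .

lemma BB_cring: "cring BB" unfolding BB_eq by (rule L.D_cring)

sublocale BB: cring BB by (rule BB_cring)

lemma cls_hom: "L.cls n \<in> ring_hom AH BB" unfolding BB_eq by (rule L.cls_hom)

text \<open>The membership facts ride along because the next step of the induction needs
  them.\<close>

lemma PhiHn_tens: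
  assumes "a \<in> carrier J" "c \<in> carrier K0"
  shows "(PhiH ^^ m) (toA (T.tens a c)) = toA (T.tens ((fJ ^^ m) a) ((kA ^^ m) c)) \<and>
    (fJ ^^ m) a \<in> carrier J \<and> (kA ^^ m) c \<in> carrier K0"
proof (induction m)
  case (Suc m)
  then show ?case
    using PhiH(2)[of "T.tens ((fJ ^^ m) a) ((kA ^^ m) c)"] mPhi(2)[of "(fJ ^^ m) a" "(kA ^^ m) c"]
      ring_hom_closed[OF fJ(1)] ring_hom_closed[OF kA_hom] by (simp add: AA_eq)
qed (use assms in simp)

lemma uB_surj_mod_p:
  assumes b: "b \<in> carrier BB" shows "\<exists>b'\<in>carrier BB. pcong p BB 1 b (uB b')"
proof -
  have uBc: "uB x \<in> carrier BB" if "x \<in> carrier BB" for x using ring_hom_closed[OF uB(1) that] .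
  have clsc: "L.cls n x \<in> carrier BB" if "x \<in> carrier AH" for n x using ring_hom_closed[OF cls_hom that] .
  have main: "\<forall>n. \<exists>b'\<in>carrier BB. pcong p BB 1 (L.cls n (toA t)) (uB b')" if "t \<in> carrier T.TR" for t
    using that
  proof (induction t rule: T.TR_induct)
    case (tens a c)
    show ?case
    proof
      fix n
      \<comment> \<open>The class of a \<otimes> c at stage n is also that of its \<Phi>^m-image at
        stage n + m, where the jet factor lies in the image modulo p. The preimage is w \<otimes>
        \<Phi>^m(c) at that later stage.\<close>
      obtain m w where w: "w \<in> carrier J" "pcong p J 1 ((fJ ^^ m) a) (uJ w)" using image_mod_p[OF tens(1)] by blast
      let ?c = "(kA ^^ m) c"
      have e: "(PhiH ^^ m) (toA (T.tens a c)) = toA (T.tens ((fJ ^^ m) a) ?c)" "(fJ ^^ m) a \<in> carrier J" "?c \<in> carrier K0"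
        using PhiHn_tens[OF tens] by auto
      have tc: "T.tens a c \<in> carrier AA" "T.tens w ?c \<in> carrier AA" using tens w e by (simp_all add: AA_eq)
      have "pcong p AA 1 (T.tens ((fJ ^^ m) a) ?c) (T.tens (uJ w) ?c)"
        unfolding AA_eq using T.tens_pcong[OF w(2) e(3)] .
      from pcong_hom[OF AH_cring BB_cring cls_hom[of "n + m"] pcong_hom[OF AA_cring AH_cring toA_hom this]]
      have "pcong p BB 1 (L.cls (n + m) ((PhiH ^^ m) (toA (T.tens a c)))) (L.cls (n + m) (toA (mU (T.tens w ?c))))"
        using e w mU(2) by simp
      moreover have "L.cls (n + m) (toA (mU (T.tens w ?c))) = uB (L.cls (n + m) (toA (T.tens w ?c)))"
        using uB(2)[OF toA_closed[OF tc(2)]] uH(2)[OF tc(2)] by simp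
      ultimately have "pcong p BB 1 (L.cls n (toA (T.tens a c))) (uB (L.cls (n + m) (toA (T.tens w ?c))))"
        using L.cls_shift[OF toA_closed[OF tc(1)], of n m] by simp
      then show "\<exists>b'\<in>carrier BB. pcong p BB 1 (L.cls n (toA (T.tens a c))) (uB b')"
        using clsc toA_closed tc by blast
    qed
  next
    case (minus U V)
    show ?case
    proof
      fix n
      obtain b b' where bb: "b \<in> carrier BB" "pcong p BB 1 (L.cls n (toA U)) (uB b)"
        "b' \<in> carrier BB" "pcong p BB 1 (L.cls n (toA V)) (uB b')" using minus(3,4) by blast
      have UV: "U \<in> carrier AA" "V \<in> carrier AA" using minus AA_eq by auto
      have "L.cls n (toA (U \<ominus>\<^bsub>AA\<^esub> V)) = L.cls n (toA U) \<ominus>\<^bsub>BB\<^esub> L.cls n (toA V)"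
        using ring_hom_minus[OF AA_cring AH_cring toA_hom UV] ring_hom_minus[OF AH_cring BB_cring cls_hom toA_closed[OF UV(1)] toA_closed[OF UV(2)]] by simp
      moreover have "uB (b \<ominus>\<^bsub>BB\<^esub> b') = uB b \<ominus>\<^bsub>BB\<^esub> uB b'" by (rule ring_hom_minus[OF BB_cring BB_cring uB(1) bb(1,3)])
      ultimately show "\<exists>b'\<in>carrier BB. pcong p BB 1 (L.cls n (toA (U \<ominus>\<^bsub>T.TR\<^esub> V))) (uB b')"
        using BB.pcong_minus[OF bb(2,4)] BB.minus_closed[OF bb(1,3)] AA_eq[symmetric]
        by (intro bexI[of _ "b \<ominus>\<^bsub>BB\<^esub> b'"]) simp_all
    qed
  qed
  obtain n a where a: "a \<in> carrier AH" "b = L.cls n a" using b BB_eq L.D_carrier by auto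
  \<comment> \<open>Modulo p the inner completion is invisible, so a may be replaced by an element
    of the tensor product.\<close>
  obtain t where t: "t \<in> carrier AA" "pcong p AH 1 a (toA t)" using AA.completion_approx a unfolding AH_eq by blast
  have "pcong p BB 1 b (L.cls n (toA t))" unfolding a by (rule pcong_hom[OF AH_cring BB_cring cls_hom t(2)])
  then show ?thesis using main[OF t(1)[unfolded AA_eq]] BB.pcong_trans by blast
qed

abbreviation "BH \<equiv> p_completion p BB"

definition uBH where "uBH = completion_map p BB uB"

lemma BH_cring: "cring BH" by (rule BB.completion_cring)

sublocale BH: cring BH by (rule BH_cring)

lemma uBH: "uBH \<in> ring_hom BH BH" "b \<in> carrier BB \<Longrightarrow> uBH (to_completion p BB b) = to_completion p BB (uB b)"
  using completion_map_hom[OF BB_cring BB_cring uB(1), where p = p] unfolding uBH_def by auto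

lemma uBH_surj: "s \<in> carrier BH \<Longrightarrow> \<exists>s'\<in>carrier BH. uBH s' = s"
  unfolding uBH_def by (rule completion_map_surj[OF BB_cring BB_cring uB(1) uB_surj_mod_p])

section \<open>An element of the kernel that no power of p kills\<close>

definition tau where "tau = T.tens (jX 1) \<one>\<^bsub>K0\<^esub>"

lemma tau: "tau \<in> carrier AA" by (simp add: tau_def AA_eq)

text \<open>The coordinates are independent, so all of them may be sent to 1. The evaluation is
  \<open>R\<close>-linear through \<open>toK\<close>, as the tensor product requires.\<close>

lemma tau_evaluation: "\<exists>\<Theta>\<in>ring_hom AA K0. \<Theta> tau = \<one>\<^bsub>K0\<^esub>"
proof -
  have h: "toK \<in> ring_hom \<O> (p_completion p KU)"
  proof -
    have "(\<lambda>x. x) \<in> ring_hom \<O> KU" by (auto simp: ring_hom_def KU_eq KK_R)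
    from ring_hom_trans[OF this toK_hom] show ?thesis by (simp add: comp_def K_int_def)
  qed
  obtain g where g: "g \<in> ring_hom J K0" "\<And>r. r \<in> R \<Longrightarrow> g (jR r) = toK r" "\<And>i. g (jX i) = \<one>\<^bsub>K0\<^esub>"
    using J_hom_exists[OF KU_cring h, of "\<lambda>i. \<one>\<^bsub>K0\<^esub>" "\<one>\<^bsub>K0\<^esub>"] K0.one_closed K0.r_one[OF K0.one_closed]
    unfolding K_int_def by auto
  have i: "(\<lambda>c. c) \<in> ring_hom K0 K0" using id_ring_hom[of K0] by (simp add: id_def)
  obtain \<Theta> where Th: "\<Theta> \<in> ring_hom T.TR K0" "\<And>a c. a \<in> carrier J \<Longrightarrow> c \<in> carrier K0 \<Longrightarrow> \<Theta> (T.tens a c) = g a \<otimes>\<^bsub>K0\<^esub> c"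
    using T.tensor_hom_exists[OF K0_cring g(1) i] g(2) by (auto simp: jR_def)
  then have "\<Theta> tau = \<one>\<^bsub>K0\<^esub>" by (simp add: tau_def g(3))
  then show ?thesis using Th(1) AA_eq by auto
qed

text \<open>Evaluation sends every power of x' to 1, so divisibility would put p^k into p^(k+1)
  \<bbbK>\<degree>. Cancelling p^k leaves 1 divisible by p.\<close>

lemma tau_power_not_divisible: "\<not> pcong p AH (Suc k) ([(p ^ k)] \<cdot>\<^bsub>AH\<^esub> (toA tau [^]\<^bsub>AH\<^esub> (n::nat))) \<zero>\<^bsub>AH\<^esub>"
proof
  assume H: "pcong p AH (Suc k) ([(p ^ k)] \<cdot>\<^bsub>AH\<^esub> (toA tau [^]\<^bsub>AH\<^esub> n)) \<zero>\<^bsub>AH\<^esub>"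
  obtain \<Theta> where Th: "\<Theta> \<in> ring_hom AA K0" "\<Theta> tau = \<one>\<^bsub>K0\<^esub>" using tau_evaluation by blast
  let ?t = "[(p ^ k)] \<cdot>\<^bsub>AA\<^esub> (tau [^]\<^bsub>AA\<^esub> n)"
  have "[(p ^ k)] \<cdot>\<^bsub>AH\<^esub> (toA tau [^]\<^bsub>AH\<^esub> n) = toA ?t"
    using tau by (simp add: ring_hom_nmult[OF AA_cring AH_cring toA_hom] ring_hom_pow'[OF AA_cring AH_cring toA_hom])
  moreover have "\<zero>\<^bsub>AH\<^esub> = toA \<zero>\<^bsub>AA\<^esub>" using ring_hom_zero[OF toA_hom AA.ring_axioms AH.ring_axioms] by simp
  ultimately have "pcong p AH (Suc k) (toA ?t) (toA \<zero>\<^bsub>AA\<^esub>)" using H by simp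
  \<comment> \<open>Component k + 1 brings the congruence back to the uncompleted tensor product, on
    which the evaluation is defined.\<close>
  then have "toA ?t (Suc k) = toA \<zero>\<^bsub>AA\<^esub> (Suc k)" unfolding AH_eq by (rule AA.completion_pcongD)
  then have "pcong p AA (Suc k) ?t \<zero>\<^bsub>AA\<^esub>" using AA.to_completion_eq_iff tau by simp
  from pcong_hom[OF AA_cring K0_cring Th(1) this]
  have "pcong p K0 (Suc k) ([(p ^ k)] \<cdot>\<^bsub>K0\<^esub> \<one>\<^bsub>K0\<^esub>) \<zero>\<^bsub>K0\<^esub>"
    using tau Th by (simp add: ring_hom_nmult[OF AA_cring K0_cring Th(1)] ring_hom_pow'[OF AA_cring K0_cring Th(1)]
        ring_hom_zero[OF Th(1) AA.ring_axioms K0.ring_axioms])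
  then obtain c where c: "c \<in> carrier K0" "[(p ^ k)] \<cdot>\<^bsub>K0\<^esub> \<one>\<^bsub>K0\<^esub> = [(p ^ Suc k)] \<cdot>\<^bsub>K0\<^esub> c" unfolding K0.pcong_zero_iff by blast
  have canc: "a = \<zero>\<^bsub>K0\<^esub>" if "a \<in> carrier K0" "[(p ^ k)] \<cdot>\<^bsub>K0\<^esub> a = \<zero>\<^bsub>K0\<^esub>" for a k
    using that
  proof (induction k arbitrary: a)
    case (Suc k)
    have "[(p ^ k)] \<cdot>\<^bsub>K0\<^esub> ([p] \<cdot>\<^bsub>K0\<^esub> a) = \<zero>\<^bsub>K0\<^esub>" using Suc(2,3) by (simp add: K0.nmult_nmult mult.commute)
    then have "[p] \<cdot>\<^bsub>K0\<^esub> a = \<zero>\<^bsub>K0\<^esub>" using Suc.IH[of "[p] \<cdot>\<^bsub>K0\<^esub> a"] Suc(2) by simp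
    then show ?case using K0_torsion_free Suc(2) by blast
  qed simp
  have "[(p ^ k)] \<cdot>\<^bsub>K0\<^esub> (\<one>\<^bsub>K0\<^esub> \<ominus>\<^bsub>K0\<^esub> [p] \<cdot>\<^bsub>K0\<^esub> c) = \<zero>\<^bsub>K0\<^esub>"
  proof -
    have "[(p ^ k)] \<cdot>\<^bsub>K0\<^esub> ([p] \<cdot>\<^bsub>K0\<^esub> c) = [(p ^ Suc k)] \<cdot>\<^bsub>K0\<^esub> c" using c(1) by (simp add: K0.nmult_nmult mult.commute)
    then show ?thesis using c by (simp add: K0.nmult_minus)
  qed
  then have "\<one>\<^bsub>K0\<^esub> \<ominus>\<^bsub>K0\<^esub> [p] \<cdot>\<^bsub>K0\<^esub> c = \<zero>\<^bsub>K0\<^esub>" by (rule canc[rotated]) (use c(1) in simp)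
  then have "\<one>\<^bsub>K0\<^esub> = [p] \<cdot>\<^bsub>K0\<^esub> c" using c(1) by simp
  then have "pcong p K0 1 \<one>\<^bsub>K0\<^esub> \<zero>\<^bsub>K0\<^esub>" using K0.pcong_p_zero[OF c(1), of p 1] by simp
  then show False using K0_one by blast
qed

lemma PhiH_tau: "pcong p AH 1 ((PhiH ^^ m) (toA tau)) (toA tau [^]\<^bsub>AH\<^esub> (p ^ m))"
proof -
  have k1: "(kA ^^ m) \<one>\<^bsub>K0\<^esub> = \<one>\<^bsub>K0\<^esub>" by (induction m) (simp_all add: ring_hom_one[OF kA_hom])
  have "pcong p J 1 ((fJ ^^ m) (jX 1)) (jX 1 [^]\<^bsub>J\<^esub> (p ^ m))" using FH.frob_iter by simp
  from pcong_hom[OF AA_cring AH_cring toA_hom, OF T.tens_pcong[OF this K0.one_closed, folded AA_eq]]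
  have "pcong p AH 1 (toA (T.tens ((fJ ^^ m) (jX 1)) \<one>\<^bsub>K0\<^esub>)) (toA (T.tens (jX 1 [^]\<^bsub>J\<^esub> (p ^ m)) \<one>\<^bsub>K0\<^esub>))" .
  moreover have "toA (T.tens (jX 1 [^]\<^bsub>J\<^esub> (p ^ m)) \<one>\<^bsub>K0\<^esub>) = toA tau [^]\<^bsub>AH\<^esub> (p ^ m)"
    using ring_hom_pow'[OF AA_cring AH_cring toA_hom tau, of "p ^ m"] T.tens_pow[of "jX 1" "\<one>\<^bsub>K0\<^esub>" "p ^ m"]
    by (simp add: tau_def AA_eq)
  moreover have "(PhiH ^^ m) (toA tau) = toA (T.tens ((fJ ^^ m) (jX 1)) \<one>\<^bsub>K0\<^esub>)"
    unfolding tau_def using PhiHn_tens[of "jX 1" "\<one>\<^bsub>K0\<^esub>" m] k1 by simp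
  ultimately show ?thesis by simp
qed

text \<open>The limit \<open>teich\<close> of this sequence is the Teichmueller lift of \<open>x'\<close>.\<close>

definition tseq where "tseq n = L.cls n (toA tau [^]\<^bsub>AH\<^esub> (p ^ n))"

text \<open>Moved to stage n + 1, consecutive terms are the p^n-th powers of \<Phi>(x') and x'^p.
  These agree modulo p, hence their p^n-th powers agree modulo p^(n+1).\<close>

lemma tseq_coherent: "coherent p BB tseq"
  unfolding coherent_def
proof
  fix n
  let ?a = "toA tau"
  have a: "?a \<in> carrier AH" by (rule toA_closed[OF tau])
  have "pcong p AH 1 (PhiH ?a) (?a [^]\<^bsub>AH\<^esub> p)" using PhiH_tau[of 1] by simp
  from AH.pcong_pow_p_pow[OF p(1) this, of n]
  have "pcong p AH n ((PhiH ?a) [^]\<^bsub>AH\<^esub> (p ^ n)) ((?a [^]\<^bsub>AH\<^esub> p) [^]\<^bsub>AH\<^esub> (p ^ n))" by (rule AH.pcong_mono) simp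
  from pcong_hom[OF AH_cring BB_cring cls_hom[of "Suc n"] this]
  have "pcong p BB n (L.cls (Suc n) ((PhiH ?a) [^]\<^bsub>AH\<^esub> (p ^ n))) (L.cls (Suc n) ((?a [^]\<^bsub>AH\<^esub> p) [^]\<^bsub>AH\<^esub> (p ^ n)))" .
  moreover have "L.cls (Suc n) ((PhiH ?a) [^]\<^bsub>AH\<^esub> (p ^ n)) = tseq n"
    unfolding tseq_def using L.cls_shift[of "?a [^]\<^bsub>AH\<^esub> (p ^ n)" n 1] a
    by (simp add: ring_hom_pow'[OF AH_cring AH_cring PhiH(1)])
  moreover have "L.cls (Suc n) ((?a [^]\<^bsub>AH\<^esub> p) [^]\<^bsub>AH\<^esub> (p ^ n)) = tseq (Suc n)"
    unfolding tseq_def using a by (simp add: AH.nat_pow_pow)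
  ultimately show "pcong p BB n (tseq (Suc n)) (tseq n)" using BB.pcong_sym by simp
qed

definition teich where "teich = lim_seq p BB tseq"

lemma teich_closed: "teich \<in> carrier BH" unfolding teich_def by (rule BB.lim_seq_in[OF tseq_coherent])

lemma teich_approx: "pcong p BH n teich (to_completion p BB (tseq n))"
proof -
  have "to_completion p BB (tseq n) \<in> carrier BH"
    using ring_hom_closed[OF BB.to_completion_ring_hom] BB.coherent_carr[OF tseq_coherent] by blast
  then show ?thesis using BB.completion_pcong_iff[OF teich_closed] by (simp add: teich_def lim_seq_def)
qed

text \<open>The image of x' is p c, so the image of the n-th approximation is divisible by p to the
  power p^n, hence by p^n; it tends to zero.\<close>

lemma uBH_teich: "uBH teich = \<zero>\<^bsub>BH\<^esub>"
proof (rule BB.completion_eqI)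
  fix n
  have tc: "tseq n \<in> carrier BB" by (rule BB.coherent_carr[OF tseq_coherent])
  have a: "toA tau \<in> carrier AH" by (rule toA_closed[OF tau])
  have "uH (toA tau) = toA (T.tens (uJ (jX 1)) \<one>\<^bsub>K0\<^esub>)"
    using uH(2)[OF tau] mU(2)[of "jX 1" "\<one>\<^bsub>K0\<^esub>"] by (simp add: tau_def)
  moreover have "pcong p AH 1 (toA (T.tens (uJ (jX 1)) \<one>\<^bsub>K0\<^esub>)) (toA (T.tens \<zero>\<^bsub>J\<^esub> \<one>\<^bsub>K0\<^esub>))"
    using pcong_hom[OF AA_cring AH_cring toA_hom, OF T.tens_pcong[OF uJ_var_1 K0.one_closed, folded AA_eq]] .
  moreover have "toA (T.tens \<zero>\<^bsub>J\<^esub> \<one>\<^bsub>K0\<^esub>) = \<zero>\<^bsub>AH\<^esub>"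
    using T.tens_nmult[of "\<zero>\<^bsub>J\<^esub>" "\<one>\<^bsub>K0\<^esub>" 0] ring_hom_zero[OF toA_hom AA.ring_axioms AH.ring_axioms]
    by (simp add: AA_eq)
  ultimately have "pcong p AH 1 (uH (toA tau)) \<zero>\<^bsub>AH\<^esub>" by simp
  then obtain c where c: "c \<in> carrier AH" "uH (toA tau) = [p] \<cdot>\<^bsub>AH\<^esub> c" unfolding AH.pcong_zero_iff by auto
  have "uH (toA tau [^]\<^bsub>AH\<^esub> (p ^ n)) = [(p ^ (p ^ n))] \<cdot>\<^bsub>AH\<^esub> (c [^]\<^bsub>AH\<^esub> (p ^ n))"
    using a c by (simp add: ring_hom_pow'[OF AH_cring AH_cring uH(1)] AH.nmult_pow)
  then have "pcong p AH (p ^ n) (uH (toA tau [^]\<^bsub>AH\<^esub> (p ^ n))) \<zero>\<^bsub>AH\<^esub>" using AH.pcong_p_zero[of "c [^]\<^bsub>AH\<^esub> (p ^ n)" p "p ^ n"] c(1) by simp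
  moreover have "n \<le> p ^ n" using less_exp[of n] power_mono[OF prime_ge_2_nat[OF p(1)], of n] by linarith
  ultimately have "pcong p AH n (uH (toA tau [^]\<^bsub>AH\<^esub> (p ^ n))) \<zero>\<^bsub>AH\<^esub>" by (rule AH.pcong_mono)
  from pcong_hom[OF AH_cring BB_cring cls_hom[of n] this]
  have "pcong p BB n (uB (tseq n)) \<zero>\<^bsub>BB\<^esub>"
    unfolding tseq_def using uB(2)[of "toA tau [^]\<^bsub>AH\<^esub> (p ^ n)" n] a
      ring_hom_zero[OF cls_hom AH.ring_axioms BB.ring_axioms] by simp
  from pcong_hom[OF BB_cring BH_cring BB.to_completion_ring_hom this]
  have "pcong p BH n (to_completion p BB (uB (tseq n))) \<zero>\<^bsub>BH\<^esub>"
    using ring_hom_zero[OF BB.to_completion_ring_hom BB.ring_axioms BH.ring_axioms] by simp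
  moreover have "pcong p BH n (uBH teich) (to_completion p BB (uB (tseq n)))"
    using pcong_hom[OF BH_cring BH_cring uBH(1) teich_approx[of n]] uBH(2)[OF tc] by simp
  ultimately show "pcong p BH n (uBH teich) \<zero>\<^bsub>BH\<^esub>" using BH.pcong_trans by blast
qed (use ring_hom_closed[OF uBH(1) teich_closed] in auto)

text \<open>Vanishing of p^k times the limit is tested modulo p^(k+1), with the approximation of
  index k + 1. Equality in the direct limit becomes an equality in the completed tensor product
  after finitely many applications of \<Phi>, and there \<open>tau_power_not_divisible\<close>
  contradicts it.\<close>

lemma teich_nonzero: "[(p ^ k)] \<cdot>\<^bsub>BH\<^esub> teich \<noteq> \<zero>\<^bsub>BH\<^esub>"
proof
  assume z: "[(p ^ k)] \<cdot>\<^bsub>BH\<^esub> teich = \<zero>\<^bsub>BH\<^esub>"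
  let ?n = "Suc k" and ?a = "toA tau"
  let ?x = "[(p ^ k)] \<cdot>\<^bsub>AH\<^esub> (?a [^]\<^bsub>AH\<^esub> (p ^ ?n))"
  have a: "?a \<in> carrier AH" by (rule toA_closed[OF tau])
  have tc: "tseq ?n \<in> carrier BB" by (rule BB.coherent_carr[OF tseq_coherent])
  have "pcong p BH ?n \<zero>\<^bsub>BH\<^esub> ([(p ^ k)] \<cdot>\<^bsub>BH\<^esub> to_completion p BB (tseq ?n))"
    using BH.pcong_nmult_any[OF teich_approx[of ?n], of "p ^ k"] z by simp
  moreover have "[(p ^ k)] \<cdot>\<^bsub>BH\<^esub> to_completion p BB (tseq ?n) = to_completion p BB ([(p ^ k)] \<cdot>\<^bsub>BB\<^esub> tseq ?n)"
    using ring_hom_nmult[OF BB_cring BH_cring BB.to_completion_ring_hom tc] by simp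
  moreover have "\<zero>\<^bsub>BH\<^esub> = to_completion p BB \<zero>\<^bsub>BB\<^esub>" using ring_hom_zero[OF BB.to_completion_ring_hom BB.ring_axioms BH.ring_axioms] by simp
  ultimately have "pcong p BH ?n (to_completion p BB \<zero>\<^bsub>BB\<^esub>) (to_completion p BB ([(p ^ k)] \<cdot>\<^bsub>BB\<^esub> tseq ?n))" by simp
  then have "to_completion p BB \<zero>\<^bsub>BB\<^esub> ?n = to_completion p BB ([(p ^ k)] \<cdot>\<^bsub>BB\<^esub> tseq ?n) ?n"
    by (rule BB.completion_pcongD)
  then have "pcong p BB ?n ([(p ^ k)] \<cdot>\<^bsub>BB\<^esub> tseq ?n) \<zero>\<^bsub>BB\<^esub>"
    using BB.to_completion_eq_iff[of "\<zero>\<^bsub>BB\<^esub>" "[(p ^ k)] \<cdot>\<^bsub>BB\<^esub> tseq ?n"] tc BB.pcong_sym by simp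
  moreover have "[(p ^ k)] \<cdot>\<^bsub>BB\<^esub> tseq ?n = L.cls ?n ?x"
    unfolding tseq_def using ring_hom_nmult[OF AH_cring BB_cring cls_hom[of ?n], where a = "?a [^]\<^bsub>AH\<^esub> (p ^ ?n)" and k = "p ^ k"] a
    by (simp del: power_Suc)
  ultimately obtain d where d: "d \<in> carrier BB" "L.cls ?n ?x = [(p ^ ?n)] \<cdot>\<^bsub>BB\<^esub> d" unfolding BB.pcong_zero_iff by auto
  obtain m b where b: "b \<in> carrier AH" "d = L.cls m b" using d(1) BB_eq L.D_carrier by auto
  have "L.cls ?n ?x = L.cls m ([(p ^ ?n)] \<cdot>\<^bsub>AH\<^esub> b)"
    using d(2) b ring_hom_nmult[OF AH_cring BB_cring cls_hom[of m] b(1), where k = "p ^ ?n"] by simp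
  then obtain i j where ij: "(PhiH ^^ i) ?x = (PhiH ^^ j) ([(p ^ ?n)] \<cdot>\<^bsub>AH\<^esub> b)"
    using L.cls_eq_iff[of ?x "[(p ^ ?n)] \<cdot>\<^bsub>AH\<^esub> b" ?n m] a b(1) by auto
  have xi: "(PhiH ^^ i) ?x = [(p ^ k)] \<cdot>\<^bsub>AH\<^esub> ((PhiH ^^ i) ?a [^]\<^bsub>AH\<^esub> (p ^ ?n))" using a by simp
  have "(PhiH ^^ j) ([(p ^ ?n)] \<cdot>\<^bsub>AH\<^esub> b) = [(p ^ ?n)] \<cdot>\<^bsub>AH\<^esub> ((PhiH ^^ j) b)" using b(1) by simp
  then have 1: "pcong p AH ?n ([(p ^ k)] \<cdot>\<^bsub>AH\<^esub> ((PhiH ^^ i) ?a [^]\<^bsub>AH\<^esub> (p ^ ?n))) \<zero>\<^bsub>AH\<^esub>"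
    using ij xi AH.pcong_p_zero[of "(PhiH ^^ j) b" p ?n] b(1) by simp
  \<comment> \<open>\<Phi>^i(x') is known only modulo p, but the factor p^k raises this to a
    congruence modulo p^(k+1), exactly the level in question.\<close>
  have "pcong p AH 1 ((PhiH ^^ i) ?a [^]\<^bsub>AH\<^esub> (p ^ ?n)) ((?a [^]\<^bsub>AH\<^esub> (p ^ i)) [^]\<^bsub>AH\<^esub> (p ^ ?n))"
    by (rule AH.pcong_pow[OF PhiH_tau])
  from AH.pcong_nmult[OF this, of k]
  have 2: "pcong p AH ?n ([(p ^ k)] \<cdot>\<^bsub>AH\<^esub> ((PhiH ^^ i) ?a [^]\<^bsub>AH\<^esub> (p ^ ?n))) ([(p ^ k)] \<cdot>\<^bsub>AH\<^esub> (?a [^]\<^bsub>AH\<^esub> (p ^ i * p ^ ?n)))"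
    using a by (simp add: AH.nat_pow_pow)
  show False using AH.pcong_trans[OF AH.pcong_sym[OF 2] 1] tau_power_not_divisible by blast
qed

lemma P_infty_map_eq: "P_infty_map p R \<phi> \<pi> u = invert_p_map p BH uBH"
  unfolding P_infty_map_def uBH_def uB_def uH_def mU_def ..

lemma P_infty_eq: "P_infty p R \<phi> \<pi> = invert_p p BH"
  unfolding P_infty_def ..

end

theorem theorem4p1:
  fixes p :: nat
    and R :: "'k::field set"
    and \<phi> :: "'k \<Rightarrow> 'k"
    and \<pi> :: "nat \<Rightarrow> 'k"
    and u :: "'k jet_poly \<Rightarrow> 'k jet_poly"
  assumes p: "Factorial_Ring.prime p" "odd p"
    and subring: "subring R ring_of_type_algebra"
    and dvr: "complete_dvr_at p (sub_of_type R)"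
    and residue: "algebraically_closed (sub_of_type R Quot p_ideal p (sub_of_type R) 1)"
    and frob: "frobenius_lift p (sub_of_type R) \<phi>"
    and roots: "\<pi> 0 = of_nat p" "\<And>m. \<pi> (Suc m) ^ p = \<pi> m"
    and u_hom: "u \<in> ring_hom (laurent_ring R) (laurent_ring R)"
    and u_const: "\<And>r. r \<in> R \<Longrightarrow> u (jet_const r) = jet_const r"
    and u_var: "u (jet_var 0) = jet_var 0 ^ p"
  shows "P_infty_map p R \<phi> \<pi> u ` carrier (P_infty p R \<phi> \<pi>) = carrier (P_infty p R \<phi> \<pi>) \<and>
    \<not> inj_on (P_infty_map p R \<phi> \<pi> u) (carrier (P_infty p R \<phi> \<pi>))"
proof -
  interpret base_map p R \<phi> \<pi> u
    by (rule base_map.intro[OF base.intro[OF p subring dvr residue frob roots]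
          base_map_axioms.intro[OF u_hom u_const u_var]])
  show ?thesis
    unfolding P_infty_map_eq P_infty_eq
    using BH.invert_p_map_surj[OF uBH(1) uBH_surj]
      BH.invert_p_map_not_inj[OF uBH(1) teich_closed uBH_teich teich_nonzero] by (rule conjI)
qed

end
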